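(* Let $f\colon\mathbb R^n\times\mathbb R^d\to\mathbb R^n$ and $\varphi_1,\dots,\varphi_m\colon\mathbb R^n\times\mathbb R^d\to\mathbb R$, and let $C(p):=\{x\in\mathbb R^n:\varphi_i(x,p)\le0,\ i=1,\dots,m\}$. Let $(\bar x,\bar v,\bar p)\in\mathbb R^n\times\mathbb R^n\times\mathbb R^d$ satisfy $\bar x\in\breve S(\bar v,\bar p)$, where $\breve S(v,p):=\{x\in\mathbb R^n: v\in f(x,p)+N_{C(p)}(x)\}$. Suppose that the $\varphi_i$ are $\mathcal C^2$-smooth around $(\bar x,\bar p)$, that $f$ is differentiable with respect to $x$ at all points $(x,p)$ around $(\bar x,\bar p)$, that $\nabla_xf$ is continuous at $(\bar x,\bar p)$, that there are a neighborhood $U_0\times P_0$ of $(\bar x,\bar p)$ and a constant $L_0>0$ with $\|f(x,p_1)-f(x,p_2)\|\le L_0\|p_1-p_2\|$ for all $x\in U_0$, $p_1,p_2\in P_0$, and that both the partial MFCQ and the partial CRCQ hold at $(\bar x,\bar p)$. Then the following are equivalent: (i) $\bar x$ is a Lipschitzian fully stable solution of the parametric variational condition $v\in f(x,p)+N_{C(p)}(x)$ corresponding to $(\bar v,\bar p)$. (ii) The general uniform second-order sufficient condition (GUSOSC) holds at $(\bar x,\bar p)$ with $\bar v\in\Psi(\bar x,\bar p)$. Consequently, the validity of GUSOSC at $(\bar x,\bar p)$ with $\bar v\in\Psi(\bar x,\bar p)$ ensures that $\breve S$ admits a single-valued and Lipschitz continuous localization around $(\bar v,\bar p,\bar x)$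.
   Context: $N_\Omega$ is the limiting normal cone: $\widehat N_\Omega(\bar z)=\{\zeta:\limsup_{z\to\bar z,\,z\in\Omega}\langle\zeta,z-\bar z\rangle/\|z-\bar z\|\le0\}$ and $N_\Omega(\bar z)$ is the set of limits $\lim\zeta_k$ with $\zeta_k\in\widehat N_\Omega(z_k)$, $z_k\in\Omega$, $z_k\to\bar z$ (empty if $\bar z\notin\Omega$). Notation. $I(x,p)=\{i:\varphi_i(x,p)=0\}$ for feasible $(x,p)$; $\varphi=(\varphi_1,\dots,\varphi_m)$; $L(x,p,\lambda)=f(x,p)+\sum_{i=1}^m\lambda_i\nabla_x\varphi_i(x,p)$ for $\lambda\in\mathbb R^m$; $\Psi(x,p)=\{L(x,p,\lambda):\lambda\in N_{\mathbb R^m_-}(\varphi(x,p))\}$; $\Lambda(x,p,v)=\{\lambda\in\mathbb R^m_+: v=L(x,p,\lambda),\ \langle\lambda,\varphi(x,p)\rangle=0\}$; $I_+(x,p,\lambda)=\{i\in I(x,p):\lambda_i>0\}$. Partial MFCQ at $(\bar x,\bar p)$: there is $d\in\mathbb R^n$ with $\langle\nabla_x\varphi_i(\bar x,\bar p),d\rangle<0$ for all $i\in I(\bar x,\bar p)$. Partial CRCQ at $(\bar x,\bar p)$: there is a neighborhood $W$ of $(\bar x,\bar p)$ such that for every $J\subset I(\bar x,\bar p)$ the family $\{\nabla_x\varphi_i(x,p):i\in J\}$ has the same rank for all $(x,p)\in W$. GUSOSC at $(\bar x,\bar p)$ with $\bar v\in\Psi(\bar x,\bar p)$: there are $\eta,\ell>0$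 such that for all $(x,p,v)\in\mathrm{gph}\,\Psi$ in the closed $\eta$-ball $\mathbb B_\eta(\bar x)\times\mathbb B_\eta(\bar p)\times\mathbb B_\eta(\bar v)$ and all $\lambda\in\Lambda(x,p,v)$ one has $\langle\nabla_xL(x,p,\lambda)u,u\rangle\ge\ell\|u\|^2$ for every $u\in\mathbb R^n$ with $\langle\nabla_x\varphi_i(x,p),u\rangle=0$ for $i\in I_+(x,p,\lambda)$ and $\langle\nabla_x\varphi_i(x,p),u\rangle\ge0$ for $i\in I(x,p)\setminus I_+(x,p,\lambda)$. Localization and full stability. A single-valued localization of $\breve S$ relative to a neighborhood $V\times Q\times U$ of $(\bar v,\bar p,\bar x)$ is a single-valued mapping $\vartheta\colon V\times Q\to U$ defined on all of $V\times Q$ with $\mathrm{gph}\,\vartheta=\mathrm{gph}\,\breve S\cap(V\times Q\times U)$. $\bar x$ is a Lipschitzian fully stable solution corresponding to $(\bar v,\bar p)$ if such a localization exists and, with some constants $\kappa,\ell>0$, $\|(v_1-v_2)-2\kappa[\vartheta(v_1,p_1)-\vartheta(v_2,p_2)]\|\le\|v_1-v_2\|+\ell\|p_1-p_2\|$ for all $(v_1,p_1),(v_2,p_2)\in V\times Q$. *)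

theory Defs
  imports "HOL-Analysis.Analysis"
begin

text \<open>The parameter space of the problem is \<open>real^'d\<close>, the decision space \<open>real^'n\<close>, and the
  inequality constraints are indexed by the finite type \<open>'m\<close>.  The data are
  \<open>f :: (real^'n) \<times> (real^'d) \<Rightarrow> real^'n\<close> and
  \<open>\<phi> :: 'm \<Rightarrow> (real^'n) \<times> (real^'d) \<Rightarrow> real\<close>.
  "\<open>U\<close> is a neighborhood of \<open>x\<close>" is rendered throughout as \<open>x \<in> interior U\<close>.\<close>

subsection \<open>Normal cones\<close>

text \<open>The filter \<open>at z within \<Omega>\<close> excludes \<open>z\<close> itself; at an isolated point of \<open>\<Omega>\<close> it is trivial,
  the upper limit is \<open>-\<infinity>\<close>, and every vector is a regular normal.\<close>

definition regular_normal_cone :: "'a::real_inner set \<Rightarrow> 'a \<Rightarrow> 'a set" where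
  "regular_normal_cone \<Omega> zb =
     {\<zeta>. Limsup (at zb within \<Omega>) (\<lambda>z. ereal (\<zeta> \<bullet> (z - zb) / norm (z - zb))) \<le> 0}"

definition limiting_normal_cone :: "'a::real_inner set \<Rightarrow> 'a \<Rightarrow> 'a set" where
  "limiting_normal_cone \<Omega> zb =
     (if zb \<in> \<Omega> then
        {\<zeta>. \<exists>(z :: nat \<Rightarrow> 'a) (w :: nat \<Rightarrow> 'a).
            (\<forall>k. z k \<in> \<Omega> \<and> w k \<in> regular_normal_cone \<Omega> (z k)) \<and>
            z \<longlonglongrightarrow> zb \<and> w \<longlonglongrightarrow> \<zeta>}
      else {})"

subsection \<open>Smoothness\<close>

definition C2_around :: "('a::real_normed_vector \<Rightarrow> real) \<Rightarrow> 'a \<Rightarrow> bool" where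
  "C2_around g z0 \<longleftrightarrow>
     (\<exists>W (g' :: 'a \<Rightarrow> 'a \<Rightarrow>\<^sub>L real) (g'' :: 'a \<Rightarrow> 'a \<Rightarrow>\<^sub>L ('a \<Rightarrow>\<^sub>L real)).
        open W \<and> z0 \<in> W \<and>
        (\<forall>z\<in>W. (g has_derivative blinfun_apply (g' z)) (at z)) \<and>
        (\<forall>z\<in>W. (g' has_derivative blinfun_apply (g'' z)) (at z)) \<and>
        continuous_on W g'')"

text \<open>The partial gradient; it is meaningful only where \<open>\<lambda>x. g (x, p)\<close> is differentiable at \<open>x\<close>,
  in which case the description picks the unique gradient.\<close>

definition grad_x :: "('a::real_inner \<times> 'b \<Rightarrow> real) \<Rightarrow> 'a \<Rightarrow> 'b \<Rightarrow> 'a" where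
  "grad_x g x p = (THE D. GDERIV (\<lambda>y. g (y, p)) x :> D)"

subsection \<open>The parametric variational condition\<close>

definition feasible_set :: "('m \<Rightarrow> (real^'n) \<times> (real^'d) \<Rightarrow> real) \<Rightarrow> real^'d \<Rightarrow> (real^'n) set" where
  "feasible_set \<phi> p = {x. \<forall>i. \<phi> i (x, p) \<le> 0}"

definition sol_map ::
  "((real^'n) \<times> (real^'d) \<Rightarrow> real^'n) \<Rightarrow> ('m \<Rightarrow> (real^'n) \<times> (real^'d) \<Rightarrow> real) \<Rightarrow>
   (real^'n) \<times> (real^'d) \<Rightarrow> (real^'n) set" where
  "sol_map f \<phi> = (\<lambda>(v, p). {x. v \<in> (\<lambda>w. f (x, p) + w) ` limiting_normal_cone (feasible_set \<phi> p) x})"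

text \<open>The active index set is used only at points \<open>(x, p)\<close> with \<open>x \<in> feasible_set \<phi> p\<close>.\<close>

definition active_set ::
  "('m \<Rightarrow> (real^'n) \<times> (real^'d) \<Rightarrow> real) \<Rightarrow> real^'n \<Rightarrow> real^'d \<Rightarrow> 'm set" where
  "active_set \<phi> x p = {i. \<phi> i (x, p) = 0}"

definition active_pos ::
  "('m::finite \<Rightarrow> (real^'n) \<times> (real^'d) \<Rightarrow> real) \<Rightarrow> real^'n \<Rightarrow> real^'d \<Rightarrow> real^'m \<Rightarrow> 'm set" where
  "active_pos \<phi> x p \<mu> = {i \<in> active_set \<phi> x p. \<mu> $ i > 0}"

definition constr_vec ::
  "('m::finite \<Rightarrow> (real^'n) \<times> (real^'d) \<Rightarrow> real) \<Rightarrow> real^'n \<Rightarrow> real^'d \<Rightarrow> real^'m" where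
  "constr_vec \<phi> x p = (\<chi> i. \<phi> i (x, p))"

definition Lagr ::
  "((real^'n) \<times> (real^'d) \<Rightarrow> real^'n) \<Rightarrow> ('m::finite \<Rightarrow> (real^'n) \<times> (real^'d) \<Rightarrow> real) \<Rightarrow>
   real^'n \<Rightarrow> real^'d \<Rightarrow> real^'m \<Rightarrow> real^'n" where
  "Lagr f \<phi> x p \<mu> = f (x, p) + (\<Sum>i\<in>UNIV. (\<mu> $ i) *\<^sub>R grad_x (\<phi> i) x p)"

definition Psi ::
  "((real^'n) \<times> (real^'d) \<Rightarrow> real^'n) \<Rightarrow> ('m::finite \<Rightarrow> (real^'n) \<times> (real^'d) \<Rightarrow> real) \<Rightarrow>
   real^'n \<Rightarrow> real^'d \<Rightarrow> (real^'n) set" where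
  "Psi f \<phi> x p = Lagr f \<phi> x p ` limiting_normal_cone {y :: real^'m. \<forall>i. y $ i \<le> 0} (constr_vec \<phi> x p)"

definition multipliers ::
  "((real^'n) \<times> (real^'d) \<Rightarrow> real^'n) \<Rightarrow> ('m::finite \<Rightarrow> (real^'n) \<times> (real^'d) \<Rightarrow> real) \<Rightarrow>
   real^'n \<Rightarrow> real^'d \<Rightarrow> real^'n \<Rightarrow> (real^'m) set" where
  "multipliers f \<phi> x p v =
     {\<mu>. (\<forall>i. 0 \<le> \<mu> $ i) \<and> v = Lagr f \<phi> x p \<mu> \<and> \<mu> \<bullet> constr_vec \<phi> x p = 0}"

subsection \<open>Constraint qualifications and the second-order condition\<close>

definition partial_MFCQ ::
  "('m \<Rightarrow> (real^'n) \<times> (real^'d) \<Rightarrow> real) \<Rightarrow> real^'n \<Rightarrow> real^'d \<Rightarrow> bool" where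
  "partial_MFCQ \<phi> xb pb \<longleftrightarrow>
     (\<exists>d. \<forall>i\<in>active_set \<phi> xb pb. grad_x (\<phi> i) xb pb \<bullet> d < 0)"

text \<open>The rank of a finite family of vectors is the dimension of the span of its range.\<close>

definition partial_CRCQ ::
  "('m \<Rightarrow> (real^'n) \<times> (real^'d) \<Rightarrow> real) \<Rightarrow> real^'n \<Rightarrow> real^'d \<Rightarrow> bool" where
  "partial_CRCQ \<phi> xb pb \<longleftrightarrow>
     (\<exists>W. (xb, pb) \<in> interior W \<and>
        (\<forall>J \<subseteq> active_set \<phi> xb pb. \<exists>r. \<forall>(x, p) \<in> W.
           dim ((\<lambda>i. grad_x (\<phi> i) x p) ` J) = r))"

definition GUSOSC ::
  "((real^'n) \<times> (real^'d) \<Rightarrow> real^'n) \<Rightarrow> ('m::finite \<Rightarrow> (real^'n) \<times> (real^'d) \<Rightarrow> real) \<Rightarrow>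
   real^'n \<Rightarrow> real^'d \<Rightarrow> real^'n \<Rightarrow> bool" where
  "GUSOSC f \<phi> xb pb vb \<longleftrightarrow>
     vb \<in> Psi f \<phi> xb pb \<and>
     (\<exists>\<eta>>0. \<exists>l>0. \<forall>x p v. v \<in> Psi f \<phi> x p \<longrightarrow>
        x \<in> cball xb \<eta> \<longrightarrow> p \<in> cball pb \<eta> \<longrightarrow> v \<in> cball vb \<eta> \<longrightarrow>
        (\<forall>\<mu>\<in>multipliers f \<phi> x p v. \<forall>u.
           (\<forall>i\<in>active_pos \<phi> x p \<mu>. grad_x (\<phi> i) x p \<bullet> u = 0) \<longrightarrow>
           (\<forall>i\<in>active_set \<phi> x p - active_pos \<phi> x p \<mu>. grad_x (\<phi> i) x p \<bullet> u \<ge> 0) \<longrightarrow>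
           (jacobian (\<lambda>y. Lagr f \<phi> y p \<mu>) (at x) *v u) \<bullet> u \<ge> l * (norm u)\<^sup>2))"

subsection \<open>Localizations and full stability\<close>

definition single_valued_localization ::
  "('v \<times> 'p \<Rightarrow> 'x set) \<Rightarrow> 'v set \<Rightarrow> 'p set \<Rightarrow> 'x set \<Rightarrow> ('v \<times> 'p \<Rightarrow> 'x) \<Rightarrow> bool" where
  "single_valued_localization S V Q U \<theta> \<longleftrightarrow>
     \<theta> \<in> V \<times> Q \<rightarrow> U \<and>
     {(z, x). z \<in> V \<times> Q \<and> x = \<theta> z} = {(z, x). x \<in> S z} \<inter> ((V \<times> Q) \<times> U)"

definition lipschitzian_fully_stable ::
  "((real^'n) \<times> (real^'d) \<Rightarrow> (real^'n) set) \<Rightarrow> real^'n \<Rightarrow> real^'n \<Rightarrow> real^'d \<Rightarrow> bool" where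
  "lipschitzian_fully_stable S xb vb pb \<longleftrightarrow>
     (\<exists>V Q U \<theta>. vb \<in> interior V \<and> pb \<in> interior Q \<and> xb \<in> interior U \<and>
        single_valued_localization S V Q U \<theta> \<and>
        (\<exists>\<kappa>>0. \<exists>l>0. \<forall>v1\<in>V. \<forall>v2\<in>V. \<forall>p1\<in>Q. \<forall>p2\<in>Q.
           norm ((v1 - v2) - (2 * \<kappa>) *\<^sub>R (\<theta> (v1, p1) - \<theta> (v2, p2)))
             \<le> norm (v1 - v2) + l * norm (p1 - p2)))"

definition lipschitz_localization ::
  "((real^'n) \<times> (real^'d) \<Rightarrow> (real^'n) set) \<Rightarrow> real^'n \<Rightarrow> real^'n \<Rightarrow> real^'d \<Rightarrow> bool" where
  "lipschitz_localization S xb vb pb \<longleftrightarrow>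
     (\<exists>V Q U \<theta>. vb \<in> interior V \<and> pb \<in> interior Q \<and> xb \<in> interior U \<and>
        single_valued_localization S V Q U \<theta> \<and>
        (\<exists>C. C-lipschitz_on (V \<times> Q) \<theta>))"

end

theory Submission
  imports Defs
begin

text \<open>The solution map is studied through multipliers. Under the partial MFCQ the multipliers of nearby
solutions are bounded, and the limiting normal cone of \<open>feasible_set \<phi> p\<close> at \<open>x\<close> is the cone of
nonnegative combinations of active gradients (\<open>limiting_normal_cone_eq_kkt\<close>). Thus solving
\<open>v \<in> f(x, p) + N(x)\<close> means finding \<open>\<mu>\<close> with \<open>kkt \<phi> x p \<mu>\<close> and \<open>v = Lagr f \<phi> x p \<mu>\<close>.

Stability implies the second-order condition. For a fixed parameter the stability estimate says that
the localized inverse of the solution map is strongly monotone. Given \<open>(x, p, \<mu>)\<close> and a critical direction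
\<open>u\<close>, the constant rank condition yields an arc through \<open>x\<close> with velocity \<open>u\<close> that stays feasible
and keeps all constraints of positive multiplier tight (\<open>tight_arc\<close>). The fixed multiplier \<open>\<mu>\<close> then
certifies that every point of the arc is a solution for the right-hand side \<open>Lagr f \<phi> x(t) p \<mu>\<close>. Strong
monotonicity along the arc, divided by \<open>t\<^sup>2\<close>, is the second-order inequality in the limit.

The second-order condition implies stability. Comparing a solution with another one close to it, no
first-order terms remain when the multiplier at the first point is the limit of the multipliers at the
second one: a constraint with positive limit multiplier is tight at both points. A blow-up argument
therefore shows that the graph at a fixed parameter is strongly monotone at each of its points, with a
uniform constant but on a neighborhood that depends on the point
(\<open>pointwise_strong_monotonicity\<close>). To reach a uniform neighborhood, add a large multiple \<open>\<sigma>\<close> of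
\<open>x - xb\<close>. The shifted inclusion is uniquely solvable with a Lipschitz solution, by minimizing a penalized
linear function and contracting (\<open>resolvent_exists\<close>). Along a segment of right-hand sides of the
shifted problem the local inequalities add up to \<open>\<langle>\<Delta>w, \<Delta>x\<rangle> \<ge> (\<kappa> + \<sigma>) \<parallel>\<Delta>x\<parallel>\<^sup>2\<close>
(\<open>strong_monotonicity_along_path\<close>). Subtracting the shift leaves strong monotonicity of the original problem
in a box, and a second contraction gives its solvability there (\<open>strongly_monotone_solutions\<close>).

For the dependence on \<open>p\<close> it suffices, again by moving along a segment, to bound the speed of solutions
at each point by one constant (\<open>calm_in_parameter\<close>). Here the constant rank condition enters twice.
Multipliers with linearly independent support move at most proportionally to the solutions
(\<open>multiplier_difference_bound\<close>), and an approximately critical direction is close to a critical one,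
by Hoffman's bound with a uniform constant (\<open>hoffman_bound\<close>). If solutions moved much faster
than the parameter, the limiting direction would be nearly critical and violate the second-order condition.
Strong monotonicity in \<open>v\<close> and the Lipschitz estimate in \<open>p\<close> combine to the stability inequality.\<close>

section \<open>Linear combinations, Farkas, Caratheodory and Hoffman\<close>

definition comb :: "('m::finite \<Rightarrow> 'a::real_vector) \<Rightarrow> real^'m \<Rightarrow> 'a" where
  "comb h \<mu> = (\<Sum>i\<in>UNIV. (\<mu> $ i) *\<^sub>R h i)"

definition supp :: "real^'m::finite \<Rightarrow> 'm set" where
  "supp \<mu> = {i. \<mu> $ i \<noteq> 0}"

text \<open>Independence of an indexed family: two indices with the same vector make it dependent. This is the notion
that matches the rank condition, where the rank is compared with the number of indices.\<close>

definition indep_family :: "('m::finite \<Rightarrow> 'a::real_vector) \<Rightarrow> 'm set \<Rightarrow> bool" where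
  "indep_family h J \<longleftrightarrow> (\<forall>\<mu>. supp \<mu> \<subseteq> J \<longrightarrow> comb h \<mu> = 0 \<longrightarrow> \<mu> = 0)"

lemma comb_add: "comb h (\<mu> + \<nu>) = comb h \<mu> + comb h \<nu>"
  by (simp add: comb_def scaleR_add_left sum.distrib)

lemma comb_scaleR: "comb h (c *\<^sub>R \<mu>) = c *\<^sub>R comb h \<mu>"
  by (simp add: comb_def scaleR_sum_right)

lemma linear_comb: "linear (comb h)"
  by (rule linearI) (simp_all add: comb_add comb_scaleR)

lemma comb_diff: "comb h (\<mu> - \<nu>) = comb h \<mu> - comb h \<nu>"
  by (simp add: linear_diff[OF linear_comb])

lemma comb_zero [simp]: "comb h 0 = 0"
  by (simp add: comb_def)

lemma comb_axis: "comb h (axis i 1) = h i"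
proof -
  have "comb h (axis i 1) = (\<Sum>j\<in>UNIV. if j = i then h j else 0)"
    unfolding comb_def by (rule sum.cong) (auto simp: axis_def)
  then show ?thesis by simp
qed

lemma comb_inner: "comb h \<mu> \<bullet> u = (\<Sum>i\<in>UNIV. \<mu> $ i * (h i \<bullet> u))"
  by (simp add: comb_def inner_sum_left)

lemma comb_diff_family: "comb h \<mu> - comb g \<mu> = (\<Sum>i\<in>UNIV. (\<mu> $ i) *\<^sub>R (h i - g i))"
  by (simp add: comb_def sum_subtractf scaleR_diff_right)

lemma sum_abs_le_norm: "(\<Sum>i\<in>UNIV. \<bar>\<mu> $ i\<bar>) \<le> real CARD('m) * norm (\<mu> :: real^'m::finite)"
proof -
  have "(\<Sum>i\<in>UNIV. \<bar>\<mu> $ i\<bar>) \<le> (\<Sum>i\<in>(UNIV::'m set). norm \<mu>)"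
    by (rule sum_mono) (rule component_le_norm_cart)
  then show ?thesis by simp
qed

text \<open>A finitely generated convex cone is closed, so a point outside it is separated from it. The separating
functional is nonnegative on the generators, because otherwise a multiple of some generator would
violate the separation; its negative then contradicts the polarity assumption.\<close>

lemma farkas:
  fixes h :: "'m::finite \<Rightarrow> 'a::euclidean_space"
  assumes polar: "\<And>u. (\<And>i. i \<in> I \<Longrightarrow> h i \<bullet> u \<le> 0) \<Longrightarrow> z \<bullet> u \<le> 0"
  shows "\<exists>\<mu>. (\<forall>i. 0 \<le> \<mu> $ i) \<and> supp \<mu> \<subseteq> I \<and> z = comb h \<mu>"
proof -
  let ?K = "convex_cone hull (h ` I)"
  let ?M = "comb h ` {\<mu>. (\<forall>i. 0 \<le> \<mu> $ i) \<and> supp \<mu> \<subseteq> I}"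
  have "convex_cone {\<mu> :: real^'m. (\<forall>i. 0 \<le> \<mu> $ i) \<and> supp \<mu> \<subseteq> I}"
    by (auto simp: convex_cone_iff supp_def subset_iff) (metis add_0_left)
  then have "convex_cone ?M"
    by (intro convex_cone_linear_image conjI linear_comb)
  moreover have "h ` I \<subseteq> ?M"
  proof
    fix y assume "y \<in> h ` I"
    then obtain i where "i \<in> I" "y = h i" by auto
    then have "y = comb h (axis i 1)" "axis i 1 \<in> {\<mu>::real^'m. (\<forall>i. 0 \<le> \<mu> $ i) \<and> supp \<mu> \<subseteq> I}"
      using comb_axis[of h i] by simp (auto simp: supp_def axis_def \<open>i \<in> I\<close> split: if_splits)
    then show "y \<in> ?M" by blast
  qed
  ultimately have KM: "?K \<subseteq> ?M"
    by (simp add: hull_minimal)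
  have "z \<in> ?K"
  proof (rule ccontr)
    assume "z \<notin> ?K"
    then obtain a b where ab: "a \<bullet> z < b" "\<forall>x\<in>?K. a \<bullet> x > b"
      using separating_hyperplane_closed_point[of ?K z] closed_convex_cone_hull[of "h ` I"]
      by (auto simp: convex_convex_cone_hull)
    have b0: "b < 0"
      using ab(2) convex_cone_hull_contains_0[of "h ` I"] by force
    have "h i \<bullet> (- a) \<le> 0" if "i \<in> I" for i
    proof (rule ccontr)
      assume "\<not> ?thesis"
      then have neg: "a \<bullet> h i < 0" by (simp add: inner_commute)
      have "(b / (a \<bullet> h i)) *\<^sub>R h i \<in> ?K"
        using neg b0 that by (intro convex_cone_hull_mul) (auto simp: hull_inc divide_nonpos_nonpos)
      then have "a \<bullet> ((b / (a \<bullet> h i)) *\<^sub>R h i) > b" using ab(2) by blast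
      then show False using neg by simp
    qed
    then have "z \<bullet> (- a) \<le> 0" by (rule polar)
    then show False using ab(1) b0 by (simp add: inner_commute)
  qed
  then show ?thesis using KM by blast
qed

text \<open>An equation is a pair of opposite inequalities; the sum type indexes the doubled system.\<close>

lemma farkas_mixed:
  fixes h :: "'m::finite \<Rightarrow> 'a::euclidean_space"
  assumes polar: "\<And>u. (\<And>i. i \<in> I \<Longrightarrow> h i \<bullet> u \<le> 0) \<Longrightarrow> (\<And>i. i \<in> P \<Longrightarrow> h i \<bullet> u = 0) \<Longrightarrow> z \<bullet> u \<le> 0"
    and "P \<subseteq> I"
  shows "\<exists>\<mu>. (\<forall>i. i \<notin> P \<longrightarrow> 0 \<le> \<mu> $ i) \<and> supp \<mu> \<subseteq> I \<and> z = comb h \<mu>"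
proof -
  let ?h = "case_sum h (\<lambda>i. - h i)" and ?I = "Inl ` I \<union> Inr ` P"
  have "z \<bullet> u \<le> 0" if "\<And>i. i \<in> ?I \<Longrightarrow> ?h i \<bullet> u \<le> 0" for u
  proof (rule polar)
    show *: "h i \<bullet> u \<le> 0" if "i \<in> I" for i
      using \<open>\<And>i. i \<in> ?I \<Longrightarrow> ?h i \<bullet> u \<le> 0\<close>[of "Inl i"] that by simp
    show "h i \<bullet> u = 0" if "i \<in> P" for i
      using \<open>\<And>i. i \<in> ?I \<Longrightarrow> ?h i \<bullet> u \<le> 0\<close>[of "Inr i"] *[of i] that \<open>P \<subseteq> I\<close> by auto
  qed
  then obtain \<nu> where \<nu>: "\<forall>i. 0 \<le> \<nu> $ i" "supp \<nu> \<subseteq> ?I" "z = comb ?h \<nu>"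
    using farkas[of ?I ?h z] by blast
  let ?\<mu> = "(\<chi> i. \<nu> $ Inl i - \<nu> $ Inr i) :: real^'m"
  have "comb ?h \<nu> = (\<Sum>i\<in>range Inl. (\<nu> $ i) *\<^sub>R ?h i) + (\<Sum>i\<in>range Inr. (\<nu> $ i) *\<^sub>R ?h i)"
    unfolding comb_def UNIV_sum by (rule sum.union_disjoint) auto
  also have "\<dots> = comb h ?\<mu>"
    by (simp add: sum.reindex comb_def algebra_simps sum_subtractf sum_negf)
  finally have "z = comb h ?\<mu>" using \<nu>(3) by simp
  moreover have "\<nu> $ Inr i = 0" if "i \<notin> P" for i
    using \<nu>(2) that by (auto simp: supp_def)
  moreover have "\<nu> $ Inl i = 0" if "i \<notin> I" for i
    using \<nu>(2) that by (auto simp: supp_def)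
  ultimately show ?thesis
    using \<nu>(1) \<open>P \<subseteq> I\<close> by (intro exI[of _ ?\<mu>]) (fastforce simp: supp_def)
qed

text \<open>Among the representations with the same sign pattern one with the fewest nonzero coefficients is
independent, since a linear relation could be subtracted until a further coefficient vanishes. Tracking
signs makes this usable for cones that have both free and nonnegative coefficients.\<close>

lemma caratheodory_signed:
  fixes h :: "'m::finite \<Rightarrow> 'a::real_vector"
  shows "\<exists>\<nu>. comb h \<nu> = comb h \<mu> \<and> supp \<nu> \<subseteq> supp \<mu> \<and> (\<forall>i. 0 \<le> \<mu> $ i * \<nu> $ i) \<and> indep_family h (supp \<nu>)"
proof -
  define P where "P \<nu> \<longleftrightarrow> comb h \<nu> = comb h \<mu> \<and> supp \<nu> \<subseteq> supp \<mu> \<and> (\<forall>i. 0 \<le> \<mu> $ i * \<nu> $ i)" for \<nu>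
  have "P \<mu>" by (simp add: P_def)
  then obtain \<nu> where "P \<nu>" and least: "\<And>\<nu>'. P \<nu>' \<Longrightarrow> card (supp \<nu>) \<le> card (supp \<nu>')"
    using ex_has_least_nat[of P \<mu> "\<lambda>\<nu>. card (supp \<nu>)"] by blast
  have "indep_family h (supp \<nu>)"
  proof (rule ccontr)
    assume "\<not> ?thesis"
    then obtain \<rho>0 where \<rho>0: "supp \<rho>0 \<subseteq> supp \<nu>" "comb h \<rho>0 = 0" "\<rho>0 \<noteq> 0"
      by (auto simp: indep_family_def)
    then obtain i0 where "\<rho>0 $ i0 \<noteq> 0" by (auto simp: vec_eq_iff)
    then have "\<nu> $ i0 \<noteq> 0" using \<rho>0(1) by (auto simp: supp_def)
    \<comment> \<open>choose the sign of the relation so that moving along it shrinks some coefficient\<close>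
    define \<rho> where "\<rho> = (if \<rho>0 $ i0 * \<nu> $ i0 > 0 then \<rho>0 else - \<rho>0)"
    have \<rho>: "supp \<rho> \<subseteq> supp \<nu>" "comb h \<rho> = 0"
      using \<rho>0 by (auto simp: \<rho>_def supp_def linear_neg[OF linear_comb])
    have i0: "\<rho> $ i0 * \<nu> $ i0 > 0"
      using \<open>\<rho>0 $ i0 \<noteq> 0\<close> \<open>\<nu> $ i0 \<noteq> 0\<close>
      by (auto simp: \<rho>_def mult_less_0_iff zero_less_mult_iff not_less linorder_neq_iff)
    let ?A = "{i. \<rho> $ i * \<nu> $ i > 0}"
    define t where "t = Min ((\<lambda>i. \<nu> $ i / \<rho> $ i) ` ?A)"
    have ne: "finite ((\<lambda>i. \<nu> $ i / \<rho> $ i) ` ?A)" "(\<lambda>i. \<nu> $ i / \<rho> $ i) ` ?A \<noteq> {}"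
      using i0 by auto
    from Min_in[OF ne] obtain j where j: "\<rho> $ j * \<nu> $ j > 0" "t = \<nu> $ j / \<rho> $ j"
      unfolding t_def by blast
    have tle: "t \<le> \<nu> $ i / \<rho> $ i" if "\<rho> $ i * \<nu> $ i > 0" for i
      unfolding t_def using that ne(1) by (intro Min_le) auto
    have t0: "t > 0" using j by (auto simp: zero_less_mult_iff zero_less_divide_iff)
    define \<nu>' where "\<nu>' = \<nu> - t *\<^sub>R \<rho>"
    have sgn: "0 \<le> \<nu> $ i * \<nu>' $ i" for i
    proof (cases "\<rho> $ i * \<nu> $ i > 0")
      case True
      then have "t * (\<rho> $ i * \<nu> $ i) \<le> \<nu> $ i / \<rho> $ i * (\<rho> $ i * \<nu> $ i)"
        by (intro mult_right_mono tle) auto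
      also have "\<dots> = \<nu> $ i * \<nu> $ i" using True by auto
      finally show ?thesis by (simp add: \<nu>'_def algebra_simps)
    next
      case False
      then have "t * (\<rho> $ i * \<nu> $ i) \<le> 0" using t0 by (simp add: mult_nonneg_nonpos)
      moreover have "0 \<le> \<nu> $ i * \<nu> $ i" by simp
      ultimately have "0 \<le> \<nu> $ i * \<nu> $ i - t * (\<rho> $ i * \<nu> $ i)" by linarith
      then show ?thesis by (simp add: \<nu>'_def algebra_simps)
    qed
    have sub: "supp \<nu>' \<subseteq> supp \<nu>" using \<rho>(1) by (auto simp: \<nu>'_def supp_def)
    have "0 \<le> \<mu> $ i * \<nu>' $ i" for i
    proof (cases "\<nu> $ i = 0")
      case True
      then have "\<nu>' $ i = 0" using sub by (auto simp: supp_def)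
      then show ?thesis by simp
    next
      case False
      moreover from False have "\<mu> $ i \<noteq> 0" using \<open>P \<nu>\<close> by (auto simp: P_def supp_def)
      moreover have "0 \<le> \<mu> $ i * \<nu> $ i" using \<open>P \<nu>\<close> by (auto simp: P_def)
      ultimately show ?thesis using sgn[of i] by (auto simp: zero_le_mult_iff)
    qed
    then have "P \<nu>'"
      using \<open>P \<nu>\<close> sub \<rho>(2) by (auto simp: P_def \<nu>'_def comb_diff comb_scaleR)
    moreover have "supp \<nu>' \<subset> supp \<nu>"
    proof -
      have "\<nu>' $ j = 0" using j by (auto simp: \<nu>'_def)
      moreover have "\<nu> $ j \<noteq> 0" using j by auto
      ultimately show ?thesis using sub by (auto simp: supp_def)
    qed
    then have "card (supp \<nu>') < card (supp \<nu>)" by (simp add: psubset_card_mono)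
    ultimately show False using least[of \<nu>'] by simp
  qed
  then show ?thesis using \<open>P \<nu>\<close> by (auto simp: P_def)
qed

lemma sum_supp_eq_comb:
  assumes "supp \<mu> \<subseteq> J"
  shows "comb h \<mu> = (\<Sum>i\<in>J. (\<mu> $ i) *\<^sub>R h i)"
  unfolding comb_def using assms by (intro sum.mono_neutral_right) (auto simp: supp_def)

lemma indep_family_subset: "indep_family h J \<Longrightarrow> K \<subseteq> J \<Longrightarrow> indep_family h K"
  unfolding indep_family_def by blast

lemma inj_independent_if_dim:
  fixes h :: "'m::finite \<Rightarrow> 'a::euclidean_space"
  assumes d: "dim (h ` J) = card J"
  shows "inj_on h J" "independent (h ` J)"
proof -
  have "card J \<le> card (h ` J)" using dim_le_card'[of "h ` J"] d by simp
  then have cJ: "card (h ` J) = card J" using card_image_le[of J h] by simp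
  then show "inj_on h J" by (intro eq_card_imp_inj_on) auto
  show "independent (h ` J)"
    by (rule card_le_dim_spanning[of _ "h ` J"]) (auto simp: d cJ span_base)
qed

text \<open>This translates the rank formulation of the constant rank condition into the independence of families.\<close>

lemma indep_family_iff_dim:
  fixes h :: "'m::finite \<Rightarrow> 'a::euclidean_space"
  shows "indep_family h J \<longleftrightarrow> dim (h ` J) = card J"
proof
  assume ind: "indep_family h J"
  have inj: "inj_on h J"
  proof (rule inj_onI, rule ccontr)
    fix i j assume ij: "i \<in> J" "j \<in> J" "h i = h j" "i \<noteq> j"
    let ?\<mu> = "axis i 1 - axis j 1 :: real^'m"
    have "supp ?\<mu> \<subseteq> J"
      using ij by (auto simp: supp_def axis_def split: if_splits)
    moreover have "comb h ?\<mu> = 0"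
      using ij by (simp add: comb_diff comb_axis)
    ultimately have "?\<mu> = 0" using ind unfolding indep_family_def by blast
    then have "?\<mu> $ i = 0" by simp
    then show False using ij(4) by (simp add: axis_def)
  qed
  have "independent (h ` J)"
  proof
    assume "dependent (h ` J)"
    then obtain c v where c: "v \<in> h ` J" "c v \<noteq> 0" "(\<Sum>v\<in>h ` J. c v *\<^sub>R v) = 0"
      by (auto simp: dependent_finite)
    let ?\<mu> = "(\<chi> i. if i \<in> J then c (h i) else 0) :: real^'m"
    have s: "supp ?\<mu> \<subseteq> J" by (auto simp: supp_def)
    have "comb h ?\<mu> = (\<Sum>i\<in>J. c (h i) *\<^sub>R h i)"
      by (subst sum_supp_eq_comb[OF s]) (rule sum.cong, auto)
    also have "\<dots> = 0" using c(3) by (simp add: sum.reindex[OF inj])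
    finally have "?\<mu> = 0" using ind s unfolding indep_family_def by blast
    moreover obtain i where "i \<in> J" "v = h i" using c(1) by auto
    ultimately show False using c(2) by (auto simp: vec_eq_iff dest: spec[of _ i])
  qed
  then show "dim (h ` J) = card J"
    by (simp add: dim_eq_card_independent card_image[OF inj])
next
  assume d: "dim (h ` J) = card J"
  note inj = inj_independent_if_dim(1)[OF d] and ind = inj_independent_if_dim(2)[OF d]
  show "indep_family h J"
    unfolding indep_family_def
  proof (intro allI impI)
    fix \<mu> assume s: "supp \<mu> \<subseteq> J" and "comb h \<mu> = 0"
    then have "(\<Sum>i\<in>J. (\<mu> $ the_inv_into J h (h i)) *\<^sub>R h i) = 0"
      using sum_supp_eq_comb[OF s, of h] by (simp add: the_inv_into_f_f[OF inj])
    then have "(\<Sum>v\<in>h ` J. (\<mu> $ the_inv_into J h v) *\<^sub>R v) = 0"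
      by (simp add: sum.reindex[OF inj])
    then have "\<mu> $ the_inv_into J h v = 0" if "v \<in> h ` J" for v
      using ind that
      by (auto simp: dependent_finite)
    then have "\<mu> $ i = 0" if "i \<in> J" for i
      using the_inv_into_f_f[OF inj that] that by force
    then show "\<mu> = 0" using s by (auto simp: vec_eq_iff supp_def)
  qed
qed

text \<open>A linear map that sends the family to coordinate vectors has an adjoint that provides the dual vectors.\<close>

lemma indep_family_dual_vectors:
  fixes h :: "'m::finite \<Rightarrow> 'a::euclidean_space"
  assumes "indep_family h J"
  obtains t :: "'m \<Rightarrow> 'a" where "\<And>i j. i \<in> J \<Longrightarrow> h i \<bullet> t j = (if i = j then 1 else 0)"
proof -
  note inj = inj_independent_if_dim(1)[OF assms[unfolded indep_family_iff_dim]]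
  obtain g :: "'a \<Rightarrow> real^'m" where g: "linear g" "\<forall>v\<in>h ` J. g v = axis (the_inv_into J h v) 1"
    using linear_independent_extend[OF inj_independent_if_dim(2)[OF assms[unfolded indep_family_iff_dim]],
        of "\<lambda>v. axis (the_inv_into J h v) 1"] by blast
  have "h i \<bullet> adjoint g (axis j 1) = (if i = j then 1 else 0)" if "i \<in> J" for i j
  proof -
    have "h i \<bullet> adjoint g (axis j 1) = g (h i) \<bullet> axis j 1" by (rule adjoint_works[OF g(1)])
    also have "g (h i) = axis i 1" using g(2) that the_inv_into_f_f[OF inj that] by simp
    finally show ?thesis by (simp add: inner_axis_axis)
  qed
  then show thesis by (rule that)
qed

lemma indep_family_lower_bound:
  fixes h :: "'m::finite \<Rightarrow> 'a::euclidean_space"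
  assumes "indep_family h J"
  shows "\<exists>\<gamma>>0. \<forall>\<mu>. supp \<mu> \<subseteq> J \<longrightarrow> \<gamma> * norm \<mu> \<le> norm (comb h \<mu>)"
proof -
  let ?S = "{\<mu> :: real^'m. supp \<mu> \<subseteq> J}"
  have "subspace ?S"
    by (intro subspaceI CollectI) (force simp: supp_def subset_iff)+
  moreover have "\<forall>\<mu>\<in>?S. comb h \<mu> = 0 \<longrightarrow> \<mu> = 0"
    using assms by (auto simp: indep_family_def)
  ultimately obtain e where "e > 0" "\<forall>x\<in>?S. norm (comb h x) \<ge> e * norm x"
    using injective_imp_isometric[of ?S "comb h"] linear_comb
    by (auto simp: closed_subspace linear_linear)
  then show ?thesis by blast
qed

text \<open>The residual of the projection of \<open>u\<close> onto the cone is a combination of constraint vectors that are tight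
at the projection. After a Caratheodory reduction the vectors in use are independent, so the coefficients are bounded
by the residual divided by \<open>\<gamma>\<close>; pairing the residual with itself gives the estimate. The constant depends
on the vectors only through \<open>\<gamma>\<close>, hence it is uniform for families of constant rank.\<close>

lemma hoffman_bound:
  fixes h :: "'m::finite \<Rightarrow> 'a::euclidean_space"
  assumes "\<gamma> > 0"
    and lower: "\<And>\<mu>. supp \<mu> \<subseteq> I \<Longrightarrow> indep_family h (supp \<mu>) \<Longrightarrow> \<gamma> * norm \<mu> \<le> norm (comb h \<mu>)"
    and "P \<subseteq> I"
    and eq: "\<And>i. i \<in> P \<Longrightarrow> \<bar>h i \<bullet> u\<bar> \<le> \<epsilon>"
    and ineq: "\<And>i. i \<in> I \<Longrightarrow> h i \<bullet> u \<le> \<epsilon>"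
    and "\<epsilon> \<ge> 0"
  obtains u' where "\<And>i. i \<in> P \<Longrightarrow> h i \<bullet> u' = 0" "\<And>i. i \<in> I \<Longrightarrow> h i \<bullet> u' \<le> 0"
    "norm (u - u') \<le> real CARD('m) * \<epsilon> / \<gamma>"
proof -
  define K where "K = {z. (\<forall>i\<in>I. h i \<bullet> z \<le> 0) \<and> (\<forall>i\<in>P. h i \<bullet> z = 0)}"
  have K_eq: "K = (\<Inter>i\<in>I. {z. h i \<bullet> z \<le> 0}) \<inter> (\<Inter>i\<in>P. {z. h i \<bullet> z = 0})"
    by (auto simp: K_def)
  have "closed K" "convex K"
    unfolding K_eq
    by (intro closed_Int closed_INT ballI closed_halfspace_le closed_hyperplane,
        intro convex_Int convex_INT convex_halfspace_le convex_hyperplane)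
  have "0 \<in> K" by (simp add: K_def)
  define u' where "u' = closest_point K u"
  have "u' \<in> K" unfolding u'_def using \<open>closed K\<close> \<open>0 \<in> K\<close> by (intro closest_point_in_set) auto
  have dot: "(u - u') \<bullet> (z - u') \<le> 0" if "z \<in> K" for z
    unfolding u'_def using \<open>convex K\<close> \<open>closed K\<close> that by (rule closest_point_dot)
  \<comment> \<open>testing the projection inequality with 0 and twice the projection: the residual is orthogonal to the projection\<close>
  have "2 *\<^sub>R u' \<in> K" using \<open>u' \<in> K\<close> by (auto simp: K_def)
  then have orth: "(u - u') \<bullet> u' = 0"
    using dot[of "2 *\<^sub>R u'"] dot[OF \<open>0 \<in> K\<close>] by (simp add: scaleR_2)
  have "(u - u') \<bullet> z \<le> 0" if "z \<in> K" for z
    using dot[OF that] orth by (simp add: inner_diff_right)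
  then obtain \<mu> where \<mu>: "\<forall>i. i \<notin> P \<longrightarrow> 0 \<le> \<mu> $ i" "supp \<mu> \<subseteq> I" "u - u' = comb h \<mu>"
    using farkas_mixed[of I h P "u - u'"] \<open>P \<subseteq> I\<close> by (auto simp: K_def)
  have nonpos: "\<mu> $ i * (h i \<bullet> u') \<le> 0" for i
  proof (cases "i \<in> P \<or> i \<notin> I")
    case True
    then have "h i \<bullet> u' = 0 \<or> \<mu> $ i = 0" using \<open>u' \<in> K\<close> \<mu>(2) by (auto simp: K_def supp_def)
    then show ?thesis by auto
  next
    case False
    then show ?thesis using \<open>u' \<in> K\<close> \<mu>(1) by (auto simp: K_def mult_nonneg_nonpos)
  qed
  have "(\<Sum>i\<in>UNIV. - (\<mu> $ i * (h i \<bullet> u'))) = 0"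
    using orth \<mu>(3) by (simp add: comb_inner sum_negf)
  then have compl: "\<mu> $ i * (h i \<bullet> u') = 0" for i
    using nonpos sum_nonneg_eq_0_iff[of UNIV "\<lambda>i. - (\<mu> $ i * (h i \<bullet> u'))"] by auto
  obtain \<nu> where \<nu>: "comb h \<nu> = comb h \<mu>" "supp \<nu> \<subseteq> supp \<mu>" "\<forall>i. 0 \<le> \<mu> $ i * \<nu> $ i"
      "indep_family h (supp \<nu>)"
    using caratheodory_signed by blast
  have summand: "\<nu> $ i * (h i \<bullet> (u - u')) \<le> \<bar>\<nu> $ i\<bar> * \<epsilon>" for i
  proof (cases "\<nu> $ i = 0")
    case False
    then have "\<mu> $ i \<noteq> 0" "i \<in> I" using \<nu>(2) \<mu>(2) by (auto simp: supp_def)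
    then have "h i \<bullet> u' = 0" using compl[of i] by simp
    then have *: "\<nu> $ i * (h i \<bullet> (u - u')) = \<nu> $ i * (h i \<bullet> u)" by (simp add: inner_diff_right)
    show ?thesis
    proof (cases "i \<in> P")
      case True
      have "\<nu> $ i * (h i \<bullet> u) \<le> \<bar>\<nu> $ i\<bar> * \<bar>h i \<bullet> u\<bar>" by (metis abs_ge_self abs_mult)
      also have "\<dots> \<le> \<bar>\<nu> $ i\<bar> * \<epsilon>" using eq[OF True] by (intro mult_left_mono) auto
      finally show ?thesis unfolding * .
    next
      case False
      then have "\<mu> $ i > 0" using \<mu>(1) \<open>\<mu> $ i \<noteq> 0\<close> by (simp add: order_less_le)
      then have "\<nu> $ i \<ge> 0" using \<nu>(3) by (metis zero_le_mult_iff not_less)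
      then show ?thesis unfolding * using ineq[OF \<open>i \<in> I\<close>] by (simp add: mult_left_mono)
    qed
  qed (use \<open>\<epsilon> \<ge> 0\<close> in simp)
  have "(norm (u - u'))\<^sup>2 = comb h \<nu> \<bullet> (u - u')"
    using \<nu>(1) \<mu>(3) by (simp add: power2_norm_eq_inner)
  also have "\<dots> \<le> (\<Sum>i\<in>UNIV. \<bar>\<nu> $ i\<bar> * \<epsilon>)"
    unfolding comb_inner by (rule sum_mono) (rule summand)
  also have "\<dots> = (\<Sum>i\<in>UNIV. \<bar>\<nu> $ i\<bar>) * \<epsilon>" by (simp add: sum_distrib_right)
  also have "\<dots> \<le> real CARD('m) * norm \<nu> * \<epsilon>"
    using \<open>\<epsilon> \<ge> 0\<close> by (intro mult_right_mono sum_abs_le_norm)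
  also have "\<dots> \<le> real CARD('m) * (norm (u - u') / \<gamma>) * \<epsilon>"
  proof -
    have "\<gamma> * norm \<nu> \<le> norm (u - u')"
      using lower[of \<nu>] \<nu> \<mu>(2,3) by auto
    then have "norm \<nu> \<le> norm (u - u') / \<gamma>" using \<open>\<gamma> > 0\<close> by (simp add: field_simps)
    then show ?thesis using \<open>\<epsilon> \<ge> 0\<close> by (intro mult_right_mono mult_left_mono) auto
  qed
  finally have "(norm (u - u'))\<^sup>2 \<le> (real CARD('m) * \<epsilon> / \<gamma>) * norm (u - u')"
    by (simp add: field_simps)
  then have "norm (u - u') \<le> real CARD('m) * \<epsilon> / \<gamma>"
  proof (cases "norm (u - u') = 0")
    case False
    then have "norm (u - u') > 0" by simp
    moreover have "norm (u - u') * norm (u - u') \<le> (real CARD('m) * \<epsilon> / \<gamma>) * norm (u - u')"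
      using \<open>(norm (u - u'))\<^sup>2 \<le> (real CARD('m) * \<epsilon> / \<gamma>) * norm (u - u')\<close>
      unfolding power2_eq_square .
    ultimately show ?thesis by (rule mult_right_le_imp_le[rotated])
  qed (use \<open>\<gamma> > 0\<close> \<open>\<epsilon> \<ge> 0\<close> in auto)
  moreover have "h i \<bullet> u' = 0" if "i \<in> P" for i using \<open>u' \<in> K\<close> that by (simp add: K_def)
  moreover have "h i \<bullet> u' \<le> 0" if "i \<in> I" for i using \<open>u' \<in> K\<close> that by (simp add: K_def)
  ultimately show thesis using that by blast
qed

section \<open>From pointwise estimates to estimates along segments\<close>

text \<open>The square on the left is not additive over subintervals, but with \<open>c = x 1 - x 0\<close> it may be replaced by the lower
bound \<open>2 \<langle>c, \<Delta>x\<rangle> - \<Delta>t \<parallel>c\<parallel>\<^sup>2\<close> of \<open>\<parallel>\<Delta>x\<parallel>\<^sup>2 / \<Delta>t\<close>, which is. On the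
whole interval this bound equals \<open>\<parallel>c\<parallel>\<^sup>2\<close>. The radius \<open>e\<close> may depend on \<open>t\<close> without any uniformity.\<close>

lemma strong_monotonicity_along_path:
  fixes x :: "real \<Rightarrow> 'a::real_inner"
  assumes "\<kappa> \<ge> 0"
    and loc: "\<And>t. 0 \<le> t \<Longrightarrow> t \<le> 1 \<Longrightarrow> \<exists>e>0. \<forall>s. 0 \<le> s \<and> s \<le> 1 \<and> \<bar>s - t\<bar> < e \<longrightarrow>
        \<kappa> * (norm (x s - x t))\<^sup>2 \<le> (s - t) * (w \<bullet> (x s - x t))"
  shows "\<kappa> * (norm (x 1 - x 0))\<^sup>2 \<le> w \<bullet> (x 1 - x 0)"
proof -
  define c where "c = x 1 - x 0"
  define P where "P a b \<longleftrightarrow> (0 \<le> a \<and> b \<le> 1 \<longrightarrow>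
      \<kappa> * (2 * (c \<bullet> (x b - x a)) - (b - a) * (c \<bullet> c)) \<le> w \<bullet> (x b - x a))" for a b
  have step: "\<kappa> * (2 * (c \<bullet> (x b - x a)) - (b - a) * (c \<bullet> c)) \<le> w \<bullet> (x b - x a)"
    if le: "\<kappa> * (norm (x b - x a))\<^sup>2 \<le> (b - a) * (w \<bullet> (x b - x a))" and "a \<le> b" for a b
  proof (cases "a = b")
    case False
    with \<open>a \<le> b\<close> have ab: "b - a > 0" by simp
    let ?d = "x b - x a"
    have "0 \<le> (norm (?d - (b - a) *\<^sub>R c))\<^sup>2" by simp
    also have "\<dots> = (norm ?d)\<^sup>2 - (b - a) * (2 * (c \<bullet> ?d) - (b - a) * (c \<bullet> c))"
      by (simp add: power2_norm_eq_inner inner_diff_left inner_diff_right inner_commute algebra_simps)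
    finally have "\<kappa> * ((b - a) * (2 * (c \<bullet> ?d) - (b - a) * (c \<bullet> c))) \<le> \<kappa> * (norm ?d)\<^sup>2"
      using \<open>\<kappa> \<ge> 0\<close> by (intro mult_left_mono) auto
    with le have "(b - a) * (\<kappa> * (2 * (c \<bullet> ?d) - (b - a) * (c \<bullet> c))) \<le> (b - a) * (w \<bullet> ?d)"
      by (simp add: mult.left_commute)
    then show ?thesis using ab by (simp only: mult_le_cancel_left_pos)
  qed simp
  have "P 0 1"
  proof (induction rule: Bolzano[of 0 1 P, OF zero_le_one, case_names trans local])
    case (trans a b c')
    then show ?case
      by (auto simp: P_def inner_diff_right algebra_simps)
  next
    case (local t)
    then obtain e where e: "e > 0" "\<And>s. 0 \<le> s \<Longrightarrow> s \<le> 1 \<Longrightarrow> \<bar>s - t\<bar> < e \<Longrightarrow>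
        \<kappa> * (norm (x s - x t))\<^sup>2 \<le> (s - t) * (w \<bullet> (x s - x t))"
      using loc[of t] by auto
    have "P a b" if "a \<le> t" "t \<le> b" "b - a < e" for a b
    proof -
      have ?thesis if ab: "0 \<le> a" "b \<le> 1"
      proof -
        have "\<kappa> * (norm (x t - x a))\<^sup>2 \<le> (t - a) * (w \<bullet> (x t - x a))"
          using e(2)[of a] \<open>a \<le> t\<close> \<open>t \<le> b\<close> \<open>b - a < e\<close> ab
          by (simp add: norm_minus_commute inner_diff_right algebra_simps)
        moreover have "\<kappa> * (norm (x b - x t))\<^sup>2 \<le> (b - t) * (w \<bullet> (x b - x t))"
          using e(2)[of b] \<open>a \<le> t\<close> \<open>t \<le> b\<close> \<open>b - a < e\<close> ab by simp
        ultimately show ?thesis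
          using step[of t a] step[of b t] \<open>a \<le> t\<close> \<open>t \<le> b\<close>
          by (auto simp: P_def inner_diff_right algebra_simps)
      qed
      then show ?thesis by (auto simp: P_def)
    qed
    then show ?case using e(1) by blast
  qed
  then have "\<kappa> * (2 * (c \<bullet> c) - c \<bullet> c) \<le> w \<bullet> c" by (simp add: P_def c_def)
  then show ?thesis by (simp add: c_def power2_norm_eq_inner)
qed

text \<open>A bound on the increments at every single point, on a neighborhood depending on the point, adds up along
the interval.\<close>

lemma lipschitz_along_path:
  fixes x :: "real \<Rightarrow> 'a::real_normed_vector"
  assumes loc: "\<And>t. 0 \<le> t \<Longrightarrow> t \<le> 1 \<Longrightarrow> \<exists>e>0. \<forall>s. 0 \<le> s \<and> s \<le> 1 \<and> \<bar>s - t\<bar> < e \<longrightarrow>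
        norm (x s - x t) \<le> c * \<bar>s - t\<bar>"
  shows "norm (x 1 - x 0) \<le> c"
proof -
  define P where "P a b \<longleftrightarrow> (0 \<le> a \<and> b \<le> 1 \<longrightarrow> norm (x b - x a) \<le> c * (b - a))" for a b
  have "P 0 1"
  proof (induction rule: Bolzano[of 0 1 P, OF zero_le_one, case_names trans local])
    case (trans a b c')
    have "norm (x c' - x a) \<le> norm (x c' - x b) + norm (x b - x a)"
      using norm_triangle_ineq[of "x c' - x b" "x b - x a"] by simp
    then show ?case using trans by (auto simp: P_def algebra_simps)
  next
    case (local t)
    then obtain e where e: "e > 0" "\<And>s. 0 \<le> s \<Longrightarrow> s \<le> 1 \<Longrightarrow> \<bar>s - t\<bar> < e \<Longrightarrow>
        norm (x s - x t) \<le> c * \<bar>s - t\<bar>"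
      using loc[of t] by auto
    have "P a b" if "a \<le> t" "t \<le> b" "b - a < e" for a b
      using e(2)[of a] e(2)[of b] that norm_triangle_ineq[of "x b - x t" "x t - x a"]
      by (auto simp: P_def norm_minus_commute algebra_simps)
    then show ?case using e(1) by blast
  qed
  then show ?thesis by (simp add: P_def)
qed

text \<open>The derivative is evaluated along sequences that approach \<open>x\<close> only asymptotically in the direction \<open>u\<close>, as
blow-ups of solutions and curved feasible arcs do.\<close>

lemma has_derivative_along_sequence:
  fixes F :: "'a::real_normed_vector \<Rightarrow> 'b::real_normed_vector"
  assumes F: "(F has_derivative A) (at x)"
    and t: "\<And>k. t k > 0" "t \<longlonglongrightarrow> 0"
    and X: "(\<lambda>k. (X k - x) /\<^sub>R t k) \<longlonglongrightarrow> u"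
  shows "(\<lambda>k. (F (X k) - F x) /\<^sub>R t k) \<longlonglongrightarrow> A u"
proof -
  interpret A: bounded_linear A using F by (rule has_derivative_bounded_linear)
  define q where "q h = norm (F (x + h) - F x - A h) / norm h" for h
  have "q \<midarrow>0\<rightarrow> 0" using F by (simp add: has_derivative_at q_def[abs_def])
  then have "isCont q 0" by (simp add: isCont_def q_def)
  have "(\<lambda>k. t k *\<^sub>R ((X k - x) /\<^sub>R t k)) \<longlonglongrightarrow> 0 *\<^sub>R u" by (intro tendsto_intros t X)
  then have "(\<lambda>k. X k - x) \<longlonglongrightarrow> 0" using t(1) by (simp add: less_imp_neq[THEN not_sym])
  then have "(\<lambda>k. q (X k - x)) \<longlonglongrightarrow> q 0"
    using \<open>isCont q 0\<close> by (rule isCont_tendsto_compose[rotated])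
  then have "(\<lambda>k. q (X k - x) * norm ((X k - x) /\<^sub>R t k)) \<longlonglongrightarrow> 0 * norm u"
    by (intro tendsto_intros X) (simp add: q_def)
  moreover have "q (X k - x) * norm ((X k - x) /\<^sub>R t k)
      = norm ((F (X k) - F x) /\<^sub>R t k - A ((X k - x) /\<^sub>R t k))" for k
  proof -
    have "(F (X k) - F x) /\<^sub>R t k - A ((X k - x) /\<^sub>R t k) = (F (X k) - F x - A (X k - x)) /\<^sub>R t k"
      unfolding A.scaleR by (simp add: scaleR_diff_right)
    moreover have "q (X k - x) * norm ((X k - x) /\<^sub>R t k) = norm (F (X k) - F x - A (X k - x)) / t k"
      using t(1)[of k] by (cases "X k = x") (auto simp: q_def divide_simps A.zero)
    ultimately show ?thesis using t(1)[of k] by (simp add: divide_inverse mult.commute)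
  qed
  ultimately have "(\<lambda>k. (F (X k) - F x) /\<^sub>R t k - A ((X k - x) /\<^sub>R t k)) \<longlonglongrightarrow> 0"
    by (simp add: tendsto_norm_zero_iff)
  then have "(\<lambda>k. (F (X k) - F x) /\<^sub>R t k - A ((X k - x) /\<^sub>R t k) + A ((X k - x) /\<^sub>R t k)) \<longlonglongrightarrow> 0 + A u"
    by (intro tendsto_add A.tendsto X)
  then show ?thesis by simp
qed

text \<open>Difference quotients along a ray inherit the Lipschitz bound, and so does their limit.\<close>

lemma derivative_bound_if_lipschitz:
  fixes F :: "'a::real_normed_vector \<Rightarrow> 'b::real_normed_vector"
  assumes F: "(F has_derivative A) (at x)" and "e > 0"
    and lip: "\<And>y. norm (y - x) < e \<Longrightarrow> norm (F y - F x) \<le> K * norm (y - x)"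
  shows "norm (A z) \<le> K * norm z"
proof -
  define t where "t k = e / (norm z + 1) * inverse (real (Suc k))" for k
  have pos: "norm z + 1 > 0" by (simp add: add_nonneg_pos)
  have t: "t k > 0" for k using \<open>e > 0\<close> pos by (simp add: t_def)
  have "(\<lambda>k. e / (norm z + 1) * inverse (real (Suc k))) \<longlonglongrightarrow> e / (norm z + 1) * 0"
    by (intro tendsto_intros LIMSEQ_inverse_real_of_nat)
  then have t0: "t \<longlonglongrightarrow> 0" by (simp add: t_def[abs_def])
  have "(\<lambda>k. ((x + t k *\<^sub>R z) - x) /\<^sub>R t k) \<longlonglongrightarrow> z"
    using t by (simp add: less_imp_neq[THEN not_sym])
  from tendsto_norm[OF has_derivative_along_sequence[OF F t t0 this]]
  have lim: "(\<lambda>k. norm ((F (x + t k *\<^sub>R z) - F x) /\<^sub>R t k)) \<longlonglongrightarrow> norm (A z)" .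
  have "norm ((F (x + t k *\<^sub>R z) - F x) /\<^sub>R t k) \<le> K * norm z" for k
  proof -
    have "t k * norm z < e"
    proof -
      have "t k \<le> e / (norm z + 1) * 1"
        unfolding t_def using \<open>e > 0\<close> pos by (intro mult_left_mono) (auto simp: inverse_le_1_iff)
      then have "t k * (norm z + 1) \<le> e" using pos by (simp add: pos_le_divide_eq)
      then show ?thesis using t[of k] by (simp add: distrib_left)
    qed
    then have "norm (F (x + t k *\<^sub>R z) - F x) \<le> K * (t k * norm z)"
      using lip[of "x + t k *\<^sub>R z"] t[of k] by simp
    then have "norm (F (x + t k *\<^sub>R z) - F x) / t k \<le> K * norm z"
      using t[of k] by (simp add: pos_divide_le_eq mult_ac)
    then show ?thesis using t[of k] by (simp add: divide_inverse mult.commute)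
  qed
  then show ?thesis by (intro LIMSEQ_le_const2[OF lim]) blast
qed

lemma inner_scaleR_quotient: "(a /\<^sub>R t) \<bullet> (b /\<^sub>R t) = (a \<bullet> b) / t\<^sup>2" for a b :: "'a::real_inner"
  by (simp add: power2_eq_square divide_inverse)

lemma norm_scaleR_quotient: "(norm (b /\<^sub>R t))\<^sup>2 = (norm b)\<^sup>2 / t\<^sup>2" for b :: "'a::real_inner"
  by (simp only: power2_norm_eq_inner inner_scaleR_quotient)

lemma norm_le_of_square: "(norm a)\<^sup>2 \<le> b \<bullet> a \<Longrightarrow> norm a \<le> norm b" for a b :: "'x::real_inner"
proof (cases "a = 0")
  case False
  assume "(norm a)\<^sup>2 \<le> b \<bullet> a"
  also have "\<dots> \<le> norm b * norm a" by (rule norm_cauchy_schwarz)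
  finally show ?thesis using False by (simp add: power2_eq_square)
qed simp

text \<open>Banach's fixed point theorem for a selection of the relation \<open>Q\<close>: the equation for \<open>x\<close> with
frozen data \<open>y\<close> is solved, and the frozen data are then identified with the solution.\<close>

lemma implicit_contraction:
  fixes xb :: "'a::euclidean_space"
  assumes "r \<ge> 0" "0 \<le> q" "q < 1"
    and ex: "\<And>y. y \<in> cball xb r \<Longrightarrow> \<exists>x\<in>cball xb r. Q y x"
    and lip: "\<And>x1 x2 y1 y2. x1 \<in> cball xb r \<Longrightarrow> x2 \<in> cball xb r \<Longrightarrow> y1 \<in> cball xb r \<Longrightarrow> y2 \<in> cball xb r \<Longrightarrow>
        Q y1 x1 \<Longrightarrow> Q y2 x2 \<Longrightarrow> norm (x1 - x2) \<le> q * norm (y1 - y2)"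
  shows "\<exists>x\<in>cball xb r. Q x x"
proof -
  define F where "F y = (SOME x. x \<in> cball xb r \<and> Q y x)" for y
  have F: "F y \<in> cball xb r \<and> Q y (F y)" if "y \<in> cball xb r" for y
    unfolding F_def using someI_ex[of "\<lambda>x. x \<in> cball xb r \<and> Q y x"] ex[OF that] by blast
  have "\<exists>!x\<in>cball xb r. F x = x"
  proof (rule Banach_fix)
    show "complete (cball xb r)" by (simp add: complete_eq_closed)
    show "cball xb r \<noteq> {}" using \<open>r \<ge> 0\<close> by simp
    show "F ` cball xb r \<subseteq> cball xb r" using F by blast
    show "dist (F x) (F y) \<le> q * dist x y" if "x \<in> cball xb r" "y \<in> cball xb r" for x y
      using lip[of "F x" "F y" x y] F that by (simp add: dist_norm)
  qed (use assms in auto)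
  then show ?thesis using F by metis
qed

section \<open>Normal cones and multipliers\<close>

text \<open>A quadratic bound is absorbed by any linear one near \<open>zb\<close>.\<close>

lemma regular_normal_cone_if_quadratic:
  assumes "e > 0"
    and quad: "\<And>z. z \<in> \<Omega> \<Longrightarrow> norm (z - zb) < e \<Longrightarrow> \<zeta> \<bullet> (z - zb) \<le> C * (norm (z - zb))\<^sup>2"
  shows "\<zeta> \<in> regular_normal_cone \<Omega> zb"
proof -
  have "Limsup (at zb within \<Omega>) (\<lambda>z. ereal (\<zeta> \<bullet> (z - zb) / norm (z - zb))) \<le> 0 + ereal \<epsilon>" if "\<epsilon> > 0" for \<epsilon> :: real
  proof -
    let ?d = "min e (\<epsilon> / (\<bar>C\<bar> + 1))"
    have "?d > 0" using \<open>e > 0\<close> that by simp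
    have "\<zeta> \<bullet> (z - zb) / norm (z - zb) \<le> \<epsilon>" if z: "z \<in> \<Omega>" "z \<noteq> zb" "dist z zb < ?d" for z
    proof -
      have n: "norm (z - zb) > 0" "norm (z - zb) < e" "norm (z - zb) * (\<bar>C\<bar> + 1) < \<epsilon>"
        using z by (auto simp: dist_norm field_simps)
      have "\<zeta> \<bullet> (z - zb) / norm (z - zb) \<le> C * (norm (z - zb))\<^sup>2 / norm (z - zb)"
        using quad[OF z(1) n(2)] n(1) by (intro divide_right_mono) auto
      also have "\<dots> = C * norm (z - zb)" using n(1) by (simp add: power2_eq_square)
      also have "\<dots> \<le> (\<bar>C\<bar> + 1) * norm (z - zb)" using n(1) by (intro mult_right_mono) auto
      also have "\<dots> \<le> \<epsilon>" using n(3) by (simp add: mult.commute)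
      finally show ?thesis .
    qed
    then have "eventually (\<lambda>z. ereal (\<zeta> \<bullet> (z - zb) / norm (z - zb)) \<le> ereal \<epsilon>) (at zb within \<Omega>)"
      unfolding eventually_at ereal_less_eq(3) using \<open>?d > 0\<close> by blast
    then show ?thesis by (simp add: Limsup_bounded)
  qed
  then have "Limsup (at zb within \<Omega>) (\<lambda>z. ereal (\<zeta> \<bullet> (z - zb) / norm (z - zb))) \<le> 0"
    by (rule ereal_le_epsilon2)
  then show ?thesis by (simp add: regular_normal_cone_def)
qed

lemma regular_normal_coneD:
  assumes "\<zeta> \<in> regular_normal_cone \<Omega> zb" "e > 0"
  shows "eventually (\<lambda>z. \<zeta> \<bullet> (z - zb) \<le> e * norm (z - zb)) (at zb within \<Omega>)"
proof -
  have "Limsup (at zb within \<Omega>) (\<lambda>z. ereal (\<zeta> \<bullet> (z - zb) / norm (z - zb))) < ereal e"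
    using assms by (auto simp: regular_normal_cone_def intro: order_le_less_trans)
  then have "eventually (\<lambda>z. ereal (\<zeta> \<bullet> (z - zb) / norm (z - zb)) < ereal e) (at zb within \<Omega>)"
    by (rule Limsup_lessD)
  moreover have "eventually (\<lambda>z. z \<noteq> zb) (at zb within \<Omega>)"
    by (simp add: eventually_at_filter)
  ultimately show ?thesis
    by eventually_elim (auto simp: pos_divide_less_eq)
qed

lemma regular_subset_limiting:
  "zb \<in> \<Omega> \<Longrightarrow> regular_normal_cone \<Omega> zb \<subseteq> limiting_normal_cone \<Omega> zb"
  unfolding limiting_normal_cone_def
  by (auto intro!: exI[of _ "\<lambda>k. zb"] exI[of _ "\<lambda>k. x" for x])

abbreviation gradients ::
  "('m \<Rightarrow> (real^'n) \<times> (real^'d) \<Rightarrow> real) \<Rightarrow> real^'n \<Rightarrow> real^'d \<Rightarrow> 'm \<Rightarrow> real^'n" where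
  "gradients \<phi> x p \<equiv> \<lambda>i. grad_x (\<phi> i) x p"

lemma Lagr_eq_comb: "Lagr f \<phi> x p \<mu> = f (x, p) + comb (gradients \<phi> x p) \<mu>"
  by (simp add: Lagr_def comb_def)

text \<open>Sign and complementarity conditions for a multiplier at a feasible point, without the stationarity equation.\<close>

definition kkt ::
  "('m::finite \<Rightarrow> (real^'n) \<times> (real^'d) \<Rightarrow> real) \<Rightarrow> real^'n \<Rightarrow> real^'d \<Rightarrow> real^'m \<Rightarrow> bool" where
  "kkt \<phi> x p \<mu> \<longleftrightarrow> x \<in> feasible_set \<phi> p \<and> (\<forall>i. 0 \<le> \<mu> $ i) \<and> supp \<mu> \<subseteq> active_set \<phi> x p"

lemma multipliers_iff_kkt:
  assumes "x \<in> feasible_set \<phi> p"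
  shows "\<mu> \<in> multipliers f \<phi> x p v \<longleftrightarrow> kkt \<phi> x p \<mu> \<and> v = Lagr f \<phi> x p \<mu>"
proof -
  have "\<mu> \<bullet> constr_vec \<phi> x p = 0 \<longleftrightarrow> supp \<mu> \<subseteq> active_set \<phi> x p" if "\<forall>i. 0 \<le> \<mu> $ i"
  proof -
    have "\<And>i. 0 \<le> - (\<mu> $ i * \<phi> i (x, p))"
      using assms that by (auto simp: feasible_set_def mult_nonneg_nonpos)
    then have "(\<Sum>i\<in>UNIV. - (\<mu> $ i * \<phi> i (x, p))) = 0 \<longleftrightarrow> (\<forall>i. \<mu> $ i * \<phi> i (x, p) = 0)"
      by (subst sum_nonneg_eq_0_iff) auto
    then show ?thesis
      by (auto simp: inner_vec_def constr_vec_def supp_def active_set_def sum_negf)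
  qed
  then show ?thesis
    using assms by (auto simp: multipliers_def kkt_def)
qed

lemma active_pos_eq_supp: "kkt \<phi> x p \<mu> \<Longrightarrow> active_pos \<phi> x p \<mu> = supp \<mu>"
  by (fastforce simp: kkt_def active_pos_def supp_def order_less_le)

lemma limiting_normal_coneE:
  assumes "\<zeta> \<in> limiting_normal_cone \<Omega> zb"
  obtains z w where "zb \<in> \<Omega>" "\<And>k. z k \<in> \<Omega>" "\<And>k. w k \<in> regular_normal_cone \<Omega> (z k)"
    "z \<longlonglongrightarrow> zb" "w \<longlonglongrightarrow> \<zeta>"
proof -
  have zb: "zb \<in> \<Omega>" using assms by (simp add: limiting_normal_cone_def split: if_splits)
  obtain z w where "\<forall>k. z k \<in> \<Omega> \<and> w k \<in> regular_normal_cone \<Omega> (z k)" "z \<longlonglongrightarrow> zb" "w \<longlonglongrightarrow> \<zeta>"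
    using assms zb unfolding limiting_normal_cone_def by (simp only: if_True mem_Collect_eq) blast
  then show thesis by (intro that[of z w] zb) auto
qed

lemma regular_normal_direction:
  assumes \<zeta>: "\<zeta> \<in> regular_normal_cone \<Omega> x"
    and w: "eventually (\<lambda>t. x + t *\<^sub>R w \<in> \<Omega>) (at_right 0)"
  shows "\<zeta> \<bullet> w \<le> 0"
proof (cases "w = 0")
  case False
  have "\<zeta> \<bullet> w \<le> e" if "e > 0" for e
  proof -
    let ?e = "e / norm w"
    have "eventually (\<lambda>z. \<zeta> \<bullet> (z - x) \<le> ?e * norm (z - x)) (at x within \<Omega>)"
      using \<zeta> that False by (intro regular_normal_coneD) auto
    moreover have "filterlim (\<lambda>t. x + t *\<^sub>R w) (at x within \<Omega>) (at_right 0)"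
    proof -
      have "((\<lambda>t. x + t *\<^sub>R w) \<longlongrightarrow> x + 0 *\<^sub>R w) (at_right 0)" by (intro tendsto_intros)
      moreover have "eventually (\<lambda>t. x + t *\<^sub>R w \<in> \<Omega> \<and> x + t *\<^sub>R w \<noteq> x) (at_right 0)"
        using w eventually_at_right_less[of "0::real"]
        by eventually_elim (use False in auto)
      ultimately show ?thesis by (simp add: filterlim_at)
    qed
    ultimately have "eventually (\<lambda>t. \<zeta> \<bullet> (x + t *\<^sub>R w - x) \<le> ?e * norm (x + t *\<^sub>R w - x)) (at_right 0)"
      by (rule eventually_compose_filterlim)
    then have "eventually (\<lambda>t. t > 0 \<and> \<zeta> \<bullet> (x + t *\<^sub>R w - x) \<le> ?e * norm (x + t *\<^sub>R w - x)) (at_right 0)"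
      using eventually_at_right_less[of "0::real"] by eventually_elim simp
    then obtain t :: real where t: "t > 0" "\<zeta> \<bullet> (x + t *\<^sub>R w - x) \<le> ?e * norm (x + t *\<^sub>R w - x)"
      using eventually_happens'[OF trivial_limit_at_right_real] by blast
    then have "t * (\<zeta> \<bullet> w) \<le> t * e" using False by (simp add: mult.commute)
    then show ?thesis using t(1) by simp
  qed
  then show ?thesis by (rule field_le_epsilon[of _ 0, simplified])
qed simp

lemma regular_normal_orthant:
  fixes z :: "real^'m::finite"
  assumes "w \<in> regular_normal_cone {y. \<forall>i. y $ i \<le> 0} z" and z: "\<forall>i. z $ i \<le> 0"
  shows "0 \<le> w $ i" "z $ i < 0 \<Longrightarrow> w $ i = 0"
proof -
  have "w \<bullet> (- axis i 1) \<le> 0"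
  proof (rule regular_normal_direction[OF assms(1)])
    show "\<forall>\<^sub>F t in at_right 0. z + t *\<^sub>R - axis i 1 \<in> {y. \<forall>i. y $ i \<le> 0}"
      using eventually_at_right_less[of "0::real"]
    proof eventually_elim
      case (elim t)
      then show ?case using z by (auto simp: axis_def) (metis less_imp_le order_trans)
    qed
  qed
  then show pos: "0 \<le> w $ i" by (simp add: inner_axis)
  assume neg: "z $ i < 0"
  have "w \<bullet> axis i 1 \<le> 0"
  proof (rule regular_normal_direction[OF assms(1)])
    have "eventually (\<lambda>t. t < - (z $ i)) (at_right 0)"
      using neg by (intro order_tendstoD(2)[OF tendsto_ident_at]) auto
    then show "\<forall>\<^sub>F t in at_right 0. z + t *\<^sub>R axis i 1 \<in> {y. \<forall>i. y $ i \<le> 0}"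
    proof eventually_elim
      case (elim t)
      then show ?case using z by (auto simp: axis_def)
    qed
  qed
  with pos show "w $ i = 0" by (simp add: inner_axis)
qed

text \<open>The orthant is convex, so its limiting normals at a point are the nonnegative vectors supported on the zero coordinates.\<close>

lemma Psi_iff_kkt: "v \<in> Psi f \<phi> x p \<longleftrightarrow> (\<exists>\<mu>. kkt \<phi> x p \<mu> \<and> v = Lagr f \<phi> x p \<mu>)"
proof -
  let ?O = "{y :: real^'m. \<forall>i. y $ i \<le> 0}" and ?c = "constr_vec \<phi> x p"
  have "\<mu> \<in> limiting_normal_cone ?O ?c \<longleftrightarrow> kkt \<phi> x p \<mu>" for \<mu>
  proof
    assume \<mu>: "\<mu> \<in> limiting_normal_cone ?O ?c"
    then obtain z w where c: "?c \<in> ?O" and zw: "\<And>k. z k \<in> ?O" "\<And>k. w k \<in> regular_normal_cone ?O (z k)"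
        "z \<longlonglongrightarrow> ?c" "w \<longlonglongrightarrow> \<mu>"
      by (rule limiting_normal_coneE) (rule that)
    have comp: "(\<lambda>k. w k $ i) \<longlonglongrightarrow> \<mu> $ i" "(\<lambda>k. z k $ i) \<longlonglongrightarrow> \<phi> i (x, p)" for i
      using tendsto_vec_nth[OF zw(4), of i] tendsto_vec_nth[OF zw(3), of i] by (auto simp: constr_vec_def)
    have "0 \<le> \<mu> $ i" for i
      using comp(1)[of i] regular_normal_orthant(1)[OF zw(2)] zw(1) by (intro LIMSEQ_le_const) auto
    moreover have "\<mu> $ i = 0" if "\<phi> i (x, p) < 0" for i
    proof -
      have "eventually (\<lambda>k. z k $ i < 0) sequentially" using comp(2) that by (rule order_tendstoD(2))
      then have "eventually (\<lambda>k. w k $ i = 0) sequentially"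
        by eventually_elim (use regular_normal_orthant(2)[OF zw(2)] zw(1) in auto)
      then have "(\<lambda>k. w k $ i) \<longlonglongrightarrow> 0" by (rule tendsto_eventually)
      then show ?thesis using comp(1) LIMSEQ_unique by blast
    qed
    ultimately show "kkt \<phi> x p \<mu>"
      using c by (force simp: kkt_def feasible_set_def active_set_def supp_def constr_vec_def order_less_le)
  next
    assume k: "kkt \<phi> x p \<mu>"
    then have c: "?c \<in> ?O" by (simp add: kkt_def feasible_set_def constr_vec_def)
    have "\<mu> \<bullet> (z - ?c) \<le> 0 * (norm (z - ?c))\<^sup>2" if "z \<in> ?O" for z
    proof -
      have "\<mu> $ i * (z $ i - \<phi> i (x, p)) \<le> 0" for i
      proof (cases "i \<in> supp \<mu>")
        case True
        then have "\<phi> i (x, p) = 0" using k by (auto simp: kkt_def active_set_def)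
        then show ?thesis using that k by (simp add: kkt_def mult_nonneg_nonpos)
      qed (simp add: supp_def)
      then have "(\<Sum>i\<in>UNIV. \<mu> $ i * (z $ i - \<phi> i (x, p))) \<le> 0" by (intro sum_nonpos) auto
      then show ?thesis by (simp add: inner_vec_def constr_vec_def)
    qed
    then have "\<mu> \<in> regular_normal_cone ?O ?c"
      by (intro regular_normal_cone_if_quadratic[of 1 _ _ _ 0]) auto
    then show "\<mu> \<in> limiting_normal_cone ?O ?c" using regular_subset_limiting[OF c] by blast
  qed
  then show ?thesis by (auto simp: Psi_def)
qed

text \<open>The quadratic form is even in \<open>u\<close>, so the cone in the definition may be replaced by its negative, which
consists of directions tangent to the feasible set. A triple in the graph of \<open>Psi\<close> with one of its multipliers is the same
as a point \<open>(x, p)\<close> with a multiplier satisfying \<open>kkt\<close>.\<close>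

lemma GUSOSC_iff_kkt:
  "GUSOSC f \<phi> xb pb vb \<longleftrightarrow>
     (\<exists>\<mu>. kkt \<phi> xb pb \<mu> \<and> vb = Lagr f \<phi> xb pb \<mu>) \<and>
     (\<exists>\<eta>>0. \<exists>l>0. \<forall>x\<in>cball xb \<eta>. \<forall>p\<in>cball pb \<eta>. \<forall>\<mu>. kkt \<phi> x p \<mu> \<longrightarrow> Lagr f \<phi> x p \<mu> \<in> cball vb \<eta> \<longrightarrow>
        (\<forall>u. (\<forall>i\<in>supp \<mu>. grad_x (\<phi> i) x p \<bullet> u = 0) \<longrightarrow> (\<forall>i\<in>active_set \<phi> x p. grad_x (\<phi> i) x p \<bullet> u \<le> 0) \<longrightarrow>
           (jacobian (\<lambda>y. Lagr f \<phi> y p \<mu>) (at x) *v u) \<bullet> u \<ge> l * (norm u)\<^sup>2))"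
proof -
  let ?Q = "\<lambda>l x p \<mu> u. (jacobian (\<lambda>y. Lagr f \<phi> y p \<mu>) (at x) *v u) \<bullet> u \<ge> l * (norm u)\<^sup>2"
  have neg: "?Q l x p \<mu> (- u) \<longleftrightarrow> ?Q l x p \<mu> u" for l x p \<mu> u
    by (simp add: linear_neg[OF matrix_vector_mul_linear])
  have all_neg: "(\<forall>u. P u) \<longleftrightarrow> (\<forall>u. P (- u))" for P :: "real^'n \<Rightarrow> bool"
    by (metis minus_minus)
  have uiff: "(\<forall>u. (\<forall>i\<in>active_pos \<phi> x p \<mu>. grad_x (\<phi> i) x p \<bullet> u = 0) \<longrightarrow>
           (\<forall>i\<in>active_set \<phi> x p - active_pos \<phi> x p \<mu>. grad_x (\<phi> i) x p \<bullet> u \<ge> 0) \<longrightarrow> ?Q l x p \<mu> u) \<longleftrightarrow>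
      (\<forall>u. (\<forall>i\<in>supp \<mu>. grad_x (\<phi> i) x p \<bullet> u = 0) \<longrightarrow> (\<forall>i\<in>active_set \<phi> x p. grad_x (\<phi> i) x p \<bullet> u \<le> 0) \<longrightarrow>
           ?Q l x p \<mu> u)" (is "(\<forall>u. ?A u \<longrightarrow> ?B u \<longrightarrow> _) \<longleftrightarrow> (\<forall>u. ?C u \<longrightarrow> ?D u \<longrightarrow> _)")
    if "kkt \<phi> x p \<mu>" for l x p \<mu>
  proof -
    have *: "?A (- u) \<and> ?B (- u) \<longleftrightarrow> ?C u \<and> ?D u" for u
      using that by (auto simp: active_pos_eq_supp[OF that] kkt_def)
    have "(\<forall>u. ?A u \<longrightarrow> ?B u \<longrightarrow> ?Q l x p \<mu> u) \<longleftrightarrow> (\<forall>u. ?A (- u) \<longrightarrow> ?B (- u) \<longrightarrow> ?Q l x p \<mu> (- u))"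
      by (rule all_neg)
    also have "\<dots> \<longleftrightarrow> (\<forall>u. ?C u \<longrightarrow> ?D u \<longrightarrow> ?Q l x p \<mu> u)"
      unfolding neg using * by blast
    finally show ?thesis .
  qed
  have mult: "\<mu> \<in> multipliers f \<phi> x p v \<longleftrightarrow> kkt \<phi> x p \<mu> \<and> v = Lagr f \<phi> x p \<mu>"
    if "v \<in> Psi f \<phi> x p" for x p v \<mu>
    using that by (intro multipliers_iff_kkt) (auto simp: Psi_iff_kkt kkt_def)
  have "(\<forall>x p v. v \<in> Psi f \<phi> x p \<longrightarrow> x \<in> cball xb \<eta> \<longrightarrow> p \<in> cball pb \<eta> \<longrightarrow> v \<in> cball vb \<eta> \<longrightarrow>
        (\<forall>\<mu>\<in>multipliers f \<phi> x p v. \<forall>u.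
           (\<forall>i\<in>active_pos \<phi> x p \<mu>. grad_x (\<phi> i) x p \<bullet> u = 0) \<longrightarrow>
           (\<forall>i\<in>active_set \<phi> x p - active_pos \<phi> x p \<mu>. grad_x (\<phi> i) x p \<bullet> u \<ge> 0) \<longrightarrow> ?Q l x p \<mu> u)) \<longleftrightarrow>
     (\<forall>x\<in>cball xb \<eta>. \<forall>p\<in>cball pb \<eta>. \<forall>\<mu>. kkt \<phi> x p \<mu> \<longrightarrow> Lagr f \<phi> x p \<mu> \<in> cball vb \<eta> \<longrightarrow>
        (\<forall>u. (\<forall>i\<in>supp \<mu>. grad_x (\<phi> i) x p \<bullet> u = 0) \<longrightarrow> (\<forall>i\<in>active_set \<phi> x p. grad_x (\<phi> i) x p \<bullet> u \<le> 0) \<longrightarrow>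
           ?Q l x p \<mu> u))" (is "?L \<longleftrightarrow> ?R") for \<eta> l
  proof
    assume L: ?L
    show ?R
    proof (intro ballI allI impI)
      fix x p \<mu> assume *: "x \<in> cball xb \<eta>" "p \<in> cball pb \<eta>" "kkt \<phi> x p \<mu>" "Lagr f \<phi> x p \<mu> \<in> cball vb \<eta>"
      then have P: "Lagr f \<phi> x p \<mu> \<in> Psi f \<phi> x p" by (auto simp: Psi_iff_kkt)
      then have "\<mu> \<in> multipliers f \<phi> x p (Lagr f \<phi> x p \<mu>)" using * by (simp add: mult)
      with L P * uiff[OF *(3), of l]
      show "\<And>u. \<forall>i\<in>supp \<mu>. grad_x (\<phi> i) x p \<bullet> u = 0 \<Longrightarrow> \<forall>i\<in>active_set \<phi> x p. grad_x (\<phi> i) x p \<bullet> u \<le> 0 \<Longrightarrow>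
           ?Q l x p \<mu> u" by blast
    qed
  next
    assume R: ?R
    show ?L
    proof (intro allI impI ballI)
      fix x p v \<mu> assume *: "v \<in> Psi f \<phi> x p" "x \<in> cball xb \<eta>" "p \<in> cball pb \<eta>" "v \<in> cball vb \<eta>" "\<mu> \<in> multipliers f \<phi> x p v"
      then have k: "kkt \<phi> x p \<mu>" "v = Lagr f \<phi> x p \<mu>" by (auto simp: mult)
      with R * uiff[OF k(1), of l]
      show "\<And>u. (\<forall>i\<in>active_pos \<phi> x p \<mu>. grad_x (\<phi> i) x p \<bullet> u = 0) \<Longrightarrow>
           (\<forall>i\<in>active_set \<phi> x p - active_pos \<phi> x p \<mu>. grad_x (\<phi> i) x p \<bullet> u \<ge> 0) \<Longrightarrow> ?Q l x p \<mu> u" by blast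
    qed
  qed
  then show ?thesis unfolding GUSOSC_def Psi_iff_kkt[of vb] by simp
qed

section \<open>Constraints near the reference point\<close>

text \<open>One radius \<open>\<rho>\<close> and one constant \<open>B\<close> for all smoothness estimates of the constraints near \<open>(xb, pb)\<close>.
The vector \<open>d\<close> is a descent direction of all constraints active at the reference point, with a rate \<open>\<tau>\<close> that is
valid in the whole neighborhood.\<close>

locale constraint_nbhd =
  fixes \<phi> :: "'m::finite \<Rightarrow> (real^'n) \<times> (real^'d) \<Rightarrow> real"
    and xb :: "real^'n" and pb :: "real^'d" and \<rho> B \<tau> :: real and d :: "real^'n"
  assumes rho: "\<rho> > 0" and B: "B > 0" and tau: "\<tau> > 0"
    and taylor: "\<And>i x y p. x \<in> cball xb \<rho> \<Longrightarrow> y \<in> cball xb \<rho> \<Longrightarrow> p \<in> cball pb \<rho> \<Longrightarrow>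
      \<bar>\<phi> i (y, p) - \<phi> i (x, p) - grad_x (\<phi> i) x p \<bullet> (y - x)\<bar> \<le> B * (norm (y - x))\<^sup>2"
    and phi_deriv: "\<And>i x p. x \<in> cball xb \<rho> \<Longrightarrow> p \<in> cball pb \<rho> \<Longrightarrow>
      ((\<lambda>y. \<phi> i (y, p)) has_derivative (\<lambda>u. grad_x (\<phi> i) x p \<bullet> u)) (at x)"
    and phi_lip: "\<And>i x p q. x \<in> cball xb \<rho> \<Longrightarrow> p \<in> cball pb \<rho> \<Longrightarrow> q \<in> cball pb \<rho> \<Longrightarrow>
      \<bar>\<phi> i (x, p) - \<phi> i (x, q)\<bar> \<le> B * norm (p - q)"
    and grad_lip: "\<And>i x y p q. x \<in> cball xb \<rho> \<Longrightarrow> y \<in> cball xb \<rho> \<Longrightarrow> p \<in> cball pb \<rho> \<Longrightarrow> q \<in> cball pb \<rho> \<Longrightarrow>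
      norm (grad_x (\<phi> i) x p - grad_x (\<phi> i) y q) \<le> B * (norm (x - y) + norm (p - q))"
    and grad_bound: "\<And>i x p. x \<in> cball xb \<rho> \<Longrightarrow> p \<in> cball pb \<rho> \<Longrightarrow> norm (grad_x (\<phi> i) x p) \<le> B"
    and grad_diff: "\<And>i x p. x \<in> cball xb \<rho> \<Longrightarrow> p \<in> cball pb \<rho> \<Longrightarrow>
      (\<lambda>y. grad_x (\<phi> i) y p) differentiable (at x)"
    and descent: "\<And>i x p. i \<in> active_set \<phi> xb pb \<Longrightarrow> x \<in> cball xb \<rho> \<Longrightarrow> p \<in> cball pb \<rho> \<Longrightarrow>
      grad_x (\<phi> i) x p \<bullet> d \<le> - \<tau>"
    and active_sub: "\<And>x p. x \<in> cball xb \<rho> \<Longrightarrow> p \<in> cball pb \<rho> \<Longrightarrow> active_set \<phi> x p \<subseteq> active_set \<phi> xb pb"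
begin

abbreviation "G \<equiv> gradients \<phi>"

text \<open>Pairing with \<open>d\<close>: every active gradient contributes at most \<open>- \<tau>\<close> per unit of multiplier.\<close>

lemma kkt_sum_bound:
  assumes k: "kkt \<phi> x p \<mu>" and "x \<in> cball xb \<rho>" "p \<in> cball pb \<rho>"
  shows "(\<Sum>i\<in>UNIV. \<mu> $ i) \<le> norm (comb (G x p) \<mu>) * norm d / \<tau>"
proof -
  have "\<mu> $ i * (G x p i \<bullet> d) \<le> \<mu> $ i * (- \<tau>)" for i
  proof (cases "i \<in> supp \<mu>")
    case True
    then have "i \<in> active_set \<phi> xb pb"
      using k active_sub[OF assms(2,3)] by (auto simp: kkt_def)
    then show ?thesis
      using descent assms k by (intro mult_left_mono) (auto simp: kkt_def)
  qed (simp add: supp_def)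
  then have "comb (G x p) \<mu> \<bullet> d \<le> (\<Sum>i\<in>UNIV. \<mu> $ i * (- \<tau>))"
    unfolding comb_inner by (intro sum_mono)
  also have "\<dots> = - (\<tau> * (\<Sum>i\<in>UNIV. \<mu> $ i))"
    by (simp add: sum_distrib_left mult.commute sum_negf)
  finally have "\<tau> * (\<Sum>i\<in>UNIV. \<mu> $ i) \<le> - (comb (G x p) \<mu> \<bullet> d)" by simp
  also have "\<dots> \<le> norm (comb (G x p) \<mu>) * norm d"
    using norm_cauchy_schwarz[of "- comb (G x p) \<mu>" d] by simp
  finally show ?thesis using tau by (simp add: field_simps)
qed

lemma kkt_norm_le_sum: "kkt \<phi> x p \<mu> \<Longrightarrow> norm \<mu> \<le> (\<Sum>i\<in>UNIV. \<mu> $ i)"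
  using norm_le_l1_cart[of \<mu>] by (auto simp: kkt_def)

text \<open>The feasible sets are uniformly prox-regular: a tight constraint with nonnegative multiplier is nonpositive at
\<open>y\<close>, so its linearization is nonpositive up to the Taylor remainder.\<close>

lemma kkt_quadratic_normal:
  assumes k: "kkt \<phi> x p \<mu>" and x: "x \<in> cball xb \<rho>" "y \<in> cball xb \<rho>" "p \<in> cball pb \<rho>"
    and y: "y \<in> feasible_set \<phi> p"
  shows "comb (G x p) \<mu> \<bullet> (y - x) \<le> B * (\<Sum>i\<in>UNIV. \<mu> $ i) * (norm (y - x))\<^sup>2"
proof -
  have "\<mu> $ i * (G x p i \<bullet> (y - x)) \<le> \<mu> $ i * (B * (norm (y - x))\<^sup>2)" for i
  proof (cases "i \<in> supp \<mu>")
    case True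
    then have "\<phi> i (x, p) = 0" "\<phi> i (y, p) \<le> 0"
      using k y by (auto simp: kkt_def active_set_def feasible_set_def)
    then show ?thesis
      using taylor[OF x, of i] k by (intro mult_left_mono) (auto simp: kkt_def)
  qed (simp add: supp_def)
  then have "comb (G x p) \<mu> \<bullet> (y - x) \<le> (\<Sum>i\<in>UNIV. \<mu> $ i * (B * (norm (y - x))\<^sup>2))"
    unfolding comb_inner by (intro sum_mono)
  then show ?thesis by (simp add: sum_distrib_left sum_distrib_right mult_ac)
qed

lemma G_tendsto:
  assumes "X \<longlonglongrightarrow> x" "P \<longlonglongrightarrow> p" "\<And>k. X k \<in> cball xb \<rho>" "\<And>k. P k \<in> cball pb \<rho>"
  shows "(\<lambda>k. G (X k) (P k) i) \<longlonglongrightarrow> G x p i"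
proof -
  have "x \<in> cball xb \<rho>" "p \<in> cball pb \<rho>"
    using assms closed_sequentially[OF closed_cball] by blast+
  have "(\<lambda>k. B * (norm (X k - x) + norm (P k - p))) \<longlonglongrightarrow> B * (norm (x - x) + norm (p - p))"
    by (intro tendsto_intros assms)
  then have lim: "(\<lambda>k. B * (norm (X k - x) + norm (P k - p))) \<longlonglongrightarrow> 0" by simp
  have "norm (G (X k) (P k) i - G x p i) \<le> B * (norm (X k - x) + norm (P k - p))" for k
    using assms(3,4) \<open>x \<in> cball xb \<rho>\<close> \<open>p \<in> cball pb \<rho>\<close> by (intro grad_lip)
  then have "(\<lambda>k. G (X k) (P k) i - G x p i) \<longlonglongrightarrow> 0"
    by (intro Lim_null_comparison[OF _ lim] always_eventually allI)
  then show ?thesis by (rule LIM_zero_cancel)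
qed

lemma phi_tendsto:
  assumes "X \<longlonglongrightarrow> x" "P \<longlonglongrightarrow> p" "\<And>k. X k \<in> cball xb \<rho>" "\<And>k. P k \<in> cball pb \<rho>"
  shows "(\<lambda>k. \<phi> i (X k, P k)) \<longlonglongrightarrow> \<phi> i (x, p)"
proof -
  have x: "x \<in> cball xb \<rho>" "p \<in> cball pb \<rho>"
    using assms closed_sequentially[OF closed_cball] by blast+
  have "\<bar>\<phi> i (X k, P k) - \<phi> i (x, p)\<bar> \<le> B * norm (P k - p) + B * norm (X k - x) + B * (norm (X k - x))\<^sup>2" for k
  proof -
    have "\<bar>G x p i \<bullet> (X k - x)\<bar> \<le> B * norm (X k - x)"
      using Cauchy_Schwarz_ineq2[of "G x p i" "X k - x"] grad_bound[OF x, of i]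
      by (meson mult_right_mono norm_ge_zero order_trans)
    then show ?thesis
      using phi_lip[OF assms(3)[of k] assms(4)[of k] x(2), of i] taylor[OF x(1) assms(3)[of k] x(2), of i] by linarith
  qed
  then have bound: "norm (\<phi> i (X k, P k) - \<phi> i (x, p)) \<le>
      B * norm (P k - p) + B * norm (X k - x) + B * (norm (X k - x))\<^sup>2" for k
    unfolding real_norm_def .
  have "(\<lambda>k. B * norm (P k - p) + B * norm (X k - x) + B * (norm (X k - x))\<^sup>2) \<longlonglongrightarrow>
      B * norm (p - p) + B * norm (x - x) + B * (norm (x - x))\<^sup>2"
    by (intro tendsto_intros assms)
  then have lim: "(\<lambda>k. B * norm (P k - p) + B * norm (X k - x) + B * (norm (X k - x))\<^sup>2) \<longlonglongrightarrow> 0" by simp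
  have "(\<lambda>k. \<phi> i (X k, P k) - \<phi> i (x, p)) \<longlonglongrightarrow> 0"
    by (intro Lim_null_comparison[OF _ lim] always_eventually allI bound)
  then show ?thesis by (rule LIM_zero_cancel)
qed

lemma supp_limit:
  assumes "M \<longlonglongrightarrow> \<mu>" "i \<in> supp \<mu>"
  shows "eventually (\<lambda>k. i \<in> supp (M k)) sequentially"
proof -
  have "(\<lambda>k. M k $ i) \<longlonglongrightarrow> \<mu> $ i" by (intro tendsto_intros assms)
  then show ?thesis using assms(2) unfolding supp_def mem_Collect_eq by (rule tendsto_imp_eventually_ne)
qed

text \<open>The conditions \<open>kkt\<close> are closed, because a positive limit multiplier forces the constraint to be tight
along the sequence eventually.\<close>

lemma kkt_limit:
  assumes X: "X \<longlonglongrightarrow> x" "P \<longlonglongrightarrow> p" "\<And>k. X k \<in> cball xb \<rho>" "\<And>k. P k \<in> cball pb \<rho>"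
    and M: "M \<longlonglongrightarrow> \<mu>" and k: "\<And>k. kkt \<phi> (X k) (P k) (M k)"
  shows "kkt \<phi> x p \<mu>" "(\<lambda>k. comb (G (X k) (P k)) (M k)) \<longlonglongrightarrow> comb (G x p) \<mu>"
proof -
  have feas: "\<phi> i (x, p) \<le> 0" for i
    using phi_tendsto[OF X, of i] k
    by (intro LIMSEQ_le_const2[of "\<lambda>k. \<phi> i (X k, P k)"]) (auto simp: kkt_def feasible_set_def)
  have pos: "0 \<le> \<mu> $ i" for i
    using k by (intro LIMSEQ_le_const[of "\<lambda>k. M k $ i"] tendsto_intros M) (auto simp: kkt_def)
  have "\<phi> i (x, p) = 0" if "i \<in> supp \<mu>" for i
  proof -
    have "eventually (\<lambda>k. \<phi> i (X k, P k) = 0) sequentially"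
      using supp_limit[OF M that] by eventually_elim (use k in \<open>auto simp: kkt_def active_set_def\<close>)
    then have "(\<lambda>k. \<phi> i (X k, P k)) \<longlonglongrightarrow> 0" by (rule tendsto_eventually)
    then show ?thesis using phi_tendsto[OF X, of i] LIMSEQ_unique by blast
  qed
  with feas pos show "kkt \<phi> x p \<mu>"
    by (auto simp: kkt_def feasible_set_def active_set_def)
  show "(\<lambda>k. comb (G (X k) (P k)) (M k)) \<longlonglongrightarrow> comb (G x p) \<mu>"
    unfolding comb_def by (intro tendsto_intros M G_tendsto[OF X])
qed

lemma kkt_convergent_subsequence:
  assumes X: "\<And>k. X k \<in> cball xb \<rho>" "\<And>k. P k \<in> cball pb \<rho>"
    and k: "\<And>k. kkt \<phi> (X k) (P k) (M k)"
    and bd: "\<And>k. norm (comb (G (X k) (P k)) (M k)) \<le> c"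
  obtains \<mu> and r :: "nat \<Rightarrow> nat" where "strict_mono r" "(M \<circ> r) \<longlonglongrightarrow> \<mu>"
proof -
  have "norm (M k) \<le> c * norm d / \<tau>" for k
  proof -
    have "norm (M k) \<le> norm (comb (G (X k) (P k)) (M k)) * norm d / \<tau>"
      using kkt_norm_le_sum[OF k] kkt_sum_bound[OF k X] by (rule order_trans)
    also have "\<dots> \<le> c * norm d / \<tau>"
      using tau bd by (intro divide_right_mono mult_right_mono) auto
    finally show ?thesis .
  qed
  then have "bounded (range M)" by (auto simp: bounded_iff)
  then show thesis using bounded_imp_convergent_subsequence that by blast
qed

lemma strictly_feasible_direction:
  assumes x: "x \<in> ball xb \<rho>" "p \<in> cball pb \<rho>" "x \<in> feasible_set \<phi> p"
    and w: "\<And>i. i \<in> active_set \<phi> x p \<Longrightarrow> G x p i \<bullet> w < 0"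
  shows "eventually (\<lambda>t. (\<forall>i. \<phi> i (x + t *\<^sub>R w, p) < 0) \<and> x + t *\<^sub>R w \<in> ball xb \<rho>) (at_right 0)"
proof -
  have "((\<lambda>t. x + t *\<^sub>R w) \<longlongrightarrow> x + 0 *\<^sub>R w) (at_right 0)" by (intro tendsto_intros)
  then have inb: "eventually (\<lambda>t. x + t *\<^sub>R w \<in> ball xb \<rho>) (at_right 0)"
    using x(1) by (intro topological_tendstoD[of _ x]) auto
  have "eventually (\<lambda>t. \<phi> i (x + t *\<^sub>R w, p) < 0) (at_right 0)" for i
  proof -
    have bound: "\<phi> i (x + t *\<^sub>R w, p) \<le> \<phi> i (x, p) + t * (G x p i \<bullet> w + t * (B * (norm w)\<^sup>2))"
      if "x + t *\<^sub>R w \<in> ball xb \<rho>" for t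
      using taylor[of x "x + t *\<^sub>R w" p i] x that
      by (auto simp: power_mult_distrib algebra_simps power2_eq_square)
    show ?thesis
    proof (cases "i \<in> active_set \<phi> x p")
      case True
      have "((\<lambda>t. G x p i \<bullet> w + t * (B * (norm w)\<^sup>2)) \<longlongrightarrow> G x p i \<bullet> w + 0 * (B * (norm w)\<^sup>2)) (at_right 0)"
        by (intro tendsto_intros)
      then have "eventually (\<lambda>t. G x p i \<bullet> w + t * (B * (norm w)\<^sup>2) < 0) (at_right 0)"
        using w[OF True] by (intro order_tendstoD(2)) auto
      then show ?thesis
        using inb eventually_at_right_less[of "0::real"]
      proof eventually_elim
        case (elim t)
        then have "t * (G x p i \<bullet> w + t * (B * (norm w)\<^sup>2)) < 0" by (intro mult_pos_neg) auto
        then show ?case using bound[OF elim(2)] True by (simp add: active_set_def)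
      qed
    next
      case False
      then have "\<phi> i (x, p) < 0" using x(3) by (simp add: active_set_def feasible_set_def order_less_le)
      moreover have "((\<lambda>t. \<phi> i (x, p) + t * (G x p i \<bullet> w + t * (B * (norm w)\<^sup>2))) \<longlongrightarrow>
          \<phi> i (x, p) + 0 * (G x p i \<bullet> w + 0 * (B * (norm w)\<^sup>2))) (at_right 0)"
        by (intro tendsto_intros)
      ultimately have "eventually (\<lambda>t. \<phi> i (x, p) + t * (G x p i \<bullet> w + t * (B * (norm w)\<^sup>2)) < 0) (at_right 0)"
        by (intro order_tendstoD(2)) auto
      then show ?thesis
        using inb by eventually_elim (use bound in force)
    qed
  qed
  then have "eventually (\<lambda>t. \<forall>i. \<phi> i (x + t *\<^sub>R w, p) < 0) (at_right 0)"
    by (simp add: eventually_all_finite)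
  with inb show ?thesis by eventually_elim simp
qed

text \<open>Adding a small multiple of \<open>d\<close> turns a direction of the linearized cone into one along which all active
constraints strictly decrease, hence into a feasible direction. A regular normal is therefore polar to the
linearized cone, and Farkas' lemma applies.\<close>

lemma regular_normal_imp_kkt:
  assumes x: "x \<in> ball xb \<rho>" "p \<in> cball pb \<rho>" "x \<in> feasible_set \<phi> p"
    and \<zeta>: "\<zeta> \<in> regular_normal_cone (feasible_set \<phi> p) x"
  shows "\<exists>\<mu>. kkt \<phi> x p \<mu> \<and> \<zeta> = comb (G x p) \<mu>"
proof -
  have xc: "x \<in> cball xb \<rho>" using x(1) by auto
  have strict: "\<zeta> \<bullet> w \<le> 0" if w: "\<And>i. i \<in> active_set \<phi> x p \<Longrightarrow> G x p i \<bullet> w < 0" for w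
  proof (rule regular_normal_direction[OF \<zeta>])
    have "eventually (\<lambda>t. (\<forall>i. \<phi> i (x + t *\<^sub>R w, p) < 0) \<and> x + t *\<^sub>R w \<in> ball xb \<rho>) (at_right 0)"
      by (rule strictly_feasible_direction[OF x]) (rule w)
    then show "eventually (\<lambda>t. x + t *\<^sub>R w \<in> feasible_set \<phi> p) (at_right 0)"
      by eventually_elim (simp add: feasible_set_def less_imp_le)
  qed
  have "\<zeta> \<bullet> u \<le> 0" if u: "\<And>i. i \<in> active_set \<phi> x p \<Longrightarrow> G x p i \<bullet> u \<le> 0" for u
  proof -
    have *: "\<zeta> \<bullet> (u + e *\<^sub>R d) \<le> 0" if "e > 0" for e
    proof (rule strict)
      fix i assume i: "i \<in> active_set \<phi> x p"
      then have "G x p i \<bullet> d \<le> - \<tau>" using descent active_sub xc x(2) by blast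
      then have "e * (G x p i \<bullet> d) < 0" using tau \<open>e > 0\<close> by (intro mult_pos_neg) auto
      then show "G x p i \<bullet> (u + e *\<^sub>R d) < 0" using u[OF i] by (simp add: inner_add_right)
    qed
    have "eventually (\<lambda>e. \<zeta> \<bullet> (u + e *\<^sub>R d) \<le> 0) (at_right 0)"
      using eventually_at_right_less[of "0::real"] by eventually_elim (rule *)
    moreover have "((\<lambda>e. \<zeta> \<bullet> (u + e *\<^sub>R d)) \<longlongrightarrow> \<zeta> \<bullet> (u + 0 *\<^sub>R d)) (at_right 0)"
      by (intro tendsto_intros)
    ultimately have "\<zeta> \<bullet> (u + 0 *\<^sub>R d) \<le> 0"
      using tendsto_upperbound trivial_limit_at_right_real by blast
    then show ?thesis by simp
  qed
  from farkas[of "active_set \<phi> x p" "G x p", OF this]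
  show ?thesis using x(3) by (auto simp: kkt_def)
qed

lemma kkt_imp_regular_normal:
  assumes x: "x \<in> ball xb \<rho>" "p \<in> cball pb \<rho>" and k: "kkt \<phi> x p \<mu>"
  shows "comb (G x p) \<mu> \<in> regular_normal_cone (feasible_set \<phi> p) x"
proof -
  obtain e where e: "e > 0" "ball x e \<subseteq> ball xb \<rho>"
    using x(1) open_contains_ball by (metis open_ball)
  show ?thesis
  proof (rule regular_normal_cone_if_quadratic[OF e(1)])
    fix z assume "z \<in> feasible_set \<phi> p" "norm (z - x) < e"
    moreover from this have "z \<in> cball xb \<rho>"
      using e(2) by (auto simp: dist_norm norm_minus_commute subset_iff less_imp_le)
    ultimately show "comb (G x p) \<mu> \<bullet> (z - x) \<le> B * (\<Sum>i\<in>UNIV. \<mu> $ i) * (norm (z - x))\<^sup>2"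
      using kkt_quadratic_normal[OF k] x by auto
  qed
qed

text \<open>Regular normals at nearby points have bounded multipliers, so limits of them have multipliers too: passing
to the limiting cone adds no new normals.\<close>

lemma limiting_normal_cone_eq_kkt:
  assumes x: "x \<in> ball xb \<rho>" "p \<in> cball pb \<rho>"
  shows "\<zeta> \<in> limiting_normal_cone (feasible_set \<phi> p) x \<longleftrightarrow> (\<exists>\<mu>. kkt \<phi> x p \<mu> \<and> \<zeta> = comb (G x p) \<mu>)"
proof
  assume "\<exists>\<mu>. kkt \<phi> x p \<mu> \<and> \<zeta> = comb (G x p) \<mu>"
  then show "\<zeta> \<in> limiting_normal_cone (feasible_set \<phi> p) x"
    using kkt_imp_regular_normal[OF x] regular_subset_limiting[of x "feasible_set \<phi> p"] by (auto simp: kkt_def)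
next
  assume \<zeta>: "\<zeta> \<in> limiting_normal_cone (feasible_set \<phi> p) x"
  then obtain z w where zw: "\<And>k. z k \<in> feasible_set \<phi> p" "\<And>k. w k \<in> regular_normal_cone (feasible_set \<phi> p) (z k)"
    "z \<longlonglongrightarrow> x" "w \<longlonglongrightarrow> \<zeta>"
    by (rule limiting_normal_coneE) (rule that)
  have "eventually (\<lambda>k. z k \<in> ball xb \<rho>) sequentially"
    using zw(3) x(1) by (intro topological_tendstoD) auto
  then obtain N where N: "\<And>k. k \<ge> N \<Longrightarrow> z k \<in> ball xb \<rho>"
    by (auto simp: eventually_sequentially)
  define Z W where "Z k = z (k + N)" and "W k = w (k + N)" for k
  have lims: "Z \<longlonglongrightarrow> x" "W \<longlonglongrightarrow> \<zeta>"
    unfolding Z_def[abs_def] W_def[abs_def] by (intro LIMSEQ_ignore_initial_segment zw)+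
  have "\<exists>\<mu>. kkt \<phi> (Z k) p \<mu> \<and> W k = comb (G (Z k) p) \<mu>" for k
    using zw(1,2) N[of "k + N"] unfolding Z_def W_def by (intro regular_normal_imp_kkt x) auto
  then obtain M where M: "\<And>k. kkt \<phi> (Z k) p (M k)" "\<And>k. W k = comb (G (Z k) p) (M k)" by metis
  have Zb: "Z k \<in> cball xb \<rho>" for k using N[of "k + N"] by (auto simp: Z_def)
  obtain c where c: "\<And>k. norm (W k) \<le> c"
    using convergent_imp_bounded[of W] lims(2) by (auto simp: convergent_def bounded_iff)
  obtain \<mu> r where r: "strict_mono r" "(M \<circ> r) \<longlonglongrightarrow> \<mu>"
  proof (rule kkt_convergent_subsequence[of Z "\<lambda>_. p" M c])
    show "norm (comb (G (Z k) p) (M k)) \<le> c" for k using c[of k] M(2)[of k] by simp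
  qed (use M(1) Zb x(2) in auto)
  have lims': "(Z \<circ> r) \<longlonglongrightarrow> x" "(W \<circ> r) \<longlonglongrightarrow> \<zeta>"
    using lims r(1) by (auto intro: LIMSEQ_subseq_LIMSEQ)
  note lim = kkt_limit[OF lims'(1) tendsto_const[of p] _ _ r(2)]
  have "kkt \<phi> x p \<mu>" "(W \<circ> r) \<longlonglongrightarrow> comb (G x p) \<mu>"
    using lim M Zb x(2) by (auto simp: o_def)
  then show "\<exists>\<mu>. kkt \<phi> x p \<mu> \<and> \<zeta> = comb (G x p) \<mu>"
    using lims'(2) LIMSEQ_unique by blast
qed

lemma sol_map_iff_kkt:
  assumes "x \<in> ball xb \<rho>" "p \<in> cball pb \<rho>"
  shows "x \<in> sol_map f \<phi> (v, p) \<longleftrightarrow> (\<exists>\<mu>. kkt \<phi> x p \<mu> \<and> v = Lagr f \<phi> x p \<mu>)"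
  using limiting_normal_cone_eq_kkt[OF assms] by (auto simp: sol_map_def image_iff Lagr_eq_comb)

end

section \<open>Stability implies the second-order condition\<close>

text \<open>The rank of every subfamily of the gradients active at the reference point is constant on the neighborhood.\<close>

locale crcq_nbhd = constraint_nbhd \<phi> xb pb \<rho> B \<tau> d
  for \<phi> :: "'m::finite \<Rightarrow> (real^'n) \<times> (real^'d) \<Rightarrow> real" and xb pb \<rho> B \<tau> d +
  assumes crcq: "\<And>J x p. J \<subseteq> active_set \<phi> xb pb \<Longrightarrow> x \<in> cball xb \<rho> \<Longrightarrow> p \<in> cball pb \<rho> \<Longrightarrow>
    dim (gradients \<phi> x p ` J) = dim (gradients \<phi> xb pb ` J)"
begin

lemma indep_family_persists:
  assumes "J \<subseteq> active_set \<phi> xb pb" "x \<in> cball xb \<rho>" "p \<in> cball pb \<rho>" "y \<in> cball xb \<rho>" "q \<in> cball pb \<rho>"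
    and "indep_family (G x p) J"
  shows "indep_family (G y q) J"
  using assms crcq by (simp add: indep_family_iff_dim)

text \<open>With dual vectors \<open>v\<close> of the gradients at \<open>x\<close>, the map
\<open>F y = (y - x) + \<Sum>\<^sub>i (\<phi>\<^sub>i(y) - \<langle>\<nabla>\<phi>\<^sub>i(x), y - x\<rangle>) v\<^sub>i\<close> has derivative identity at \<open>x\<close> and satisfies
\<open>\<langle>\<nabla>\<phi>\<^sub>i(x), F y\<rangle> = \<phi>\<^sub>i(y)\<close> for \<open>i \<in> J\<close>. Its local inverse therefore maps the line through \<open>F x\<close> in the direction \<open>w\<close>,
on which these values are constant, to an arc on which the constraints in \<open>J\<close> stay zero.\<close>

lemma straightening:
  assumes x: "x \<in> ball xb \<rho>" "p \<in> cball pb \<rho>" and ind: "indep_family (G x p) J"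
    and w: "\<And>i. i \<in> J \<Longrightarrow> G x p i \<bullet> w = 0" and zero: "\<And>i. i \<in> J \<Longrightarrow> \<phi> i (x, p) = 0"
  obtains \<gamma> :: "real \<Rightarrow> real^'n" and \<gamma>' e where "e > 0" "\<gamma> 0 = x" "\<gamma>' 0 = w"
    "\<And>t. \<bar>t\<bar> < e \<Longrightarrow> \<gamma> t \<in> ball xb \<rho>"
    "\<And>t. \<bar>t\<bar> < e \<Longrightarrow> (\<gamma> has_vector_derivative \<gamma>' t) (at t)"
    "\<And>t i. \<bar>t\<bar> < e \<Longrightarrow> i \<in> J \<Longrightarrow> \<phi> i (\<gamma> t, p) = 0"
proof -
  obtain v :: "'m \<Rightarrow> real^'n" where v: "\<And>i j. i \<in> J \<Longrightarrow> G x p i \<bullet> v j = (if i = j then 1 else 0)"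
    using indep_family_dual_vectors[OF ind] by blast
  define F where "F y = (y - x) + (\<Sum>i\<in>UNIV. (\<phi> i (y, p) - G x p i \<bullet> (y - x)) *\<^sub>R v i)" for y
  define F' where "F' y = id_blinfun + (\<Sum>i\<in>UNIV. blinfun_scaleR_left (v i) o\<^sub>L blinfun_inner_left (G y p i - G x p i))" for y
  have F'_apply: "blinfun_apply (F' y) k = k + (\<Sum>i\<in>UNIV. (G y p i \<bullet> k - G x p i \<bullet> k) *\<^sub>R v i)" for y k
    by (simp add: F'_def plus_blinfun.rep_eq blinfun.sum_left inner_diff_left inner_commute inner_diff_right)
  have der: "(F has_derivative blinfun_apply (F' y)) (at y)" if "y \<in> ball xb \<rho>" for y
    unfolding F_def[abs_def] F'_apply[abs_def]
    by (rule derivative_eq_intros phi_deriv refl | use that x in force)+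
  have cont: "continuous_on (ball xb \<rho>) F'"
  proof -
    have "continuous_on (ball xb \<rho>) (\<lambda>y. G y p i)" for i
    proof (rule lipschitz_on_continuous_on[of B])
      show "B-lipschitz_on (ball xb \<rho>) (\<lambda>y. G y p i)"
        using B grad_lip[of _ _ p p i] x(2) by (intro lipschitz_onI) (auto simp: dist_norm)
    qed
    then show ?thesis unfolding F'_def[abs_def]
      by (intro continuous_intros bounded_linear.continuous_on[OF bounded_linear_blinfun_inner_left])
  qed
  have F'x: "F' x = id_blinfun" by (rule blinfun_eqI) (simp add: F'_apply)
  have Fx: "F x = 0 + (\<Sum>i\<in>UNIV. (\<phi> i (x, p)) *\<^sub>R v i)" by (simp add: F_def)
  have FJ: "G x p i \<bullet> F y = \<phi> i (y, p)" if "i \<in> J" for i y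
  proof -
    have "G x p i \<bullet> (\<Sum>j\<in>UNIV. (\<phi> j (y, p) - G x p j \<bullet> (y - x)) *\<^sub>R v j)
        = (\<Sum>j\<in>UNIV. if i = j then \<phi> j (y, p) - G x p j \<bullet> (y - x) else 0)"
      unfolding inner_sum_right by (rule sum.cong) (auto simp: v[OF that])
    then show ?thesis by (simp add: F_def inner_add_right)
  qed
  obtain U' V g g' where iv: "open U'" "U' \<subseteq> ball xb \<rho>" "x \<in> U'" "open V" "F x \<in> V" "homeomorphism U' V F g"
      "\<And>y. y \<in> V \<Longrightarrow> (g has_derivative (g' y)) (at y)"
      "\<And>y. y \<in> V \<Longrightarrow> g' y = inv (blinfun_apply (F' (g y)))"
  proof (rule inverse_function_theorem[OF open_ball der cont x(1), of id_blinfun])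
    show "id_blinfun o\<^sub>L F' x = id_blinfun" unfolding F'x by (rule blinfun_eqI) simp
  qed (assumption, rule that)
  have gF: "g (F x) = x" using iv(3,6) by (auto simp: homeomorphism_def)
  have g'0: "g' (F x) w = w"
    using iv(8)[OF iv(5)] gF F'x by (simp add: inv_id[unfolded id_def])
  obtain r where r: "r > 0" "ball (F x) r \<subseteq> V" using iv(4,5) open_contains_ball by blast
  define e where "e = r / (norm w + 1)"
  have "e > 0" using r(1) by (auto simp: e_def intro!: divide_pos_pos add_nonneg_pos)
  have inV: "F x + t *\<^sub>R w \<in> V" if "\<bar>t\<bar> < e" for t
  proof -
    have "\<bar>t\<bar> * norm w \<le> \<bar>t\<bar> * (norm w + 1)" by (intro mult_left_mono) auto
    also have "\<dots> < e * (norm w + 1)" using that by (intro mult_strict_right_mono add_nonneg_pos) auto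
    also have "\<dots> = r"
    proof -
      have "norm w + 1 \<noteq> 0" using norm_ge_zero[of w] by linarith
      then show ?thesis unfolding e_def by simp
    qed
    finally show ?thesis using r(2) by (auto simp: dist_norm)
  qed
  define \<gamma> where "\<gamma> t = g (F x + t *\<^sub>R w)" for t
  define \<gamma>' where "\<gamma>' t = g' (F x + t *\<^sub>R w) w" for t
  show thesis
  proof (rule that[OF \<open>e > 0\<close>, of \<gamma> \<gamma>'])
    show "\<gamma> 0 = x" "\<gamma>' 0 = w" by (simp_all add: \<gamma>_def \<gamma>'_def gF g'0)
    fix t :: real assume t: "\<bar>t\<bar> < e"
    have "g ` V = U'" using iv(6) by (simp add: homeomorphism_def)
    then show "\<gamma> t \<in> ball xb \<rho>" using inV[OF t] iv(2) by (auto simp: \<gamma>_def)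
    note gd = iv(7)[OF inV[OF t]]
    have "((\<lambda>s. F x + s *\<^sub>R w) has_derivative (\<lambda>s. s *\<^sub>R w)) (at t)"
      by (auto intro!: derivative_eq_intros)
    from diff_chain_at[OF this gd]
    have "((\<lambda>s. g (F x + s *\<^sub>R w)) has_derivative (\<lambda>s. g' (F x + t *\<^sub>R w) (s *\<^sub>R w))) (at t)"
      by (simp add: o_def)
    moreover have "g' (F x + t *\<^sub>R w) (s *\<^sub>R w) = s *\<^sub>R g' (F x + t *\<^sub>R w) w" for s
      using gd has_derivative_linear linear_scale by blast
    ultimately show "(\<gamma> has_vector_derivative \<gamma>' t) (at t)"
      by (simp add: has_vector_derivative_def \<gamma>_def[abs_def] \<gamma>'_def)
    fix i assume i: "i \<in> J"
    have "F (\<gamma> t) = F x + t *\<^sub>R w"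
      using inV[OF t] iv(6) by (simp add: homeomorphism_def \<gamma>_def)
    then have "\<phi> i (\<gamma> t, p) = G x p i \<bullet> F x + t * (G x p i \<bullet> w)"
      using FJ[OF i, of "\<gamma> t"] by (simp add: inner_add_right)
    then show "\<phi> i (\<gamma> t, p) = 0" using w[OF i] zero[OF i] FJ[OF i, of x] by simp
  qed
qed

text \<open>Straighten a maximal independent subfamily. By constant rank, the remaining gradients in \<open>J\<close> are combinations of the
chosen ones all along the arc, so the derivatives of the remaining constraints along the arc vanish as well.\<close>

lemma tight_arc:
  assumes x: "x \<in> ball xb \<rho>" "p \<in> cball pb \<rho>" and J: "J \<subseteq> active_set \<phi> x p"
    and w: "\<And>i. i \<in> J \<Longrightarrow> G x p i \<bullet> w = 0"
  obtains \<gamma> :: "real \<Rightarrow> real^'n" and e where "e > 0" "\<gamma> 0 = x"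
    "(\<gamma> has_vector_derivative w) (at 0)"
    "\<And>t. \<bar>t\<bar> < e \<Longrightarrow> \<gamma> t \<in> ball xb \<rho>"
    "\<And>t i. \<bar>t\<bar> < e \<Longrightarrow> i \<in> J \<Longrightarrow> \<phi> i (\<gamma> t, p) = 0"
proof -
  have xc: "x \<in> cball xb \<rho>" using x(1) by auto
  have Jb: "J \<subseteq> active_set \<phi> xb pb" using J active_sub[OF xc x(2)] by blast
  let ?P = "\<lambda>K. K \<subseteq> J \<and> indep_family (G x p) K"
  have "?P {}" by (auto simp: indep_family_def supp_def vec_eq_iff)
  then obtain K where K: "K \<subseteq> J" "indep_family (G x p) K"
    and max: "\<And>K'. ?P K' \<Longrightarrow> card K' \<le> card K"
  proof -
    have "\<forall>K. ?P K \<longrightarrow> card K < card (UNIV::'m set) + 1"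
      by (simp add: less_Suc_eq_le card_mono)
    from ex_has_greatest_nat[of ?P, OF \<open>?P {}\<close> this] show ?thesis using that by blast
  qed
  have zero: "\<phi> i (x, p) = 0" if "i \<in> J" for i using J that by (auto simp: active_set_def)
  obtain \<gamma> \<gamma>' e where arc: "e > 0" "\<gamma> 0 = x" "\<gamma>' 0 = w"
    "\<And>t. \<bar>t\<bar> < e \<Longrightarrow> \<gamma> t \<in> ball xb \<rho>"
    "\<And>t. \<bar>t\<bar> < e \<Longrightarrow> (\<gamma> has_vector_derivative \<gamma>' t) (at t)"
    "\<And>t i. \<bar>t\<bar> < e \<Longrightarrow> i \<in> K \<Longrightarrow> \<phi> i (\<gamma> t, p) = 0"
  proof (rule straightening[OF x K(2), of w])
    show "\<And>i. i \<in> K \<Longrightarrow> G x p i \<bullet> w = 0" "\<And>i. i \<in> K \<Longrightarrow> \<phi> i (x, p) = 0"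
      using w zero K(1) by auto
  qed (rule that)
  have deriv: "((\<lambda>t. \<phi> i (\<gamma> t, p)) has_real_derivative G (\<gamma> t) p i \<bullet> \<gamma>' t) (at t)" if "\<bar>t\<bar> < e" for t i
  proof -
    have "((\<lambda>y. \<phi> i (y, p)) has_derivative (\<lambda>u. G (\<gamma> t) p i \<bullet> u)) (at (\<gamma> t))"
      using arc(4)[OF that] x(2) by (intro phi_deriv) auto
    from diff_chain_at[OF arc(5)[OF that, unfolded has_vector_derivative_def] this]
    show ?thesis by (simp add: o_def has_field_derivative_def mult_commute_abs)
  qed
  have "\<phi> i (\<gamma> t, p) = 0" if t: "\<bar>t\<bar> < e" and i: "i \<in> J" for t i
  proof (cases "i \<in> K")
    case False
    have "DERIV (\<lambda>t. \<phi> i (\<gamma> t, p)) s :> 0" if s: "s \<in> {- e <..< e}" for s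
    proof -
      have s': "\<bar>s\<bar> < e" using s by auto
      have gs: "\<gamma> s \<in> cball xb \<rho>" using arc(4)[OF s'] by auto
      have indK: "indep_family (G (\<gamma> s) p) K"
        using K Jb xc gs x(2) by (intro indep_family_persists[OF _ xc x(2) gs x(2)]) auto
      have "\<not> indep_family (G x p) (insert i K)"
        using max[of "insert i K"] i K(1) False by (auto simp: card_insert_if)
      then have "\<not> indep_family (G (\<gamma> s) p) (insert i K)"
        using indep_family_persists[OF _ gs x(2) xc x(2), of "insert i K"] i K(1) Jb by blast
      then obtain \<mu> where \<mu>: "supp \<mu> \<subseteq> insert i K" "comb (G (\<gamma> s) p) \<mu> = 0" "\<mu> \<noteq> 0"
        by (auto simp: indep_family_def)
      then have "\<mu> $ i \<noteq> 0"
        using indK by (auto simp: indep_family_def supp_def subset_iff)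
      have tang: "G (\<gamma> s) p j \<bullet> \<gamma>' s = 0" if "j \<in> K" for j
      proof -
        have "eventually (\<lambda>t. \<bar>t\<bar> < e) (nhds s)"
          using s' by (intro order_tendstoD(2)[of abs "\<bar>s\<bar>"] tendsto_intros filterlim_ident)
        then have "eventually (\<lambda>t. \<phi> j (\<gamma> t, p) = 0) (nhds s)"
          by eventually_elim (use arc(6) that in auto)
        then have "((\<lambda>t. 0) has_real_derivative G (\<gamma> s) p j \<bullet> \<gamma>' s) (at s)"
          using deriv[OF s', of j] by (subst (asm) DERIV_cong_ev[OF refl _ refl]) auto
        then show ?thesis using DERIV_const DERIV_unique by blast
      qed
      have "0 = comb (G (\<gamma> s) p) \<mu> \<bullet> \<gamma>' s" using \<mu>(2) by simp
      also have "\<dots> = (\<Sum>j\<in>UNIV. if j = i then \<mu> $ i * (G (\<gamma> s) p i \<bullet> \<gamma>' s) else 0)"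
        unfolding comb_inner using \<mu>(1) tang by (intro sum.cong) (auto simp: supp_def)
      finally have "G (\<gamma> s) p i \<bullet> \<gamma>' s = 0" using \<open>\<mu> $ i \<noteq> 0\<close> by simp
      then show ?thesis using deriv[OF s', of i] by simp
    qed
    then have "\<phi> i (\<gamma> t, p) = \<phi> i (\<gamma> 0, p)"
      using t arc(1) by (intro DERIV_isconst3[of "- e" e]) auto
    then show ?thesis using arc(2) zero[OF i] by simp
  qed (use arc(6) t in auto)
  moreover have "(\<gamma> has_vector_derivative w) (at 0)" using arc(5)[of 0] arc(1,3) by simp
  ultimately show thesis using that arc(1,2,4) by blast
qed

end

text \<open>The base mapping is Lipschitz on the neighborhood, jointly in both arguments, and differentiable in the decision variable.\<close>

locale variational_nbhd = constraint_nbhd \<phi> xb pb \<rho> B \<tau> d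
  for \<phi> :: "'m::finite \<Rightarrow> (real^'n) \<times> (real^'d) \<Rightarrow> real" and xb pb \<rho> B \<tau> d +
  fixes f :: "(real^'n) \<times> (real^'d) \<Rightarrow> real^'n" and Lf :: real
  assumes Lf: "Lf > 0"
    and f_lip: "\<And>x y p q. x \<in> cball xb \<rho> \<Longrightarrow> y \<in> cball xb \<rho> \<Longrightarrow> p \<in> cball pb \<rho> \<Longrightarrow> q \<in> cball pb \<rho> \<Longrightarrow>
      norm (f (x, p) - f (y, q)) \<le> Lf * (norm (x - y) + norm (p - q))"
    and f_diff: "\<And>x p. x \<in> cball xb \<rho> \<Longrightarrow> p \<in> cball pb \<rho> \<Longrightarrow> (\<lambda>y. f (y, p)) differentiable (at x)"
begin

abbreviation "L \<equiv> Lagr f \<phi>"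
abbreviation "DL x p \<mu> \<equiv> jacobian (\<lambda>y. L y p \<mu>) (at x)"

lemma Lagr_has_derivative:
  assumes "x \<in> cball xb \<rho>" "p \<in> cball pb \<rho>"
  shows "((\<lambda>y. L y p \<mu>) has_derivative (\<lambda>u. DL x p \<mu> *v u)) (at x)"
  unfolding jacobian_works[symmetric] Lagr_def
  using f_diff[OF assms] grad_diff[OF assms]
  by (intro differentiable_add differentiable_sum differentiable_scaleR differentiable_const) auto

end

locale crcq_variational_nbhd = crcq_nbhd \<phi> xb pb \<rho> B \<tau> d + variational_nbhd \<phi> xb pb \<rho> B \<tau> d f Lf
  for \<phi> :: "'m::finite \<Rightarrow> (real^'n) \<times> (real^'d) \<Rightarrow> real" and xb pb \<rho> B \<tau> d f Lf
begin

text \<open>Along the tight arc the multiplier stays admissible, so the arc consists of solutions for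
right-hand sides near \<open>L x p \<mu>\<close>, and the localization recovers them. For a fixed parameter the stability inequality is
equivalent to strong monotonicity, which is divided by \<open>t\<^sup>2\<close>.\<close>

lemma second_order_if_stable:
  assumes loc: "single_valued_localization (sol_map f \<phi>) V Q U \<theta>" and "\<kappa> > 0"
    and stab: "\<And>v1 v2 p. v1 \<in> V \<Longrightarrow> v2 \<in> V \<Longrightarrow> p \<in> Q \<Longrightarrow>
       norm ((v1 - v2) - (2 * \<kappa>) *\<^sub>R (\<theta> (v1, p) - \<theta> (v2, p))) \<le> norm (v1 - v2)"
    and x: "x \<in> ball xb \<rho>" "x \<in> interior U" and p: "p \<in> cball pb \<rho>" "p \<in> Q"
    and k: "kkt \<phi> x p \<mu>" and v: "L x p \<mu> \<in> interior V"
    and u: "\<And>i. i \<in> supp \<mu> \<Longrightarrow> G x p i \<bullet> u = 0" "\<And>i. i \<in> active_set \<phi> x p \<Longrightarrow> G x p i \<bullet> u \<le> 0"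
  shows "\<kappa> * (norm u)\<^sup>2 \<le> (DL x p \<mu> *v u) \<bullet> u"
proof -
  have xc: "x \<in> cball xb \<rho>" using x(1) by auto
  define J where "J = {i \<in> active_set \<phi> x p. G x p i \<bullet> u = 0}"
  have "J \<subseteq> active_set \<phi> x p" and "\<And>i. i \<in> J \<Longrightarrow> G x p i \<bullet> u = 0" by (auto simp: J_def)
  then obtain \<gamma> e where arc: "e > 0" "\<gamma> 0 = x" "(\<gamma> has_vector_derivative u) (at 0)"
    "\<And>t. \<bar>t\<bar> < e \<Longrightarrow> \<gamma> t \<in> ball xb \<rho>"
    "\<And>t i. \<bar>t\<bar> < e \<Longrightarrow> i \<in> J \<Longrightarrow> \<phi> i (\<gamma> t, p) = 0"
    using tight_arc[OF x(1) p(1)] by blast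
  define t where "t k = e / real (k + 2)" for k
  have t: "\<And>k. t k > 0" "t \<longlonglongrightarrow> 0" "\<And>k. \<bar>t k\<bar> < e"
  proof -
    show "t k > 0" "\<bar>t k\<bar> < e" for k
      using arc(1) mult_pos_pos[OF arc(1), of "real k + 1"] by (auto simp: t_def field_simps)
    have "(\<lambda>k. e / real k) \<longlonglongrightarrow> 0" by (rule lim_const_over_n)
    then show "t \<longlonglongrightarrow> 0" unfolding t_def[abs_def] by (rule LIMSEQ_ignore_initial_segment)
  qed
  define X where "X k = \<gamma> (t k)" for k
  have X: "(\<lambda>k. (X k - x) /\<^sub>R t k) \<longlonglongrightarrow> u"
  proof -
    have "(\<lambda>k. (t k - 0) /\<^sub>R t k) \<longlonglongrightarrow> 1" using t(1) by (simp add: less_imp_neq[THEN not_sym])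
    from has_derivative_along_sequence[OF arc(3)[unfolded has_vector_derivative_def] t(1,2) this]
    show ?thesis by (simp add: X_def arc(2))
  qed
  have Xb: "X k \<in> ball xb \<rho>" for k using arc(4) t(3) by (simp add: X_def)
  have Xlim: "X \<longlonglongrightarrow> x"
  proof -
    have "(\<lambda>k. t k *\<^sub>R ((X k - x) /\<^sub>R t k)) \<longlonglongrightarrow> 0 *\<^sub>R u" by (intro tendsto_intros t X)
    then have "(\<lambda>k. X k - x) \<longlonglongrightarrow> 0" using t(1) by (simp add: less_imp_neq[THEN not_sym])
    then show ?thesis by (rule LIM_zero_cancel)
  qed
  have neg: "eventually (\<lambda>k. \<phi> i (X k, p) \<le> 0) sequentially" for i
  proof (cases "i \<in> active_set \<phi> x p")
    case True
    show ?thesis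
    proof (cases "i \<in> J")
      case True
      then show ?thesis using arc(5) t(3) by (simp add: X_def)
    next
      case False
      then have "G x p i \<bullet> u < 0" using True u(2)[of i] by (auto simp: J_def)
      moreover have "(\<lambda>k. (\<phi> i (X k, p) - \<phi> i (x, p)) /\<^sub>R t k) \<longlonglongrightarrow> G x p i \<bullet> u"
        by (rule has_derivative_along_sequence[OF phi_deriv[OF xc p(1)] t(1,2) X])
      ultimately have "eventually (\<lambda>k. (\<phi> i (X k, p) - \<phi> i (x, p)) /\<^sub>R t k < 0) sequentially"
        by (intro order_tendstoD(2))
      then show ?thesis
        by eventually_elim (use True t(1) in \<open>auto simp: active_set_def field_simps mult_less_0_iff dest: less_imp_le\<close>)
    qed
  next
    case False
    then have "\<phi> i (x, p) < 0" using k by (auto simp: active_set_def kkt_def feasible_set_def order_less_le)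
    moreover have "(\<lambda>k. \<phi> i (X k, p)) \<longlonglongrightarrow> \<phi> i (x, p)"
      using phi_tendsto[OF Xlim tendsto_const[of p]] Xb p(1) by (auto simp: less_imp_le)
    ultimately have "eventually (\<lambda>k. \<phi> i (X k, p) < 0) sequentially" by (intro order_tendstoD(2))
    then show ?thesis by eventually_elim simp
  qed
  have "supp \<mu> \<subseteq> J" using k u(1) by (auto simp: J_def kkt_def)
  then have tight: "\<phi> i (X k, p) = 0" if "i \<in> supp \<mu>" for i k
    using arc(5) t(3) that by (auto simp: X_def)
  have "eventually (\<lambda>k. \<forall>i. \<phi> i (X k, p) \<le> 0) sequentially"
    using neg by (intro eventually_all_finite)
  then have kk: "eventually (\<lambda>k. kkt \<phi> (X k) p \<mu>) sequentially"
    by eventually_elim (use k tight in \<open>auto simp: kkt_def feasible_set_def active_set_def\<close>)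
  have dv: "(\<lambda>k. (L (X k) p \<mu> - L x p \<mu>) /\<^sub>R t k) \<longlonglongrightarrow> DL x p \<mu> *v u"
    by (rule has_derivative_along_sequence[OF Lagr_has_derivative[OF xc p(1)] t(1,2) X])
  have vlim: "(\<lambda>k. L (X k) p \<mu>) \<longlonglongrightarrow> L x p \<mu>"
    using has_derivative_continuous[OF Lagr_has_derivative[OF xc p(1)]] Xlim
    by (rule isCont_tendsto_compose)
  have inV: "eventually (\<lambda>k. L (X k) p \<mu> \<in> interior V) sequentially"
    using vlim v by (intro topological_tendstoD) auto
  have inU: "eventually (\<lambda>k. X k \<in> interior U) sequentially"
    using Xlim x(2) by (intro topological_tendstoD) auto
  have \<theta>: "y = \<theta> (L y p \<mu>, p)" if "kkt \<phi> y p \<mu>" "y \<in> ball xb \<rho>" "y \<in> interior U" "L y p \<mu> \<in> interior V" for y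
  proof -
    have "y \<in> sol_map f \<phi> (L y p \<mu>, p)" using that p(1) by (auto simp: sol_map_iff_kkt)
    moreover have "y \<in> U" "L y p \<mu> \<in> V" using that interior_subset by blast+
    ultimately have "((L y p \<mu>, p), y) \<in> {(z, x). x \<in> sol_map f \<phi> z} \<inter> ((V \<times> Q) \<times> U)" using p(2) by simp
    then show ?thesis using loc unfolding single_valued_localization_def by blast
  qed
  have ev: "eventually (\<lambda>k. \<kappa> * (norm ((X k - x) /\<^sub>R t k))\<^sup>2 \<le>
      ((L (X k) p \<mu> - L x p \<mu>) /\<^sub>R t k) \<bullet> ((X k - x) /\<^sub>R t k)) sequentially"
    using kk inV inU
  proof eventually_elim
    case (elim k)
    let ?a = "L (X k) p \<mu> - L x p \<mu>" and ?b = "X k - x"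
    have "norm (?a - (2 * \<kappa>) *\<^sub>R ?b) \<le> norm ?a"
      using stab[of "L (X k) p \<mu>" "L x p \<mu>" p] \<theta>[OF elim(1) Xb elim(3,2)] \<theta>[OF k x v] elim(2) v p(2) interior_subset
      by (metis subsetD)
    then have "(norm (?a - (2 * \<kappa>) *\<^sub>R ?b))\<^sup>2 \<le> (norm ?a)\<^sup>2" by (intro power_mono) auto
    then have "0 \<le> 4 * \<kappa> * (?a \<bullet> ?b - \<kappa> * (norm ?b)\<^sup>2)"
      by (simp add: power2_norm_eq_inner inner_diff_left inner_diff_right inner_commute algebra_simps)
    then have "\<kappa> * (norm ?b)\<^sup>2 \<le> ?a \<bullet> ?b" using \<open>\<kappa> > 0\<close> by (simp add: zero_le_mult_iff)
    then have "(\<kappa> * (norm ?b)\<^sup>2) / (t k)\<^sup>2 \<le> (?a \<bullet> ?b) / (t k)\<^sup>2" by (intro divide_right_mono) auto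
    then show ?case by (simp only: inner_scaleR_quotient norm_scaleR_quotient times_divide_eq_right)
  qed
  have "(\<lambda>k. \<kappa> * (norm ((X k - x) /\<^sub>R t k))\<^sup>2) \<longlonglongrightarrow> \<kappa> * (norm u)\<^sup>2" by (intro tendsto_intros X)
  moreover have "(\<lambda>k. ((L (X k) p \<mu> - L x p \<mu>) /\<^sub>R t k) \<bullet> ((X k - x) /\<^sub>R t k)) \<longlonglongrightarrow> (DL x p \<mu> *v u) \<bullet> u"
    by (intro tendsto_intros X dv)
  ultimately show ?thesis using ev tendsto_le[OF sequentially_bot] by blast
qed

end

section \<open>Second-order expansion and local strong monotonicity\<close>

context constraint_nbhd
begin

text \<open>A small step along \<open>d\<close> makes all constraints strictly negative, and this survives small changes of the parameter.\<close>

lemma feasible_point_nearby: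
  assumes xb: "xb \<in> feasible_set \<phi> pb" and "a > 0"
  shows "\<exists>\<beta>>0. \<beta> \<le> \<rho> \<and> (\<forall>p\<in>cball pb \<beta>. \<exists>x\<in>cball xb a. x \<in> feasible_set \<phi> p)"
proof -
  have c: "xb \<in> ball xb \<rho>" "xb \<in> cball xb \<rho>" "pb \<in> cball pb \<rho>" using rho by auto
  have "G xb pb i \<bullet> d < 0" if "i \<in> active_set \<phi> xb pb" for i
    using descent[OF that c(2,3)] tau by linarith
  then have "eventually (\<lambda>t. (\<forall>i. \<phi> i (xb + t *\<^sub>R d, pb) < 0) \<and> xb + t *\<^sub>R d \<in> ball xb \<rho>) (at_right 0)"
    by (intro strictly_feasible_direction c xb)
  moreover have "eventually (\<lambda>t. xb + t *\<^sub>R d \<in> ball xb a) (at_right 0)"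
  proof -
    have "((\<lambda>t. xb + t *\<^sub>R d) \<longlongrightarrow> xb + 0 *\<^sub>R d) (at_right 0)" by (intro tendsto_intros)
    then show ?thesis using \<open>a > 0\<close> by (intro topological_tendstoD[of _ xb]) auto
  qed
  ultimately have "eventually (\<lambda>t. (\<forall>i. \<phi> i (xb + t *\<^sub>R d, pb) < 0) \<and> xb + t *\<^sub>R d \<in> ball xb \<rho>
      \<and> xb + t *\<^sub>R d \<in> ball xb a) (at_right 0)"
    by eventually_elim simp
  then obtain t where t: "\<forall>i. \<phi> i (xb + t *\<^sub>R d, pb) < 0" "xb + t *\<^sub>R d \<in> ball xb \<rho>" "xb + t *\<^sub>R d \<in> ball xb a"
    using eventually_happens'[OF trivial_limit_at_right_real] by blast
  let ?x = "xb + t *\<^sub>R d"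
  define s where "s = Max (range (\<lambda>i. \<phi> i (?x, pb)))"
  have s: "s < 0" "\<And>i. \<phi> i (?x, pb) \<le> s" using t(1) by (auto simp: s_def)
  show ?thesis
  proof (intro exI[of _ "min \<rho> (- s / B)"] conjI ballI bexI[of _ ?x])
    show "min \<rho> (- s / B) > 0" using rho s(1) B by (simp add: divide_neg_pos)
    fix p assume p: "p \<in> cball pb (min \<rho> (- s / B))"
    have "\<phi> i (?x, p) \<le> 0" for i
    proof -
      have "\<bar>\<phi> i (?x, pb) - \<phi> i (?x, p)\<bar> \<le> B * norm (pb - p)"
        using t(2) p c(3) by (intro phi_lip) auto
      also have "\<dots> \<le> B * (- s / B)" using B p by (intro mult_left_mono) (auto simp: dist_norm)
      finally show ?thesis using s(2)[of i] B by simp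
    qed
    then show "?x \<in> feasible_set \<phi> p" by (simp add: feasible_set_def)
  qed (use t(3) in auto)
qed

lemma active_limit:
  assumes "X \<longlonglongrightarrow> x" "P \<longlonglongrightarrow> p" "\<And>k. X k \<in> cball xb \<rho>" "\<And>k. P k \<in> cball pb \<rho>"
  shows "eventually (\<lambda>k. active_set \<phi> (X k) (P k) \<subseteq> active_set \<phi> x p) sequentially"
proof -
  have "eventually (\<lambda>k. i \<in> active_set \<phi> (X k) (P k) \<longrightarrow> i \<in> active_set \<phi> x p) sequentially" for i
  proof (cases "\<phi> i (x, p) = 0")
    case False
    from tendsto_imp_eventually_ne[OF phi_tendsto[OF assms] this]
    show ?thesis by eventually_elim (simp add: active_set_def)
  qed (simp add: active_set_def)
  then have "eventually (\<lambda>k. \<forall>i. i \<in> active_set \<phi> (X k) (P k) \<longrightarrow> i \<in> active_set \<phi> x p) sequentially"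
    by (intro eventually_all_finite)
  then show ?thesis by eventually_elim auto
qed

text \<open>The gradient of a constraint that is tight at \<open>x\<close> is nearly orthogonal to \<open>y - x\<close> if it is tight at \<open>y\<close>, too; the
parameter shift enters linearly and the distance quadratically.\<close>

lemma active_gradient_bound:
  assumes x: "x \<in> cball xb \<rho>" "y \<in> cball xb \<rho>" and p: "p \<in> cball pb \<rho>" "q \<in> cball pb \<rho>"
    and i: "i \<in> active_set \<phi> x p"
  shows "\<phi> i (y, q) \<le> 0 \<Longrightarrow> G x p i \<bullet> (y - x) \<le> B * norm (q - p) + B * (norm (y - x))\<^sup>2"
    and "\<phi> i (y, q) = 0 \<Longrightarrow> \<bar>G x p i \<bullet> (y - x)\<bar> \<le> B * norm (q - p) + B * (norm (y - x))\<^sup>2"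
    and "\<phi> i (y, q) = 0 \<Longrightarrow> \<bar>G y p i \<bullet> (y - x)\<bar> \<le> B * norm (q - p) + B * (norm (y - x))\<^sup>2"
proof -
  have "\<bar>\<phi> i (y, q) - \<phi> i (y, p)\<bar> \<le> B * norm (q - p)" using assms by (intro phi_lip)
  moreover have "\<bar>\<phi> i (y, p) - \<phi> i (x, p) - G x p i \<bullet> (y - x)\<bar> \<le> B * (norm (y - x))\<^sup>2"
    using assms by (intro taylor)
  moreover have "\<bar>\<phi> i (x, p) - \<phi> i (y, p) - G y p i \<bullet> (x - y)\<bar> \<le> B * (norm (x - y))\<^sup>2"
    using assms by (intro taylor)
  moreover have "G y p i \<bullet> (x - y) = - (G y p i \<bullet> (y - x))" by (simp add: inner_diff_right)
  moreover have "\<phi> i (x, p) = 0" using i by (simp add: active_set_def)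
  ultimately show "\<phi> i (y, q) \<le> 0 \<Longrightarrow> G x p i \<bullet> (y - x) \<le> B * norm (q - p) + B * (norm (y - x))\<^sup>2"
    and "\<phi> i (y, q) = 0 \<Longrightarrow> \<bar>G x p i \<bullet> (y - x)\<bar> \<le> B * norm (q - p) + B * (norm (y - x))\<^sup>2"
    and "\<phi> i (y, q) = 0 \<Longrightarrow> \<bar>G y p i \<bullet> (y - x)\<bar> \<le> B * norm (q - p) + B * (norm (y - x))\<^sup>2"
    by (simp_all add: norm_minus_commute)
qed

lemma comb_gradient_diff:
  assumes "x \<in> cball xb \<rho>" "y \<in> cball xb \<rho>" "p \<in> cball pb \<rho>" "q \<in> cball pb \<rho>" and \<mu>: "\<And>i. 0 \<le> \<mu> $ i"
  shows "norm (comb (G x p) \<mu> - comb (G y q) \<mu>) \<le> B * (\<Sum>i\<in>UNIV. \<mu> $ i) * (norm (x - y) + norm (p - q))"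
proof -
  have "norm (comb (G x p) \<mu> - comb (G y q) \<mu>) \<le> (\<Sum>i\<in>UNIV. norm ((\<mu> $ i) *\<^sub>R (G x p i - G y q i)))"
    unfolding comb_diff_family by (rule norm_sum)
  also have "\<dots> \<le> (\<Sum>i\<in>UNIV. \<mu> $ i * (B * (norm (x - y) + norm (p - q))))"
    using assms by (intro sum_mono) (auto intro!: mult_left_mono grad_lip)
  also have "\<dots> = B * (\<Sum>i\<in>UNIV. \<mu> $ i) * (norm (x - y) + norm (p - q))"
    by (simp add: sum_distrib_left sum_distrib_right mult_ac)
  finally show ?thesis .
qed

end

context variational_nbhd
begin

lemma Lagr_lipschitz:
  assumes x: "x \<in> cball xb \<rho>" "y \<in> cball xb \<rho>" "p \<in> cball pb \<rho>" "q \<in> cball pb \<rho>" and \<mu>: "\<And>i. 0 \<le> \<mu> $ i"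
  shows "norm (L x p \<mu> - L y q \<mu>) \<le> (Lf + B * (\<Sum>i\<in>UNIV. \<mu> $ i)) * (norm (x - y) + norm (p - q))"
proof -
  have "norm (L x p \<mu> - L y q \<mu>) \<le> norm (f (x, p) - f (y, q)) + norm (comb (G x p) \<mu> - comb (G y q) \<mu>)"
    unfolding Lagr_eq_comb by norm
  then show ?thesis
    using f_lip[OF x] comb_gradient_diff[of x y p q \<mu>, OF x \<mu>] by (simp add: distrib_right)
qed

text \<open>All constraints on which the multipliers differ are tight at both points, so the change of the multiplier enters only multiplied
by the small quantities of \<open>active_gradient_bound\<close>. What remains is the increment of the Lagrangian mapping for the
fixed multiplier \<open>\<mu>\<close>.\<close>

lemma second_order_expansion:
  assumes x: "x \<in> cball xb \<rho>" "y \<in> cball xb \<rho>" and p: "p \<in> cball pb \<rho>" "q \<in> cball pb \<rho>"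
    and k: "kkt \<phi> x p \<mu>" "kkt \<phi> y q \<nu>" and s: "supp \<mu> \<subseteq> supp \<nu>" "supp \<nu> \<subseteq> active_set \<phi> x p"
  shows "\<bar>(L y q \<nu> - L x p \<mu>) \<bullet> (y - x) - (L y p \<mu> - L x p \<mu>) \<bullet> (y - x)\<bar> \<le>
     (Lf + B * (\<Sum>i\<in>UNIV. \<nu> $ i)) * norm (q - p) * norm (y - x)
     + (\<Sum>i\<in>UNIV. \<bar>\<nu> $ i - \<mu> $ i\<bar>) * (B * norm (q - p) + B * (norm (y - x))\<^sup>2)"
proof -
  have pos: "\<And>i. 0 \<le> \<nu> $ i" using k by (simp add: kkt_def)
  have "(L y q \<nu> - L x p \<mu>) \<bullet> (y - x) - (L y p \<mu> - L x p \<mu>) \<bullet> (y - x)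
      = (L y q \<nu> - L y p \<nu>) \<bullet> (y - x) + comb (G y p) (\<nu> - \<mu>) \<bullet> (y - x)"
    by (simp add: Lagr_eq_comb comb_diff inner_diff_left inner_add_left)
  moreover have "\<bar>(L y q \<nu> - L y p \<nu>) \<bullet> (y - x)\<bar> \<le> (Lf + B * (\<Sum>i\<in>UNIV. \<nu> $ i)) * norm (q - p) * norm (y - x)"
  proof -
    have "\<bar>(L y q \<nu> - L y p \<nu>) \<bullet> (y - x)\<bar> \<le> norm (L y q \<nu> - L y p \<nu>) * norm (y - x)"
      by (rule Cauchy_Schwarz_ineq2)
    also have "\<dots> \<le> (Lf + B * (\<Sum>i\<in>UNIV. \<nu> $ i)) * norm (q - p) * norm (y - x)"
      using Lagr_lipschitz[OF x(2,2) p(2,1), of \<nu>] pos by (intro mult_right_mono) auto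
    finally show ?thesis .
  qed
  moreover have "\<bar>comb (G y p) (\<nu> - \<mu>) \<bullet> (y - x)\<bar> \<le>
      (\<Sum>i\<in>UNIV. \<bar>\<nu> $ i - \<mu> $ i\<bar>) * (B * norm (q - p) + B * (norm (y - x))\<^sup>2)"
  proof -
    have "\<bar>(\<nu> - \<mu>) $ i * (G y p i \<bullet> (y - x))\<bar> \<le> \<bar>\<nu> $ i - \<mu> $ i\<bar> * (B * norm (q - p) + B * (norm (y - x))\<^sup>2)" for i
    proof (cases "i \<in> supp \<nu>")
      case True
      then have "i \<in> active_set \<phi> x p" "\<phi> i (y, q) = 0" using s k(2) by (auto simp: kkt_def active_set_def)
      then show ?thesis using active_gradient_bound(3)[OF x p] by (auto simp: abs_mult intro!: mult_left_mono)
    next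
      case False
      then have "\<nu> $ i = 0" "\<mu> $ i = 0" using s(1) by (auto simp: supp_def)
      then show ?thesis by simp
    qed
    then have "(\<Sum>i\<in>UNIV. \<bar>(\<nu> - \<mu>) $ i * (G y p i \<bullet> (y - x))\<bar>) \<le>
      (\<Sum>i\<in>UNIV. \<bar>\<nu> $ i - \<mu> $ i\<bar> * (B * norm (q - p) + B * (norm (y - x))\<^sup>2))" by (intro sum_mono)
    then show ?thesis
      unfolding comb_inner sum_distrib_right by (rule order_trans[OF sum_abs])
  qed
  ultimately show ?thesis by linarith
qed

lemma f_tendsto:
  assumes "X \<longlonglongrightarrow> x" "P \<longlonglongrightarrow> p" "\<And>k. X k \<in> cball xb \<rho>" "\<And>k. P k \<in> cball pb \<rho>"
  shows "(\<lambda>k. f (X k, P k)) \<longlonglongrightarrow> f (x, p)"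
proof -
  have c: "x \<in> cball xb \<rho>" "p \<in> cball pb \<rho>"
    using assms closed_sequentially[OF closed_cball] by blast+
  have "(\<lambda>k. Lf * (norm (X k - x) + norm (P k - p))) \<longlonglongrightarrow> Lf * (norm (x - x) + norm (p - p))"
    by (intro tendsto_intros assms)
  then have lim: "(\<lambda>k. Lf * (norm (X k - x) + norm (P k - p))) \<longlonglongrightarrow> 0" by simp
  have "norm (f (X k, P k) - f (x, p)) \<le> Lf * (norm (X k - x) + norm (P k - p))" for k
    using assms(3,4) c by (intro f_lip)
  then have "(\<lambda>k. f (X k, P k) - f (x, p)) \<longlonglongrightarrow> 0"
    by (intro Lim_null_comparison[OF _ lim] always_eventually allI)
  then show ?thesis by (rule LIM_zero_cancel)
qed

lemma Lagr_kkt_limit: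
  assumes X: "X \<longlonglongrightarrow> x" "P \<longlonglongrightarrow> p" "\<And>k. X k \<in> cball xb \<rho>" "\<And>k. P k \<in> cball pb \<rho>"
    and M: "\<And>k. kkt \<phi> (X k) (P k) (M k)" and v: "(\<lambda>k. L (X k) (P k) (M k)) \<longlonglongrightarrow> v"
  obtains r :: "nat \<Rightarrow> nat" and \<mu> where "strict_mono r" "(M \<circ> r) \<longlonglongrightarrow> \<mu>" "kkt \<phi> x p \<mu>" "L x p \<mu> = v"
proof -
  have lim: "(\<lambda>k. comb (G (X k) (P k)) (M k)) \<longlonglongrightarrow> v - f (x, p)"
    using tendsto_diff[OF v f_tendsto[OF X]] by (simp add: Lagr_eq_comb)
  obtain c where c: "\<And>k. norm (comb (G (X k) (P k)) (M k)) \<le> c"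
    using convergent_imp_bounded[of "\<lambda>k. comb (G (X k) (P k)) (M k)"] lim
    by (auto simp: convergent_def bounded_iff)
  obtain \<mu> r where r: "strict_mono r" "(M \<circ> r) \<longlonglongrightarrow> \<mu>"
    by (rule kkt_convergent_subsequence[of X P M c, OF X(3,4) M c])
  note sub = LIMSEQ_subseq_LIMSEQ[OF X(1) r(1)] LIMSEQ_subseq_LIMSEQ[OF X(2) r(1)]
  have *: "kkt \<phi> x p \<mu>" "(\<lambda>k. comb (G ((X \<circ> r) k) ((P \<circ> r) k)) ((M \<circ> r) k)) \<longlonglongrightarrow> comb (G x p) \<mu>"
    by (rule kkt_limit[OF sub _ _ r(2)]; use X M in simp)+
  have "(\<lambda>k. comb (G ((X \<circ> r) k) ((P \<circ> r) k)) ((M \<circ> r) k)) \<longlonglongrightarrow> v - f (x, p)"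
    using LIMSEQ_subseq_LIMSEQ[OF lim r(1)] by (simp add: o_def)
  then have "comb (G x p) \<mu> = v - f (x, p)" using *(2) LIMSEQ_unique by blast
  then have "L x p \<mu> = v" by (simp add: Lagr_eq_comb)
  then show thesis using that r *(1) by blast
qed

text \<open>The compactness step shared by both contradiction arguments below. The inclusions between the supports make
\<open>second_order_expansion\<close> applicable along the whole subsequence.\<close>

lemma blow_up_subsequence:
  assumes X: "X \<longlonglongrightarrow> x" "P \<longlonglongrightarrow> p" "\<And>k. X k \<in> cball xb \<rho>" "\<And>k. P k \<in> cball pb \<rho>"
    and M: "\<And>k. kkt \<phi> (X k) (P k) (M k)" and v: "(\<lambda>k. L (X k) (P k) (M k)) \<longlonglongrightarrow> v"
    and ne: "\<And>k. X k \<noteq> x"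
  obtains r :: "nat \<Rightarrow> nat" and \<mu> u where "strict_mono r" "(M \<circ> r) \<longlonglongrightarrow> \<mu>" "kkt \<phi> x p \<mu>" "L x p \<mu> = v"
    "(\<lambda>k. (X (r k) - x) /\<^sub>R norm (X (r k) - x)) \<longlonglongrightarrow> u" "norm u = 1"
    "\<And>k. supp \<mu> \<subseteq> supp (M (r k))" "\<And>k. supp (M (r k)) \<subseteq> active_set \<phi> x p"
proof -
  obtain r1 \<mu> where r1: "strict_mono r1" "(M \<circ> r1) \<longlonglongrightarrow> \<mu>" "kkt \<phi> x p \<mu>" "L x p \<mu> = v"
    by (rule Lagr_kkt_limit[OF X M v])
  let ?u = "\<lambda>k. (X k - x) /\<^sub>R norm (X k - x)"
  have on_sphere: "\<forall>k. (?u \<circ> r1) k \<in> sphere 0 1" using ne by (simp add: dist_norm)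
  obtain u r2 where r2: "u \<in> sphere 0 1" "strict_mono r2" "((?u \<circ> r1) \<circ> r2) \<longlonglongrightarrow> u"
    by (rule seq_compactE[OF compact_imp_seq_compact[OF compact_sphere[of 0 1]] on_sphere])
  let ?r = "r1 \<circ> r2"
  have mono: "strict_mono ?r" using r1(1) r2(2) by (rule strict_mono_o)
  have Mlim: "(M \<circ> ?r) \<longlonglongrightarrow> \<mu>" using LIMSEQ_subseq_LIMSEQ[OF r1(2) r2(2)] by (simp add: o_assoc)
  have "eventually (\<lambda>k. i \<in> supp \<mu> \<longrightarrow> i \<in> supp ((M \<circ> ?r) k)) sequentially" for i
    using supp_limit[OF Mlim, of i] by (cases "i \<in> supp \<mu>") simp_all
  then have "eventually (\<lambda>k. \<forall>i. i \<in> supp \<mu> \<longrightarrow> i \<in> supp ((M \<circ> ?r) k)) sequentially"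
    by (intro eventually_all_finite)
  moreover have "eventually (\<lambda>k. active_set \<phi> ((X \<circ> ?r) k) ((P \<circ> ?r) k) \<subseteq> active_set \<phi> x p) sequentially"
  proof (rule active_limit)
    show "(X \<circ> ?r) \<longlonglongrightarrow> x" "(P \<circ> ?r) \<longlonglongrightarrow> p"
      using X(1,2) mono by (auto intro: LIMSEQ_subseq_LIMSEQ)
  qed (use X(3,4) in auto)
  ultimately have "eventually (\<lambda>k. supp \<mu> \<subseteq> supp (M (?r k)) \<and> supp (M (?r k)) \<subseteq> active_set \<phi> x p) sequentially"
  proof eventually_elim
    case (elim k)
    then show ?case using M[of "?r k"] unfolding kkt_def by auto
  qed
  then obtain N where N: "\<And>k. k \<ge> N \<Longrightarrow> supp \<mu> \<subseteq> supp (M (?r k)) \<and> supp (M (?r k)) \<subseteq> active_set \<phi> x p"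
    unfolding eventually_sequentially by blast
  define r where "r k = ?r (k + N)" for k
  show thesis
  proof (rule that[of r \<mu> u])
    show "strict_mono r" using mono by (auto simp: r_def strict_mono_def)
    show "(M \<circ> r) \<longlonglongrightarrow> \<mu>"
      using LIMSEQ_ignore_initial_segment[OF Mlim, of N] by (simp add: r_def o_def)
    show "(\<lambda>k. (X (r k) - x) /\<^sub>R norm (X (r k) - x)) \<longlonglongrightarrow> u"
      using LIMSEQ_ignore_initial_segment[OF r2(3), of N] by (simp add: r_def o_def)
    show "norm u = 1" using r2(1) by simp
  qed (use r1 N in \<open>auto simp: r_def\<close>)
qed

text \<open>Violating points would converge to \<open>x\<close> along a direction \<open>u\<close>, with multipliers converging to some \<open>\<mu>\<close>.
The direction is critical for this particular \<open>\<mu>\<close>, and in the expansion the coefficients \<open>\<nu> - \<mu>\<close> tend to zero;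
so the quadratic form at \<open>u\<close> would be at most \<open>\<kappa> < l\<close>.\<close>

lemma pointwise_strong_monotonicity:
  assumes x: "x \<in> ball xb \<rho>" "p \<in> cball pb \<rho>" and "\<kappa> < l"
    and soc: "\<And>\<mu> u. kkt \<phi> x p \<mu> \<Longrightarrow> L x p \<mu> = v \<Longrightarrow> (\<And>i. i \<in> supp \<mu> \<Longrightarrow> G x p i \<bullet> u = 0) \<Longrightarrow>
       (\<And>i. i \<in> active_set \<phi> x p \<Longrightarrow> G x p i \<bullet> u \<le> 0) \<Longrightarrow> l * (norm u)\<^sup>2 \<le> (DL x p \<mu> *v u) \<bullet> u"
  shows "\<exists>\<epsilon>>0. \<forall>y \<nu>. kkt \<phi> y p \<nu> \<longrightarrow> norm (y - x) < \<epsilon> \<longrightarrow> norm (L y p \<nu> - v) < \<epsilon> \<longrightarrow>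
      \<kappa> * (norm (y - x))\<^sup>2 \<le> (L y p \<nu> - v) \<bullet> (y - x)"
proof (rule ccontr)
  have xc: "x \<in> cball xb \<rho>" using x(1) by auto
  \<comment> \<open>the violating points are kept inside the ball of radius \<rho>\<close>
  define R where "R = \<rho> - dist xb x"
  have R: "R > 0" using x(1) by (simp add: R_def)
  assume "\<not> ?thesis"
  then have "\<forall>k. \<exists>y \<nu>. kkt \<phi> y p \<nu> \<and> norm (y - x) < min R (inverse (real (Suc k))) \<and>
      norm (L y p \<nu> - v) < min R (inverse (real (Suc k))) \<and> \<not> \<kappa> * (norm (y - x))\<^sup>2 \<le> (L y p \<nu> - v) \<bullet> (y - x)"
    using R by (metis min_less_iff_conj inverse_positive_iff_positive of_nat_0_less_iff zero_less_Suc)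
  then obtain Y N where YN: "\<And>k. kkt \<phi> (Y k) p (N k)" "\<And>k. norm (Y k - x) < R"
      "\<And>k. norm (Y k - x) < inverse (real (Suc k))" "\<And>k. norm (L (Y k) p (N k) - v) < inverse (real (Suc k))"
      "\<And>k. (L (Y k) p (N k) - v) \<bullet> (Y k - x) < \<kappa> * (norm (Y k - x))\<^sup>2"
    by (metis min_less_iff_conj not_le)
  have Ylim: "Y \<longlonglongrightarrow> x"
    by (rule LIM_zero_cancel, rule Lim_null_comparison[OF _ LIMSEQ_inverse_real_of_nat])
       (intro always_eventually allI less_imp_le YN(3))
  have vlim: "(\<lambda>k. L (Y k) p (N k)) \<longlonglongrightarrow> v"
    by (rule LIM_zero_cancel, rule Lim_null_comparison[OF _ LIMSEQ_inverse_real_of_nat])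
       (intro always_eventually allI less_imp_le YN(4))
  have Yb: "Y k \<in> cball xb \<rho>" for k
    using YN(2)[of k] dist_triangle[of xb "Y k" x] by (simp add: R_def dist_norm norm_minus_commute)
  have ne: "Y k \<noteq> x" for k using YN(5)[of k] by auto
  obtain r \<mu> u where r: "strict_mono r" "(N \<circ> r) \<longlonglongrightarrow> \<mu>" and k: "kkt \<phi> x p \<mu>" "L x p \<mu> = v"
    and u: "(\<lambda>k. (Y (r k) - x) /\<^sub>R norm (Y (r k) - x)) \<longlonglongrightarrow> u" "norm u = 1"
    and s: "\<And>k. supp \<mu> \<subseteq> supp (N (r k))" "\<And>k. supp (N (r k)) \<subseteq> active_set \<phi> x p"
    by (rule blow_up_subsequence[OF Ylim tendsto_const[of p] Yb x(2) YN(1) vlim ne]) (rule that)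
  define t where "t k = norm (Y (r k) - x)" for k
  have t: "\<And>k. t k > 0" "t \<longlonglongrightarrow> 0"
    using ne tendsto_norm_zero[OF LIM_zero[OF LIMSEQ_subseq_LIMSEQ[OF Ylim r(1)]]] by (auto simp: t_def[abs_def] o_def)
  let ?u = "\<lambda>k. (Y (r k) - x) /\<^sub>R t k"
  have u': "?u \<longlonglongrightarrow> u" using u(1) by (simp add: t_def)
  have tang: "(\<lambda>k. \<phi> i (Y (r k), p) /\<^sub>R t k) \<longlonglongrightarrow> G x p i \<bullet> u" if "i \<in> active_set \<phi> x p" for i
    using has_derivative_along_sequence[OF phi_deriv[OF xc x(2), of i] t u'] that
    by (simp add: active_set_def)
  have "l * (norm u)\<^sup>2 \<le> (DL x p \<mu> *v u) \<bullet> u"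
  proof (rule soc[OF k])
    fix i assume i: "i \<in> supp \<mu>"
    then have "\<phi> i (Y (r k), p) = 0" for k using s(1)[of k] YN(1)[of "r k"] by (auto simp: kkt_def active_set_def)
    moreover have "i \<in> active_set \<phi> x p" using i s by blast
    ultimately have "(\<lambda>k. 0) \<longlonglongrightarrow> G x p i \<bullet> u" using tang[of i] by simp
    then show "G x p i \<bullet> u = 0" by (simp add: LIMSEQ_const_iff)
  next
    fix i assume i: "i \<in> active_set \<phi> x p"
    have *: "\<phi> i (Y (r k), p) /\<^sub>R t k \<le> 0" for k
      using YN(1)[of "r k"] t(1)[of k] by (auto simp: kkt_def feasible_set_def mult_nonneg_nonpos)
    then show "G x p i \<bullet> u \<le> 0" by (intro LIMSEQ_le_const2[OF tang[OF i]] exI allI impI)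
  qed
  moreover have "(DL x p \<mu> *v u) \<bullet> u \<le> \<kappa>"
  proof -
    let ?q = "\<lambda>k. ((L (Y (r k)) p \<mu> - L x p \<mu>) /\<^sub>R t k) \<bullet> ?u k"
    let ?e = "\<lambda>k. (\<Sum>i\<in>UNIV. \<bar>N (r k) $ i - \<mu> $ i\<bar>) * B"
    have le: "?q k \<le> \<kappa> + ?e k" for k
    proof -
      have "\<bar>(L (Y (r k)) p (N (r k)) - L x p \<mu>) \<bullet> (Y (r k) - x) - (L (Y (r k)) p \<mu> - L x p \<mu>) \<bullet> (Y (r k) - x)\<bar>
          \<le> ?e k * (t k)\<^sup>2"
        using second_order_expansion[OF xc Yb x(2,2) k(1) YN(1) s, of k] by (simp add: t_def mult.assoc)
      then have "(L (Y (r k)) p \<mu> - L x p \<mu>) \<bullet> (Y (r k) - x) \<le> \<kappa> * (t k)\<^sup>2 + ?e k * (t k)\<^sup>2"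
        using YN(5)[of "r k"] k(2) by (simp add: t_def)
      then have "((L (Y (r k)) p \<mu> - L x p \<mu>) \<bullet> (Y (r k) - x)) / (t k)\<^sup>2 \<le> (\<kappa> + ?e k) * (t k)\<^sup>2 / (t k)\<^sup>2"
        by (intro divide_right_mono) (auto simp: distrib_right)
      then show ?thesis using t(1)[of k] unfolding inner_scaleR_quotient by simp
    qed
    have q: "?q \<longlonglongrightarrow> (DL x p \<mu> *v u) \<bullet> u"
      by (intro tendsto_inner u' has_derivative_along_sequence[OF Lagr_has_derivative[OF xc x(2)] t u'])
    have e: "(\<lambda>k. \<kappa> + ?e k) \<longlonglongrightarrow> \<kappa> + (\<Sum>i\<in>UNIV. \<bar>\<mu> $ i - \<mu> $ i\<bar>) * B"
      using r(2) by (intro tendsto_intros) (simp add: o_def)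
    have "(DL x p \<mu> *v u) \<bullet> u \<le> \<kappa> + (\<Sum>i\<in>UNIV. \<bar>\<mu> $ i - \<mu> $ i\<bar>) * B"
      by (rule LIMSEQ_le[OF q e]) (use le in blast)
    then show ?thesis by simp
  qed
  ultimately show False using u(2) \<open>\<kappa> < l\<close> by simp
qed

end

section \<open>A shifted problem that is always solvable\<close>

locale solution_nbhd = variational_nbhd \<phi> xb pb \<rho> B \<tau> d f Lf
  for \<phi> :: "'m::finite \<Rightarrow> (real^'n) \<times> (real^'d) \<Rightarrow> real" and xb pb \<rho> B \<tau> d f Lf +
  fixes vb :: "real^'n" and \<mu>b :: "real^'m"
  assumes base_kkt: "kkt \<phi> xb pb \<mu>b" and base_eq: "vb = Lagr f \<phi> xb pb \<mu>b"
begin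

text \<open>A bound for the sum of the multipliers of all solutions in the neighborhood; it combines \<open>kkt_sum_bound\<close>
with a bound for the normal part of the right-hand side.\<close>

definition multiplier_cap :: real where
  "multiplier_cap = (norm vb + \<rho> + norm (f (xb, pb)) + 2 * Lf * \<rho>) * norm d / \<tau>"

text \<open>A shift large enough to beat the negative curvature of the constraints, weighted with the reference multiplier and with
\<open>multiplier_cap\<close>, and the Lipschitz constant of \<open>f\<close>.\<close>

definition \<sigma> :: real where
  "\<sigma> = 2 * (B * (\<Sum>i\<in>UNIV. \<mu>b $ i) + 2 + 2 * Lf) + 2 * B * multiplier_cap + 2 * Lf + 1"

lemma multiplier_cap_nonneg: "0 \<le> multiplier_cap"
  using rho Lf tau by (simp add: multiplier_cap_def)

lemma sum_base_nonneg: "0 \<le> (\<Sum>i\<in>UNIV. \<mu>b $ i)"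
  using base_kkt by (auto simp: kkt_def intro: sum_nonneg)

lemma sigma_ge: "\<sigma> \<ge> 2 * (B * (\<Sum>i\<in>UNIV. \<mu>b $ i) + 2 + 2 * Lf)" "\<sigma> \<ge> 2 * B * multiplier_cap + 2 * Lf + 1" "\<sigma> > 0"
proof -
  have pos: "0 \<le> 2 * B * multiplier_cap" "0 \<le> B * (\<Sum>i\<in>UNIV. \<mu>b $ i)"
    using B multiplier_cap_nonneg sum_base_nonneg by auto
  have "2 * (s + 2 + 2 * c) + t + 2 * c + 1 \<ge> 2 * (s + 2 + 2 * c)"
    "2 * (s + 2 + 2 * c) + t + 2 * c + 1 \<ge> t + 2 * c + 1"
    "2 * (s + 2 + 2 * c) + t + 2 * c + 1 > 0" if "0 \<le> t" "0 \<le> s" "0 < c" for s t c :: real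
    using that by auto
  from this[OF pos Lf]
  show "\<sigma> \<ge> 2 * (B * (\<Sum>i\<in>UNIV. \<mu>b $ i) + 2 + 2 * Lf)" "\<sigma> \<ge> 2 * B * multiplier_cap + 2 * Lf + 1" "\<sigma> > 0"
    unfolding \<sigma>_def .
qed

lemma base_in: "xb \<in> cball xb \<rho>" "pb \<in> cball pb \<rho>" "xb \<in> ball xb \<rho>"
  using rho by auto

lemma multiplier_bound:
  assumes x: "x \<in> cball xb \<rho>" "p \<in> cball pb \<rho>" and k: "kkt \<phi> x p \<mu>" and v: "L x p \<mu> \<in> cball vb \<rho>"
  shows "(\<Sum>i\<in>UNIV. \<mu> $ i) \<le> multiplier_cap"
proof -
  have "norm (f (x, p) - f (xb, pb)) \<le> Lf * (norm (x - xb) + norm (p - pb))"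
    using x base_in by (intro f_lip)
  also have "\<dots> \<le> Lf * (\<rho> + \<rho>)"
    using x Lf by (intro mult_left_mono add_mono) (auto simp: dist_norm norm_minus_commute)
  finally have f: "norm (f (x, p)) \<le> norm (f (xb, pb)) + 2 * Lf * \<rho>"
    using norm_triangle_ineq2[of "f (x, p)" "f (xb, pb)"] by simp
  have v': "norm (L x p \<mu>) \<le> norm vb + \<rho>"
    using v norm_triangle_ineq2[of "L x p \<mu>" vb] by (simp add: dist_norm norm_minus_commute)
  have "norm (comb (G x p) \<mu>) \<le> norm vb + \<rho> + norm (f (xb, pb)) + 2 * Lf * \<rho>"
    using f v' norm_triangle_ineq4[of "L x p \<mu>" "f (x, p)"] by (simp add: Lagr_eq_comb)
  then have "norm (comb (G x p) \<mu>) * norm d / \<tau> \<le> multiplier_cap"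
    unfolding multiplier_cap_def using tau by (intro divide_right_mono mult_right_mono) auto
  then show ?thesis using kkt_sum_bound[OF k x] by linarith
qed

lemma normal_hypomonotone:
  assumes x: "x \<in> cball xb \<rho>" "y \<in> cball xb \<rho>" "p \<in> cball pb \<rho>"
    and k: "kkt \<phi> x p \<mu>" "kkt \<phi> y p \<nu>" and v: "L x p \<mu> \<in> cball vb \<rho>" "L y p \<nu> \<in> cball vb \<rho>"
  shows "- (2 * B * multiplier_cap) * (norm (x - y))\<^sup>2 \<le> (comb (G x p) \<mu> - comb (G y p) \<nu>) \<bullet> (x - y)"
proof -
  have feas: "x \<in> feasible_set \<phi> p" "y \<in> feasible_set \<phi> p" using k by (auto simp: kkt_def)
  have "comb (G x p) \<mu> \<bullet> (y - x) \<le> B * (\<Sum>i\<in>UNIV. \<mu> $ i) * (norm (y - x))\<^sup>2"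
    using kkt_quadratic_normal[OF k(1) x feas(2)] .
  also have "\<dots> \<le> B * multiplier_cap * (norm (y - x))\<^sup>2"
    using multiplier_bound[OF x(1,3) k(1) v(1)] B by (intro mult_right_mono mult_left_mono) auto
  finally have 1: "comb (G x p) \<mu> \<bullet> (y - x) \<le> B * multiplier_cap * (norm (x - y))\<^sup>2" by (simp add: norm_minus_commute)
  have "comb (G y p) \<nu> \<bullet> (x - y) \<le> B * (\<Sum>i\<in>UNIV. \<nu> $ i) * (norm (x - y))\<^sup>2"
    using kkt_quadratic_normal[OF k(2) x(2,1,3) feas(1)] .
  also have "\<dots> \<le> B * multiplier_cap * (norm (x - y))\<^sup>2"
    using multiplier_bound[OF x(2,3) k(2) v(2)] B by (intro mult_right_mono mult_left_mono) auto
  finally have 2: "comb (G y p) \<nu> \<bullet> (x - y) \<le> B * multiplier_cap * (norm (x - y))\<^sup>2" .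
  have "(comb (G x p) \<mu> - comb (G y p) \<nu>) \<bullet> (x - y)
      = - (comb (G x p) \<mu> \<bullet> (y - x)) - comb (G y p) \<nu> \<bullet> (x - y)"
    by (simp add: inner_diff_left inner_diff_right)
  then show ?thesis using 1 2 by simp
qed

lemma shifted_strongly_monotone:
  assumes x: "x \<in> cball xb \<rho>" "y \<in> cball xb \<rho>" "p \<in> cball pb \<rho>"
    and k: "kkt \<phi> x p \<mu>" "kkt \<phi> y p \<nu>" and v: "L x p \<mu> \<in> cball vb \<rho>" "L y p \<nu> \<in> cball vb \<rho>"
  shows "(norm (x - y))\<^sup>2 \<le> ((L x p \<mu> + \<sigma> *\<^sub>R (x - xb)) - (L y p \<nu> + \<sigma> *\<^sub>R (y - xb))) \<bullet> (x - y)"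
proof -
  have "\<bar>(f (x, p) - f (y, p)) \<bullet> (x - y)\<bar> \<le> norm (f (x, p) - f (y, p)) * norm (x - y)"
    by (rule Cauchy_Schwarz_ineq2)
  also have "\<dots> \<le> Lf * norm (x - y) * norm (x - y)"
    using f_lip[OF x(1,2,3,3)] by (intro mult_right_mono) auto
  finally have f: "- (Lf * (norm (x - y))\<^sup>2) \<le> (f (x, p) - f (y, p)) \<bullet> (x - y)"
    by (simp add: power2_eq_square mult.assoc)
  have "(1 + 2 * B * multiplier_cap + Lf) * (norm (x - y))\<^sup>2 \<le> \<sigma> * (norm (x - y))\<^sup>2"
    using sigma_ge(2) Lf by (intro mult_right_mono) auto
  moreover have "((L x p \<mu> + \<sigma> *\<^sub>R (x - xb)) - (L y p \<nu> + \<sigma> *\<^sub>R (y - xb))) \<bullet> (x - y)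
      = (f (x, p) - f (y, p)) \<bullet> (x - y) + (comb (G x p) \<mu> - comb (G y p) \<nu>) \<bullet> (x - y) + \<sigma> * (norm (x - y))\<^sup>2"
    by (simp add: Lagr_eq_comb power2_norm_eq_inner inner_add_left inner_diff_left inner_diff_right algebra_simps)
  ultimately show ?thesis using normal_hypomonotone[OF x k v] f by (simp add: algebra_simps)
qed

text \<open>Freezing \<open>f\<close> at \<open>y\<close> leaves the stationarity condition of a strongly convex quadratic function \<open>h\<close> over the feasible points
in the ball of radius \<open>r\<close>. On the boundary of the ball, \<open>h\<close> is of the order \<open>r\<^sup>2\<close> by the prox-regularity at the
reference point, while \<open>h\<close> is small at a feasible point close to \<open>xb\<close>. Hence the minimizer is interior
to the ball and stationary. The right-hand sides may vary in a ball of the same radius \<open>r\<close>.\<close>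

lemma penalized_minimizer:
  assumes r: "0 < r" "r < \<rho>"
  shows "\<exists>\<beta>>0. \<beta> \<le> r \<and> (\<forall>p\<in>cball pb \<beta>. \<forall>v\<in>cball vb r. \<forall>y\<in>cball xb r.
      \<exists>x\<in>cball xb r. \<exists>\<mu>. kkt \<phi> x p \<mu> \<and> v = f (y, p) + \<sigma> *\<^sub>R (x - xb) + comb (G x p) \<mu>)"
proof -
  define nb where "nb = comb (G xb pb) \<mu>b"
  define \<Lambda> where "\<Lambda> = (\<Sum>i\<in>UNIV. \<mu>b $ i)"
  have \<Lambda>: "\<Lambda> \<ge> 0" unfolding \<Lambda>_def by (rule sum_base_nonneg)
  define e where "e = (1 + 2 * Lf) * r"
  have e: "e > 0" using r Lf by (simp add: e_def)
  define c where "c = \<sigma> / 2 + norm nb + e + 1"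
  have c: "c > 0" using sigma_ge(3) e by (simp add: c_def add_nonneg_pos)
  \<comment> \<open>so close to xb that h is at most a quarter of r squared at a feasible point\<close>
  define a where "a = min r (min 1 (r\<^sup>2 / (4 * c)))"
  have a: "a > 0" "a \<le> r" "a \<le> 1" "a * c \<le> r\<^sup>2 / 4"
  proof -
    show "a > 0" "a \<le> r" "a \<le> 1" using r c by (auto simp: a_def)
    have "a \<le> r\<^sup>2 / (4 * c)" by (simp add: a_def)
    then show "a * c \<le> r\<^sup>2 / 4" using c by (simp add: field_simps)
  qed
  obtain \<beta>0 where \<beta>0: "\<beta>0 > 0" "\<beta>0 \<le> \<rho>" "\<And>p. p \<in> cball pb \<beta>0 \<Longrightarrow> \<exists>x\<in>cball xb a. x \<in> feasible_set \<phi> p"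
    using feasible_point_nearby[OF _ a(1)] base_kkt unfolding kkt_def by blast
  define \<beta> where "\<beta> = min (min \<beta>0 r) (r\<^sup>2 / (4 * (\<Lambda> * B + 1)))"
  have \<beta>: "\<beta> > 0" "\<beta> \<le> \<beta>0" "\<beta> \<le> r" "\<Lambda> * B * \<beta> \<le> r\<^sup>2 / 4"
  proof -
    have pos: "\<Lambda> * B + 1 > 0" using \<Lambda> B by (simp add: add_nonneg_pos)
    show "\<beta> > 0" "\<beta> \<le> \<beta>0" "\<beta> \<le> r" using \<beta>0(1) r pos by (auto simp: \<beta>_def)
    have "\<beta> \<le> r\<^sup>2 / (4 * (\<Lambda> * B + 1))" by (simp add: \<beta>_def)
    then have "(\<Lambda> * B + 1) * \<beta> \<le> r\<^sup>2 / 4" using pos by (simp add: field_simps)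
    then show "\<Lambda> * B * \<beta> \<le> r\<^sup>2 / 4" using \<open>\<beta> > 0\<close> by (simp add: distrib_right)
  qed
  show ?thesis
  proof (intro exI[of _ \<beta>] conjI ballI \<beta>)
    fix p v y assume p: "p \<in> cball pb \<beta>" and v: "v \<in> cball vb r" and y: "y \<in> cball xb r"
    have pr: "p \<in> cball pb \<rho>" and yr: "y \<in> cball xb \<rho>" using p y \<beta> r by auto
    define n where "n = v - f (y, p)"
    have n: "norm (n - nb) \<le> e"
    proof -
      have "n - nb = (v - vb) + (f (xb, pb) - f (y, p))"
        by (simp add: n_def nb_def base_eq Lagr_eq_comb)
      then have "norm (n - nb) \<le> norm (v - vb) + norm (f (xb, pb) - f (y, p))"
        by (simp add: norm_triangle_ineq)
      moreover have "norm (f (xb, pb) - f (y, p)) \<le> Lf * (norm (xb - y) + norm (pb - p))"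
        using base_in yr pr by (intro f_lip)
      moreover have "Lf * (norm (xb - y) + norm (pb - p)) \<le> Lf * (r + r)"
        using y p \<beta>(3) Lf by (intro mult_left_mono add_mono) (auto simp: dist_norm)
      moreover have "norm (v - vb) \<le> r" using v by (simp add: dist_norm norm_minus_commute)
      ultimately show ?thesis by (simp add: e_def algebra_simps)
    qed
    define h where "h x = \<sigma> / 2 * (norm (x - xb))\<^sup>2 - n \<bullet> (x - xb)" for x
    define A where "A = feasible_set \<phi> p \<inter> cball xb r"
    have contphi: "continuous_on (cball xb r) (\<lambda>x. \<phi> i (x, p))" for i
    proof (rule has_derivative_continuous_on)
      fix x assume "x \<in> cball xb r"
      then have "x \<in> cball xb \<rho>" using r by auto
      from has_derivative_at_withinI[OF phi_deriv[OF this pr]]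
      show "((\<lambda>x. \<phi> i (x, p)) has_derivative (\<lambda>u. G x p i \<bullet> u)) (at x within cball xb r)" .
    qed
    have "A = (\<Inter>i. {x \<in> cball xb r. \<phi> i (x, p) \<le> 0})" by (auto simp: A_def feasible_set_def)
    also have "closed \<dots>"
      by (intro closed_INT ballI continuous_on_closed_Collect_le continuous_on_const closed_cball contphi)
    finally have "closed A" .
    then have "compact A"
      using bounded_subset[OF bounded_cball[of xb r], of A] by (auto simp: compact_eq_bounded_closed A_def)
    have "p \<in> cball pb \<beta>0" using p \<beta>(2) by auto
    then obtain xp where xp: "xp \<in> cball xb a" "xp \<in> feasible_set \<phi> p" using \<beta>0(3) by blast
    have "xp \<in> A" using xp a(2) by (auto simp: A_def)
    have "continuous_on A h" unfolding h_def[abs_def] by (intro continuous_intros)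
    then obtain x where x: "x \<in> A" "\<And>z. z \<in> A \<Longrightarrow> h x \<le> h z"
      using continuous_attains_inf[OF \<open>compact A\<close>] \<open>xp \<in> A\<close> by blast
    have xr: "x \<in> cball xb r" "x \<in> cball xb \<rho>" "x \<in> ball xb \<rho>" and xf: "x \<in> feasible_set \<phi> p"
      using x(1) r by (auto simp: A_def)
    have hxp: "h xp \<le> r\<^sup>2 / 4"
    proof -
      have na: "norm (xp - xb) \<le> a" using xp(1) by (simp add: dist_norm norm_minus_commute)
      have "(norm (xp - xb))\<^sup>2 \<le> a * 1"
        unfolding power2_eq_square using na a(1,3) by (intro mult_mono) auto
      then have "\<sigma> / 2 * (norm (xp - xb))\<^sup>2 \<le> \<sigma> / 2 * a" using sigma_ge(3) by (intro mult_left_mono) auto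
      moreover have "- (n \<bullet> (xp - xb)) \<le> norm n * norm (xp - xb)"
        using norm_cauchy_schwarz[of "- n" "xp - xb"] by simp
      moreover have "norm n * norm (xp - xb) \<le> (norm nb + e) * a"
        using n na e norm_triangle_ineq2[of n nb] by (intro mult_mono) auto
      ultimately have "h xp \<le> \<sigma> / 2 * a + (norm nb + e) * a" by (simp add: h_def)
      also have "\<dots> \<le> a * c" using a(1) by (simp add: c_def algebra_simps)
      finally show ?thesis using a(4) by simp
    qed
    have inner: "norm (x - xb) < r"
    proof (rule ccontr)
      assume "\<not> ?thesis"
      then have nr: "norm (x - xb) = r" using xr by (simp add: dist_norm norm_minus_commute)
      have "\<mu>b $ i * (G xb pb i \<bullet> (x - xb)) \<le> \<mu>b $ i * (B * \<beta> + B * r\<^sup>2)" for i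
      proof (cases "i \<in> supp \<mu>b")
        case True
        then have "i \<in> active_set \<phi> xb pb" using base_kkt by (auto simp: kkt_def)
        then have "G xb pb i \<bullet> (x - xb) \<le> B * norm (p - pb) + B * (norm (x - xb))\<^sup>2"
          using xf xr pr base_in by (intro active_gradient_bound(1)) (auto simp: feasible_set_def)
        also have "\<dots> \<le> B * \<beta> + B * r\<^sup>2"
          using nr p B by (simp add: dist_norm norm_minus_commute)
        finally show ?thesis using base_kkt by (intro mult_left_mono) (auto simp: kkt_def)
      qed (simp add: supp_def)
      then have "nb \<bullet> (x - xb) \<le> (\<Sum>i\<in>UNIV. \<mu>b $ i * (B * \<beta> + B * r\<^sup>2))"
        unfolding nb_def comb_inner by (intro sum_mono)
      also have "\<dots> = \<Lambda> * B * \<beta> + B * \<Lambda> * r\<^sup>2"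
        unfolding \<Lambda>_def sum_distrib_right[symmetric] by (simp add: algebra_simps)
      finally have nb: "nb \<bullet> (x - xb) \<le> r\<^sup>2 / 4 + B * \<Lambda> * r\<^sup>2" using \<beta>(4) by simp
      have "(n - nb) \<bullet> (x - xb) \<le> norm (n - nb) * norm (x - xb)" by (rule norm_cauchy_schwarz)
      also have "\<dots> \<le> e * r" using n nr r e by (intro mult_mono) auto
      finally have "n \<bullet> (x - xb) \<le> e * r + r\<^sup>2 / 4 + B * \<Lambda> * r\<^sup>2" using nb by (simp add: inner_diff_left)
      also have "\<dots> = (1 + 2 * Lf + 1/4 + B * \<Lambda>) * r\<^sup>2" by (simp add: e_def power2_eq_square algebra_simps)
      finally have "h x \<ge> (\<sigma> / 2 - (1 + 2 * Lf + 1/4 + B * \<Lambda>)) * r\<^sup>2" by (simp add: h_def nr algebra_simps)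
      moreover have "(\<sigma> / 2 - (1 + 2 * Lf + 1/4 + B * \<Lambda>)) * r\<^sup>2 \<ge> (3 / 4) * r\<^sup>2"
        using sigma_ge(1) by (intro mult_right_mono) (auto simp: \<Lambda>_def)
      moreover have "h x \<le> h xp" using x(2)[OF \<open>xp \<in> A\<close>] .
      moreover have "0 < r\<^sup>2" using r(1) by simp
      ultimately show False using hxp by linarith
    qed
    have "n - \<sigma> *\<^sub>R (x - xb) \<in> regular_normal_cone (feasible_set \<phi> p) x"
    proof (rule regular_normal_cone_if_quadratic)
      show "r - norm (x - xb) > 0" using inner by simp
      fix z assume z: "z \<in> feasible_set \<phi> p" "norm (z - x) < r - norm (x - xb)"
      have "norm (z - xb) \<le> norm (z - x) + norm (x - xb)" using norm_triangle_ineq[of "z - x" "x - xb"] by simp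
      then have "z \<in> A" using z by (simp add: A_def dist_norm norm_minus_commute)
      then have "h x \<le> h z" by (rule x(2))
      moreover have "h z - h x = \<sigma> / 2 * (norm (z - x))\<^sup>2 - (n - \<sigma> *\<^sub>R (x - xb)) \<bullet> (z - x)"
        unfolding h_def power2_norm_eq_inner
        by (simp add: inner_diff_left inner_diff_right inner_commute algebra_simps) (simp add: field_simps)
      ultimately show "(n - \<sigma> *\<^sub>R (x - xb)) \<bullet> (z - x) \<le> \<sigma> / 2 * (norm (z - x))\<^sup>2" by simp
    qed
    then obtain \<mu> where "kkt \<phi> x p \<mu>" "n - \<sigma> *\<^sub>R (x - xb) = comb (G x p) \<mu>"
      using regular_normal_imp_kkt[OF xr(3) pr xf] by blast
    then show "\<exists>x\<in>cball xb r. \<exists>\<mu>. kkt \<phi> x p \<mu> \<and> v = f (y, p) + \<sigma> *\<^sub>R (x - xb) + comb (G x p) \<mu>"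
      using xr(1) by (intro bexI[of _ x] exI[of _ \<mu>]) (auto simp: n_def algebra_simps)
  qed
qed

text \<open>The solution for frozen data is a contraction of these data, since \<open>\<sigma>\<close> exceeds the hypomonotonicity constant of
the normals by at least \<open>2 Lf\<close>.\<close>

lemma resolvent_exists:
  assumes r: "0 < r" "r < \<rho>" "r * (1 + 2 * Lf + \<sigma>) \<le> \<rho>"
  shows "\<exists>\<beta>>0. \<beta> \<le> r \<and> (\<forall>p\<in>cball pb \<beta>. \<forall>v\<in>cball vb r.
      \<exists>x\<in>cball xb r. \<exists>\<mu>. kkt \<phi> x p \<mu> \<and> v = L x p \<mu> + \<sigma> *\<^sub>R (x - xb))"
proof -
  obtain \<beta> where \<beta>: "\<beta> > 0" "\<beta> \<le> r" and ex: "\<And>p v y. p \<in> cball pb \<beta> \<Longrightarrow> v \<in> cball vb r \<Longrightarrow> y \<in> cball xb r \<Longrightarrow>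
      \<exists>x\<in>cball xb r. \<exists>\<mu>. kkt \<phi> x p \<mu> \<and> v = f (y, p) + \<sigma> *\<^sub>R (x - xb) + comb (G x p) \<mu>"
    using penalized_minimizer[OF r(1,2)] by blast
  show ?thesis
  proof (intro exI[of _ \<beta>] conjI ballI \<beta>)
    fix p v assume p: "p \<in> cball pb \<beta>" and v: "v \<in> cball vb r"
    have pr: "p \<in> cball pb \<rho>" using p \<beta> r by auto
    define Q where "Q y x \<longleftrightarrow> (\<exists>\<mu>. kkt \<phi> x p \<mu> \<and> v = f (y, p) + \<sigma> *\<^sub>R (x - xb) + comb (G x p) \<mu>)" for y x
    have "\<exists>x\<in>cball xb r. Q x x"
    proof (rule implicit_contraction[where Q = Q and q = "1/2"])
      show "\<exists>x\<in>cball xb r. Q y x" if "y \<in> cball xb r" for y unfolding Q_def by (rule ex[OF p v that])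
      fix x1 x2 y1 y2 assume x: "x1 \<in> cball xb r" "x2 \<in> cball xb r" and y: "y1 \<in> cball xb r" "y2 \<in> cball xb r"
        and "Q y1 x1" "Q y2 x2"
      then obtain \<mu>1 \<mu>2 where k: "kkt \<phi> x1 p \<mu>1" "kkt \<phi> x2 p \<mu>2"
        and v1: "v = f (y1, p) + \<sigma> *\<^sub>R (x1 - xb) + comb (G x1 p) \<mu>1"
        and v2: "v = f (y2, p) + \<sigma> *\<^sub>R (x2 - xb) + comb (G x2 p) \<mu>2"
        unfolding Q_def by blast
      have big: "z \<in> cball xb \<rho>" if "z \<in> cball xb r" for z using that r by auto
      have close: "L x' p \<mu> \<in> cball vb \<rho>"
        if "x' \<in> cball xb r" "y' \<in> cball xb r" "v = f (y', p) + \<sigma> *\<^sub>R (x' - xb) + comb (G x' p) \<mu>" for x' y' \<mu>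
      proof -
        have "vb - L x' p \<mu> = (vb - v) + (f (y', p) - f (x', p)) + \<sigma> *\<^sub>R (x' - xb)"
          using that(3) by (simp add: Lagr_eq_comb)
        then have "norm (vb - L x' p \<mu>) \<le> norm (vb - v) + norm (f (y', p) - f (x', p)) + norm (\<sigma> *\<^sub>R (x' - xb))"
          by (metis (no_types) norm_triangle_mono order_refl)
        also have "\<dots> \<le> r + Lf * (r + r) + \<sigma> * r"
        proof (intro add_mono)
          show "norm (vb - v) \<le> r" using v by (simp add: dist_norm)
          have "norm (f (y', p) - f (x', p)) \<le> Lf * (norm (y' - x') + norm (p - p))"
            using that big pr by (intro f_lip)
          also have "\<dots> \<le> Lf * (r + r)"
            using that Lf norm_triangle_ineq4[of "y' - xb" "x' - xb"]
            by (intro mult_left_mono) (auto simp: dist_norm norm_minus_commute)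
          finally show "norm (f (y', p) - f (x', p)) \<le> Lf * (r + r)" .
          show "norm (\<sigma> *\<^sub>R (x' - xb)) \<le> \<sigma> * r"
            using that sigma_ge(3) by (simp add: dist_norm norm_minus_commute)
        qed
        also have "\<dots> \<le> \<rho>" using r(3) by (simp add: algebra_simps)
        finally show ?thesis by (simp add: dist_norm)
      qed
      have hyp: "- (2 * B * multiplier_cap) * (norm (x1 - x2))\<^sup>2 \<le> (comb (G x1 p) \<mu>1 - comb (G x2 p) \<mu>2) \<bullet> (x1 - x2)"
        using normal_hypomonotone[OF big big pr k close close] x y v1 v2 by blast
      have "comb (G x1 p) \<mu>1 - comb (G x2 p) \<mu>2 = - (f (y1, p) - f (y2, p)) - \<sigma> *\<^sub>R (x1 - x2)"
        using v1 v2 by (simp add: algebra_simps)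
      then have "(comb (G x1 p) \<mu>1 - comb (G x2 p) \<mu>2) \<bullet> (x1 - x2)
          = - (f (y1, p) - f (y2, p)) \<bullet> (x1 - x2) - \<sigma> * (norm (x1 - x2))\<^sup>2"
        by (simp only: inner_diff_left inner_scaleR_left power2_norm_eq_inner)
      moreover have "- (f (y1, p) - f (y2, p)) \<bullet> (x1 - x2) \<le> Lf * norm (y1 - y2) * norm (x1 - x2)"
      proof -
        have "- (f (y1, p) - f (y2, p)) \<bullet> (x1 - x2) \<le> norm (- (f (y1, p) - f (y2, p))) * norm (x1 - x2)"
          by (rule norm_cauchy_schwarz)
        also have "\<dots> \<le> Lf * norm (y1 - y2) * norm (x1 - x2)"
          using f_lip[OF big big pr pr, OF y] unfolding norm_minus_cancel by (intro mult_right_mono) auto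
        finally show ?thesis .
      qed
      ultimately have "(\<sigma> - 2 * B * multiplier_cap) * (norm (x1 - x2))\<^sup>2 \<le> Lf * norm (y1 - y2) * norm (x1 - x2)"
        using hyp by (simp add: algebra_simps)
      moreover have "2 * Lf * (norm (x1 - x2))\<^sup>2 \<le> (\<sigma> - 2 * B * multiplier_cap) * (norm (x1 - x2))\<^sup>2"
        using sigma_ge(2) by (intro mult_right_mono) auto
      ultimately have "Lf * (2 * norm (x1 - x2) * norm (x1 - x2)) \<le> Lf * (norm (y1 - y2) * norm (x1 - x2))"
        by (simp add: power2_eq_square algebra_simps)
      then have "2 * norm (x1 - x2) * norm (x1 - x2) \<le> norm (y1 - y2) * norm (x1 - x2)"
        using Lf by simp
      then show "norm (x1 - x2) \<le> 1 / 2 * norm (y1 - y2)"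
        by (cases "x1 = x2") auto
    qed (use r in auto)
    then obtain x \<mu> where "x \<in> cball xb r" "kkt \<phi> x p \<mu>" "v = f (x, p) + \<sigma> *\<^sub>R (x - xb) + comb (G x p) \<mu>"
      unfolding Q_def by blast
    then show "\<exists>x\<in>cball xb r. \<exists>\<mu>. kkt \<phi> x p \<mu> \<and> v = L x p \<mu> + \<sigma> *\<^sub>R (x - xb)"
      by (intro bexI[of _ x] exI[of _ \<mu>]) (auto simp: Lagr_eq_comb algebra_simps)
  qed
qed

end

section \<open>Strong monotonicity and solvability in a box\<close>

text \<open>The second-order condition on the whole neighborhood, for solutions whose right-hand sides are also close to the reference one.\<close>

locale gusosc_nbhd = solution_nbhd \<phi> xb pb \<rho> B \<tau> d f Lf vb \<mu>b
  for \<phi> :: "'m::finite \<Rightarrow> (real^'n) \<times> (real^'d) \<Rightarrow> real" and xb pb \<rho> B \<tau> d f Lf vb \<mu>b +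
  fixes l :: real
  assumes l: "l > 0"
    and soc: "\<And>x p \<mu> u. x \<in> cball xb \<rho> \<Longrightarrow> p \<in> cball pb \<rho> \<Longrightarrow> kkt \<phi> x p \<mu> \<Longrightarrow> Lagr f \<phi> x p \<mu> \<in> cball vb \<rho> \<Longrightarrow>
      (\<And>i. i \<in> supp \<mu> \<Longrightarrow> grad_x (\<phi> i) x p \<bullet> u = 0) \<Longrightarrow>
      (\<And>i. i \<in> active_set \<phi> x p \<Longrightarrow> grad_x (\<phi> i) x p \<bullet> u \<le> 0) \<Longrightarrow>
      l * (norm u)\<^sup>2 \<le> (jacobian (\<lambda>y. Lagr f \<phi> y p \<mu>) (at x) *v u) \<bullet> u"
begin

text \<open>Join the two right-hand sides of the shifted problem by a segment. The shifted solution is Lipschitz along it, so at each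
parameter \<open>t\<close> the neighborhood in \<open>pointwise_strong_monotonicity\<close> contains the nearby part of the path; in terms of the shifted
right-hand sides the local modulus is \<open>\<kappa> + \<sigma>\<close>. The local inequalities add up along the straight segment, and the shift cancels at its end points.\<close>

lemma resolvent_strongly_monotone:
  assumes r: "0 < r" "r < \<rho>" "r * (1 + 2 * Lf + \<sigma>) \<le> \<rho>" and p: "p \<in> cball pb \<rho>" and \<kappa>: "0 \<le> \<kappa>" "\<kappa> < l"
    and ex: "\<And>v. v \<in> cball vb r \<Longrightarrow> \<exists>x\<in>cball xb r. \<exists>\<mu>. kkt \<phi> x p \<mu> \<and> v = L x p \<mu> + \<sigma> *\<^sub>R (x - xb)"
    and x1: "x1 \<in> cball xb r" "kkt \<phi> x1 p \<mu>1" "L x1 p \<mu>1 + \<sigma> *\<^sub>R (x1 - xb) \<in> cball vb r"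
    and x2: "x2 \<in> cball xb r" "kkt \<phi> x2 p \<mu>2" "L x2 p \<mu>2 + \<sigma> *\<^sub>R (x2 - xb) \<in> cball vb r"
  shows "\<kappa> * (norm (x1 - x2))\<^sup>2 \<le> (L x1 p \<mu>1 - L x2 p \<mu>2) \<bullet> (x1 - x2)"
proof -
  define w1 w2 where "w1 = L x1 p \<mu>1 + \<sigma> *\<^sub>R (x1 - xb)" and "w2 = L x2 p \<mu>2 + \<sigma> *\<^sub>R (x2 - xb)"
  define sol where "sol v x \<longleftrightarrow> x \<in> cball xb r \<and> (\<exists>\<mu>. kkt \<phi> x p \<mu> \<and> v = L x p \<mu> + \<sigma> *\<^sub>R (x - xb))" for v x
  have close: "v - \<sigma> *\<^sub>R (x - xb) \<in> cball vb \<rho>" if "v \<in> cball vb r" "x \<in> cball xb r" for v x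
  proof -
    have "norm (vb - (v - \<sigma> *\<^sub>R (x - xb))) \<le> norm (vb - v) + norm (\<sigma> *\<^sub>R (x - xb))"
      using norm_triangle_ineq[of "vb - v" "\<sigma> *\<^sub>R (x - xb)"] by (simp add: algebra_simps)
    also have "\<dots> \<le> r + \<sigma> * r"
      using that sigma_ge(3) by (intro add_mono) (auto simp: dist_norm norm_minus_commute)
    also have "\<dots> \<le> r * (1 + 2 * Lf + \<sigma>)" using r(1) Lf by (simp add: algebra_simps)
    finally show ?thesis using r(3) by (simp add: dist_norm)
  qed
  have mono: "(norm (x - y))\<^sup>2 \<le> (v - w) \<bullet> (x - y)"
    if "sol v x" "sol w y" "v \<in> cball vb r" "w \<in> cball vb r" for v w x y
  proof -
    obtain \<mu> \<nu> where k: "kkt \<phi> x p \<mu>" "kkt \<phi> y p \<nu>"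
      and v: "v = L x p \<mu> + \<sigma> *\<^sub>R (x - xb)" "w = L y p \<nu> + \<sigma> *\<^sub>R (y - xb)"
      and xy: "x \<in> cball xb r" "y \<in> cball xb r"
      using \<open>sol v x\<close> \<open>sol w y\<close> unfolding sol_def by blast
    have "L x p \<mu> \<in> cball vb \<rho>" "L y p \<nu> \<in> cball vb \<rho>"
      using close[OF that(3) xy(1)] close[OF that(4) xy(2)] v by simp_all
    moreover have "x \<in> cball xb \<rho>" "y \<in> cball xb \<rho>" using xy r(2) by auto
    ultimately show ?thesis using shifted_strongly_monotone[OF _ _ p k] unfolding v by blast
  qed
  have uniq: "x = y" if "sol v x" "sol v y" "v \<in> cball vb r" for v x y
    using mono[OF that(1,2,3,3)] by simp
  define w where "w t = w2 + t *\<^sub>R (w1 - w2)" for t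
  have win: "w t \<in> cball vb r" if "0 \<le> t" "t \<le> 1" for t
  proof -
    have "w t = (1 - t) *\<^sub>R w2 + t *\<^sub>R w1" by (simp add: w_def algebra_simps)
    then show ?thesis
      using convexD_alt[OF convex_cball, of w2 vb r w1 t] x1(3) x2(3) that by (simp add: w1_def w2_def)
  qed
  define X where "X t = (SOME x. sol (w t) x)" for t
  have X: "sol (w t) (X t)" if "0 \<le> t" "t \<le> 1" for t
    using someI_ex[of "sol (w t)"] ex[OF win[OF that]] unfolding X_def sol_def by blast
  have "sol w1 x1" "sol w2 x2" using x1 x2 unfolding sol_def w1_def w2_def by blast+
  then have X01: "X 1 = x1" "X 0 = x2"
    using uniq[OF X[of 1], of x1] uniq[OF X[of 0], of x2] win[of 0] win[of 1] by (auto simp: w_def)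
  have wdiff: "w s - w t = (s - t) *\<^sub>R (w1 - w2)" for s t by (simp add: w_def algebra_simps)
  have "(\<kappa> + \<sigma>) * (norm (X 1 - X 0))\<^sup>2 \<le> (w1 - w2) \<bullet> (X 1 - X 0)"
  proof (rule strong_monotonicity_along_path)
    show "0 \<le> \<kappa> + \<sigma>" using \<kappa>(1) sigma_ge(3) by simp
    fix t :: real assume t: "0 \<le> t" "t \<le> 1"
    define v where "v = w t - \<sigma> *\<^sub>R (X t - xb)"
    have Xt: "X t \<in> ball xb \<rho>" "X t \<in> cball xb \<rho>" "X t \<in> cball xb r" using X[OF t] r(2) by (auto simp: sol_def)
    have "v \<in> cball vb \<rho>" unfolding v_def by (rule close[OF win[OF t] Xt(3)])
    then obtain \<epsilon> where \<epsilon>: "\<epsilon> > 0" and loc: "\<And>y \<nu>. kkt \<phi> y p \<nu> \<Longrightarrow> norm (y - X t) < \<epsilon> \<Longrightarrow> norm (L y p \<nu> - v) < \<epsilon> \<Longrightarrow>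
      \<kappa> * (norm (y - X t))\<^sup>2 \<le> (L y p \<nu> - v) \<bullet> (y - X t)"
      using pointwise_strong_monotonicity[OF Xt(1) p \<kappa>(2), of v] soc[OF Xt(2) p] by blast
    let ?D = "norm (w1 - w2)"
    \<comment> \<open>the right-hand side of the original problem moves at most (1 + \<sigma>) times as fast as that of the shifted one\<close>
    define e where "e = \<epsilon> / ((1 + \<sigma>) * (?D + 1))"
    have den: "(1 + \<sigma>) * (?D + 1) > 0" using sigma_ge(3) by (simp add: add_nonneg_pos)
    have "e > 0" unfolding e_def using \<epsilon> den by simp
    moreover have "(\<kappa> + \<sigma>) * (norm (X s - X t))\<^sup>2 \<le> (s - t) * ((w1 - w2) \<bullet> (X s - X t))"
      if s: "0 \<le> s" "s \<le> 1" and st: "\<bar>s - t\<bar> < e" for s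
    proof -
      have "(norm (X s - X t))\<^sup>2 \<le> (w s - w t) \<bullet> (X s - X t)"
        using s t by (intro mono X win)
      then have dX: "norm (X s - X t) \<le> \<bar>s - t\<bar> * ?D"
        using norm_le_of_square unfolding wdiff by fastforce
      have small: "(1 + \<sigma>) * (\<bar>s - t\<bar> * ?D) < \<epsilon>"
      proof -
        have "(1 + \<sigma>) * (\<bar>s - t\<bar> * ?D) \<le> \<bar>s - t\<bar> * ((1 + \<sigma>) * (?D + 1))"
          using sigma_ge(3) by (simp add: algebra_simps)
        also have "\<dots> < e * ((1 + \<sigma>) * (?D + 1))" using st den by (intro mult_strict_right_mono)
        also have "\<dots> = \<epsilon>" unfolding e_def using den by (intro nonzero_eq_divide_eq[THEN iffD1]) auto
        finally show ?thesis .
      qed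
      obtain \<nu> where \<nu>: "kkt \<phi> (X s) p \<nu>" "w s = L (X s) p \<nu> + \<sigma> *\<^sub>R (X s - xb)"
        using X[OF s] by (auto simp: sol_def)
      have Lv: "L (X s) p \<nu> - v = (s - t) *\<^sub>R (w1 - w2) - \<sigma> *\<^sub>R (X s - X t)"
        unfolding v_def wdiff[symmetric] \<nu>(2) by (simp add: algebra_simps)
      have "norm (L (X s) p \<nu> - v) \<le> \<bar>s - t\<bar> * ?D + \<sigma> * norm (X s - X t)"
        unfolding Lv using norm_triangle_ineq4[of "(s - t) *\<^sub>R (w1 - w2)" "\<sigma> *\<^sub>R (X s - X t)"] sigma_ge(3) by simp
      also have "\<dots> \<le> (1 + \<sigma>) * (\<bar>s - t\<bar> * ?D)"
        using mult_left_mono[OF dX, of \<sigma>] sigma_ge(3) by (simp add: algebra_simps)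
      also note small
      finally have 1: "norm (L (X s) p \<nu> - v) < \<epsilon>" .
      have "norm (X s - X t) \<le> (1 + \<sigma>) * (\<bar>s - t\<bar> * ?D)"
        using dX sigma_ge(3) mult_right_mono[of 1 "1 + \<sigma>" "\<bar>s - t\<bar> * ?D"] by simp
      then have 2: "norm (X s - X t) < \<epsilon>" using small by linarith
      from loc[OF \<nu>(1) 2 1] show ?thesis
        unfolding Lv by (simp add: inner_diff_left power2_norm_eq_inner algebra_simps)
    qed
    ultimately show "\<exists>e>0. \<forall>s. 0 \<le> s \<and> s \<le> 1 \<and> \<bar>s - t\<bar> < e \<longrightarrow>
        (\<kappa> + \<sigma>) * (norm (X s - X t))\<^sup>2 \<le> (s - t) * ((w1 - w2) \<bullet> (X s - X t))" by blast
  qed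
  then have "(\<kappa> + \<sigma>) * (norm (x1 - x2))\<^sup>2 \<le> (w1 - w2) \<bullet> (x1 - x2)" using X01 by simp
  moreover have "(w1 - w2) \<bullet> (x1 - x2) = (L x1 p \<mu>1 - L x2 p \<mu>2) \<bullet> (x1 - x2) + \<sigma> * (norm (x1 - x2))\<^sup>2"
    by (simp add: w1_def w2_def power2_norm_eq_inner inner_add_left inner_diff_left inner_diff_right algebra_simps)
  ultimately show ?thesis by (simp add: algebra_simps)
qed

text \<open>A solution for \<open>v\<close> is a fixed point of the map that sends \<open>y\<close> to the shifted solution for \<open>v + \<sigma> (y - xb)\<close>. This is a
contraction with factor \<open>\<sigma> / (\<kappa> + \<sigma>)\<close>. It maps a ball into itself because the shifted solution for the reference right-hand side \<open>vb\<close>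
is close to \<open>xb\<close> for parameters close to \<open>pb\<close>.\<close>

lemma strongly_monotone_solutions:
  assumes \<kappa>: "0 < \<kappa>" "\<kappa> < l"
  obtains r c \<delta> where "0 < r" "r < \<rho>" "0 < c" "c \<le> \<rho>" "0 < \<delta>" "\<delta> \<le> \<rho>"
    "\<And>p v. p \<in> cball pb \<delta> \<Longrightarrow> v \<in> cball vb c \<Longrightarrow> \<exists>x\<in>cball xb r. \<exists>\<mu>. kkt \<phi> x p \<mu> \<and> v = L x p \<mu>"
    "\<And>p x y \<mu> \<nu>. p \<in> cball pb \<delta> \<Longrightarrow> x \<in> cball xb r \<Longrightarrow> y \<in> cball xb r \<Longrightarrow> kkt \<phi> x p \<mu> \<Longrightarrow> kkt \<phi> y p \<nu> \<Longrightarrow>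
       L x p \<mu> \<in> cball vb c \<Longrightarrow> L y p \<nu> \<in> cball vb c \<Longrightarrow>
       \<kappa> * (norm (x - y))\<^sup>2 \<le> (L x p \<mu> - L y p \<nu>) \<bullet> (x - y)"
proof -
  have \<sigma>0: "\<sigma> > 0" by (rule sigma_ge(3))
  have den: "1 + 2 * Lf + \<sigma> > 0" using Lf \<sigma>0 by simp
  \<comment> \<open>the largest scale on which the shifted problem is known to be solvable\<close>
  define r0 where "r0 = min (\<rho> / 2) (\<rho> / (1 + 2 * Lf + \<sigma>))"
  have r0: "0 < r0" "r0 < \<rho>" "r0 * (1 + 2 * Lf + \<sigma>) \<le> \<rho>"
  proof -
    show "0 < r0" "r0 < \<rho>" using rho den by (auto simp: r0_def)
    have "r0 \<le> \<rho> / (1 + 2 * Lf + \<sigma>)" by (simp add: r0_def)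
    then show "r0 * (1 + 2 * Lf + \<sigma>) \<le> \<rho>" using den by (simp only: pos_le_divide_eq)
  qed
  \<comment> \<open>on this ball the shift keeps right-hand sides in the range of the shifted problem\<close>
  define r where "r = r0 / (\<sigma> + \<kappa> + 1)"
  have r: "0 < r" "r \<le> r0" "(\<sigma> + \<kappa>) * r \<le> r0"
  proof -
    have pos: "\<sigma> + \<kappa> + 1 > 0" using \<sigma>0 \<kappa> by simp
    then show "0 < r" using r0(1) by (simp add: r_def)
    have "r0 = (\<sigma> + \<kappa> + 1) * r" using pos by (simp add: r_def)
    then have *: "r0 = (\<sigma> + \<kappa>) * r + r" by (simp add: algebra_simps)
    have "(\<sigma> + \<kappa>) * r \<ge> 0" using \<sigma>0 \<kappa> \<open>0 < r\<close> by simp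
    then show "r \<le> r0" "(\<sigma> + \<kappa>) * r \<le> r0" using * \<open>0 < r\<close> by linarith+
  qed
  define c where "c = \<kappa> * r / 2"
  have c: "0 < c" "c + \<sigma> * r \<le> r0"
  proof -
    show "0 < c" using \<kappa> r by (simp add: c_def)
    have "c \<le> \<kappa> * r" using \<kappa> r by (simp add: c_def)
    then show "c + \<sigma> * r \<le> r0" using r(3) by (simp add: distrib_right)
  qed
  \<comment> \<open>with c = \<kappa> r / 2 this gives (c + \<sigma> r) / (\<kappa> + \<sigma>) + a = r, the self-mapping property\<close>
  define a where "a = c / (\<kappa> + \<sigma>)"
  have a: "0 < a" "a * (\<kappa> + \<sigma>) = c" "a \<le> r0"
  proof -
    have pos: "\<kappa> + \<sigma> > 0" using \<sigma>0 \<kappa> by simp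
    show "0 < a" "a * (\<kappa> + \<sigma>) = c" using c pos by (auto simp: a_def)
    have "a = (\<kappa> / (\<kappa> + \<sigma>)) * (r / 2)" by (simp add: a_def c_def)
    also have "\<dots> \<le> 1 * (r / 2)" using \<sigma>0 \<kappa> r by (intro mult_right_mono) auto
    finally show "a \<le> r0" using r by simp
  qed
  have small: "a < \<rho>" "a * (1 + 2 * Lf + \<sigma>) \<le> \<rho>"
    using a(3) r0 den mult_right_mono[OF a(3), of "1 + 2 * Lf + \<sigma>"] by linarith+
  obtain \<beta>0 where \<beta>0: "\<beta>0 > 0" "\<beta>0 \<le> r0" and ex0: "\<And>p v. p \<in> cball pb \<beta>0 \<Longrightarrow> v \<in> cball vb r0 \<Longrightarrow>
      \<exists>x\<in>cball xb r0. \<exists>\<mu>. kkt \<phi> x p \<mu> \<and> v = L x p \<mu> + \<sigma> *\<^sub>R (x - xb)"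
    using resolvent_exists[OF r0] by blast
  obtain \<beta>1 where \<beta>1: "\<beta>1 > 0" and ex1: "\<And>p v. p \<in> cball pb \<beta>1 \<Longrightarrow> v \<in> cball vb a \<Longrightarrow>
      \<exists>x\<in>cball xb a. \<exists>\<mu>. kkt \<phi> x p \<mu> \<and> v = L x p \<mu> + \<sigma> *\<^sub>R (x - xb)"
    using resolvent_exists[OF a(1) small] by blast
  define \<delta> where "\<delta> = min \<beta>0 \<beta>1"
  have inr: "v + \<sigma> *\<^sub>R (x - xb) \<in> cball vb r0" if "v \<in> cball vb c" "x \<in> cball xb r" for v x
  proof -
    have "norm (vb - (v + \<sigma> *\<^sub>R (x - xb))) \<le> norm (vb - v) + norm (\<sigma> *\<^sub>R (x - xb))"
      using norm_triangle_ineq4[of "vb - v" "\<sigma> *\<^sub>R (x - xb)"] by (simp add: algebra_simps)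
    also have "\<dots> \<le> c + \<sigma> * r"
      using that \<sigma>0 by (intro add_mono) (auto simp: dist_norm norm_minus_commute)
    finally show ?thesis using c(2) by (simp add: dist_norm)
  qed
  have mono0: "\<kappa> * (norm (x - y))\<^sup>2 \<le> (L x p \<mu> - L y p \<nu>) \<bullet> (x - y)"
    if "p \<in> cball pb \<delta>" "x \<in> cball xb r0" "y \<in> cball xb r0" "kkt \<phi> x p \<mu>" "kkt \<phi> y p \<nu>"
      "L x p \<mu> + \<sigma> *\<^sub>R (x - xb) \<in> cball vb r0" "L y p \<nu> + \<sigma> *\<^sub>R (y - xb) \<in> cball vb r0" for p x y \<mu> \<nu>
  proof (rule resolvent_strongly_monotone[OF r0 _ _ \<kappa>(2) ex0])
    show "p \<in> cball pb \<rho>" using that(1) \<beta>0(2) r0(2) by (auto simp: \<delta>_def)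
    show "p \<in> cball pb \<beta>0" using that(1) by (auto simp: \<delta>_def)
  qed (use that \<kappa> in auto)
  show thesis
  proof (rule that[of r c \<delta>])
    show "0 < r" "r < \<rho>" "0 < c" "0 < \<delta>" "\<delta> \<le> \<rho>" using r r0 c \<beta>0 \<beta>1 by (auto simp: \<delta>_def)
    have "0 \<le> \<sigma> * r" using \<sigma>0 r(1) by simp
    then show "c \<le> \<rho>" using c(2) r0(2) by linarith
    fix p assume p: "p \<in> cball pb \<delta>"
    show "\<kappa> * (norm (x - y))\<^sup>2 \<le> (L x p \<mu> - L y p \<nu>) \<bullet> (x - y)"
      if "x \<in> cball xb r" "y \<in> cball xb r" "kkt \<phi> x p \<mu>" "kkt \<phi> y p \<nu>"
        "L x p \<mu> \<in> cball vb c" "L y p \<nu> \<in> cball vb c" for x y \<mu> \<nu>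
      using that r(2) inr by (intro mono0[OF p]) auto
    fix v assume v: "v \<in> cball vb c"
    have p0: "p \<in> cball pb \<beta>0" "p \<in> cball pb \<beta>1" using p by (auto simp: \<delta>_def)
    obtain x0 \<mu>0 where x0: "x0 \<in> cball xb a" "kkt \<phi> x0 p \<mu>0" "vb = L x0 p \<mu>0 + \<sigma> *\<^sub>R (x0 - xb)"
      using ex1[OF p0(2), of vb] a(1) by auto
    have x0r: "x0 \<in> cball xb r0" using x0(1) a(3) by auto
    define Q where "Q y x \<longleftrightarrow> (\<exists>\<mu>. kkt \<phi> x p \<mu> \<and> v + \<sigma> *\<^sub>R (y - xb) = L x p \<mu> + \<sigma> *\<^sub>R (x - xb))" for y x
    have Qlip: "norm (x - x') \<le> norm (w - w') / (\<kappa> + \<sigma>)"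
      if "x \<in> cball xb r0" "x' \<in> cball xb r0" "kkt \<phi> x p \<mu>" "kkt \<phi> x' p \<mu>'"
        "w = L x p \<mu> + \<sigma> *\<^sub>R (x - xb)" "w' = L x' p \<mu>' + \<sigma> *\<^sub>R (x' - xb)"
        "w \<in> cball vb r0" "w' \<in> cball vb r0" for x x' \<mu> \<mu>' w w'
    proof -
      have "\<kappa> * (norm (x - x'))\<^sup>2 \<le> (L x p \<mu> - L x' p \<mu>') \<bullet> (x - x')"
        using that by (intro mono0[OF p]) auto
      moreover have "(w - w') \<bullet> (x - x') = (L x p \<mu> - L x' p \<mu>') \<bullet> (x - x') + \<sigma> * (norm (x - x'))\<^sup>2"
        unfolding that(5,6)
        by (simp add: power2_norm_eq_inner inner_add_left inner_diff_left inner_diff_right algebra_simps)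
      ultimately have "(\<kappa> + \<sigma>) * (norm (x - x'))\<^sup>2 \<le> (w - w') \<bullet> (x - x')" by (simp add: distrib_right)
      also have "\<dots> \<le> norm (w - w') * norm (x - x')" by (rule norm_cauchy_schwarz)
      finally have "(\<kappa> + \<sigma>) * norm (x - x') \<le> norm (w - w')"
        by (cases "x = x'") (auto simp: power2_eq_square)
      then show ?thesis using \<sigma>0 \<kappa> by (simp add: pos_le_divide_eq mult.commute)
    qed
    have "\<exists>x\<in>cball xb r. Q x x"
    proof (rule implicit_contraction[where Q = Q and q = "\<sigma> / (\<kappa> + \<sigma>)"])
      show "0 \<le> r" "0 \<le> \<sigma> / (\<kappa> + \<sigma>)" "\<sigma> / (\<kappa> + \<sigma>) < 1" using r \<sigma>0 \<kappa> by auto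
    next
      fix y assume y: "y \<in> cball xb r"
      let ?w = "v + \<sigma> *\<^sub>R (y - xb)"
      obtain x \<mu> where x: "x \<in> cball xb r0" "kkt \<phi> x p \<mu>" "?w = L x p \<mu> + \<sigma> *\<^sub>R (x - xb)"
        using ex0[OF p0(1) inr[OF v y]] by blast
      have "norm (x - x0) \<le> norm (?w - vb) / (\<kappa> + \<sigma>)"
        using r0(1) by (intro Qlip[OF x(1) x0r x(2) x0(2) x(3) x0(3) inr[OF v y]]) auto
      also have "\<dots> \<le> (c + \<sigma> * r) / (\<kappa> + \<sigma>)"
      proof (intro divide_right_mono)
        have "norm (?w - vb) \<le> norm (v - vb) + norm (\<sigma> *\<^sub>R (y - xb))"
          using norm_triangle_ineq[of "v - vb" "\<sigma> *\<^sub>R (y - xb)"] by (simp add: algebra_simps)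
        also have "\<dots> \<le> c + \<sigma> * r"
          using v y \<sigma>0 by (intro add_mono) (auto simp: dist_norm norm_minus_commute)
        finally show "norm (?w - vb) \<le> c + \<sigma> * r" .
      qed (use \<sigma>0 \<kappa> in auto)
      finally have "norm (x - x0) \<le> (c + \<sigma> * r) / (\<kappa> + \<sigma>)" .
      moreover have "norm (x0 - xb) \<le> a" using x0(1) by (simp add: dist_norm norm_minus_commute)
      moreover have "(c + \<sigma> * r) / (\<kappa> + \<sigma>) + a = r"
      proof -
        have "(c + \<sigma> * r) + a * (\<kappa> + \<sigma>) = r * (\<kappa> + \<sigma>)" unfolding a(2) by (simp add: c_def algebra_simps)
        then have "((c + \<sigma> * r) + a * (\<kappa> + \<sigma>)) / (\<kappa> + \<sigma>) = r" using \<sigma>0 \<kappa> by simp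
        then show ?thesis using \<sigma>0 \<kappa> by (simp only: add_divide_distrib) simp
      qed
      ultimately have "norm (x - xb) \<le> r" using norm_triangle_ineq[of "x - x0" "x0 - xb"] by simp
      then show "\<exists>x\<in>cball xb r. Q y x"
        using x unfolding Q_def by (intro bexI[of _ x]) (auto simp: dist_norm norm_minus_commute)
    next
      fix x x' y y' assume xs: "x \<in> cball xb r" "x' \<in> cball xb r" and ys: "y \<in> cball xb r" "y' \<in> cball xb r"
        and "Q y x" "Q y' x'"
      then obtain \<mu> \<mu>' where k: "kkt \<phi> x p \<mu>" "v + \<sigma> *\<^sub>R (y - xb) = L x p \<mu> + \<sigma> *\<^sub>R (x - xb)"
        "kkt \<phi> x' p \<mu>'" "v + \<sigma> *\<^sub>R (y' - xb) = L x' p \<mu>' + \<sigma> *\<^sub>R (x' - xb)"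
        unfolding Q_def by blast
      have "norm (x - x') \<le> norm ((v + \<sigma> *\<^sub>R (y - xb)) - (v + \<sigma> *\<^sub>R (y' - xb))) / (\<kappa> + \<sigma>)"
        using xs r(2) by (intro Qlip[OF _ _ k(1,3,2,4) inr[OF v ys(1)] inr[OF v ys(2)]]) auto
      also have "(v + \<sigma> *\<^sub>R (y - xb)) - (v + \<sigma> *\<^sub>R (y' - xb)) = \<sigma> *\<^sub>R (y - y')" by (simp add: algebra_simps)
      finally show "norm (x - x') \<le> \<sigma> / (\<kappa> + \<sigma>) * norm (y - y')" using \<sigma>0 by simp
    qed
    then show "\<exists>x\<in>cball xb r. \<exists>\<mu>. kkt \<phi> x p \<mu> \<and> v = L x p \<mu>" unfolding Q_def by auto
  qed
qed

end

section \<open>Lipschitz dependence on the parameter\<close>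

text \<open>A multiplier may be replaced by one with linearly independent support without changing the normal vector.\<close>

lemma kkt_independent_support:
  assumes "kkt \<phi> x p \<mu>"
  obtains \<nu> where "kkt \<phi> x p \<nu>" "Lagr f \<phi> x p \<nu> = Lagr f \<phi> x p \<mu>" "indep_family (gradients \<phi> x p) (supp \<nu>)"
proof -
  obtain \<nu> where \<nu>: "comb (gradients \<phi> x p) \<nu> = comb (gradients \<phi> x p) \<mu>" "supp \<nu> \<subseteq> supp \<mu>"
    "\<forall>i. 0 \<le> \<mu> $ i * \<nu> $ i" "indep_family (gradients \<phi> x p) (supp \<nu>)"
    using caratheodory_signed by blast
  have "0 \<le> \<nu> $ i" for i
  proof (cases "i \<in> supp \<nu>")
    case True
    then have "\<mu> $ i > 0" using \<nu>(2) assms by (auto simp: supp_def kkt_def order_less_le)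
    then show ?thesis using \<nu>(3) by (metis zero_le_mult_iff not_less)
  qed (simp add: supp_def)
  then have "kkt \<phi> x p \<nu>" using assms \<nu>(2) by (auto simp: kkt_def)
  then show thesis using that \<nu>(1,4) by (simp add: Lagr_eq_comb)
qed

text \<open>In addition, a lower bound \<open>\<gamma>\<close> for combinations of independent active gradients that is uniform on the neighborhood.\<close>

locale full_stability_nbhd = crcq_nbhd \<phi> xb pb \<rho> B \<tau> d + gusosc_nbhd \<phi> xb pb \<rho> B \<tau> d f Lf vb \<mu>b l
  for \<phi> :: "'m::finite \<Rightarrow> (real^'n) \<times> (real^'d) \<Rightarrow> real" and xb pb \<rho> B \<tau> d f Lf vb \<mu>b l +
  fixes \<gamma> :: real
  assumes gamma: "\<gamma> > 0"
    and lower: "\<And>x p \<mu>. x \<in> cball xb \<rho> \<Longrightarrow> p \<in> cball pb \<rho> \<Longrightarrow> supp \<mu> \<subseteq> active_set \<phi> xb pb \<Longrightarrow>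
      indep_family (gradients \<phi> x p) (supp \<mu>) \<Longrightarrow> \<gamma> * norm \<mu> \<le> norm (comb (gradients \<phi> x p) \<mu>)"
begin

text \<open>\<open>K\<close> is a Lipschitz constant of the Lagrangian mapping for all multipliers in question; \<open>C1\<close> bounds the speed of the multipliers,
\<open>C2\<close> collects the error terms of the expansion, and \<open>C3\<close> is the distance to a critical direction, the latter two
per unit of the ratio of parameter speed and solution speed. The final constant makes all of these small against \<open>l\<close>.\<close>

definition K :: real where "K = Lf + B * multiplier_cap"
definition C1 :: real where "C1 = real CARD('m) * (2 * K / \<gamma>)"
definition C2 :: real where "C2 = K + C1 * B"
definition C3 :: real where "C3 = real CARD('m) * B / \<gamma>"
definition calm_const :: real where "calm_const = 1 + 2 * C3 + 4 * (C2 + 3 * K * C3) / l"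

lemma const_nonneg: "0 \<le> K" "0 \<le> C1" "0 \<le> C2" "0 \<le> C3"
  using Lf B multiplier_cap_nonneg gamma by (auto simp: K_def C1_def C2_def C3_def)

lemma calm_const_ge: "calm_const \<ge> 1" "calm_const \<ge> 2 * C3" "4 * (C2 + 3 * K * C3) < l * calm_const"
proof -
  have nn: "0 \<le> 4 * (C2 + 3 * K * C3) / l" using const_nonneg l by simp
  then show "calm_const \<ge> 1" "calm_const \<ge> 2 * C3" using const_nonneg(4) by (auto simp: calm_const_def)
  have "l * calm_const = l * (1 + 2 * C3) + 4 * (C2 + 3 * K * C3)"
  proof -
    have "l * (4 * (C2 + 3 * K * C3) / l) = 4 * (C2 + 3 * K * C3)" using l by simp
    then show ?thesis unfolding calm_const_def by (simp only: distrib_left)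
  qed
  moreover have "0 < l * (1 + 2 * C3)" using l const_nonneg(4) by (simp add: add_pos_nonneg)
  ultimately show "4 * (C2 + 3 * K * C3) < l * calm_const" by simp
qed

text \<open>The difference of the multipliers is supported on a family that is independent at \<open>(y, q)\<close> and, by constant rank, also at
\<open>(x, p)\<close>. There the combination with coefficients \<open>\<nu> - \<mu>\<close> equals a difference of values of the Lagrangian mapping
for the same multiplier \<open>\<nu>\<close>.\<close>

lemma multiplier_difference_bound:
  assumes x: "x \<in> cball xb \<rho>" "y \<in> cball xb \<rho>" and p: "p \<in> cball pb \<rho>" "q \<in> cball pb \<rho>"
    and k: "kkt \<phi> y q \<nu>" and eq: "L y q \<nu> = L x p \<mu>" and v: "L x p \<mu> \<in> cball vb \<rho>"
    and s: "supp \<mu> \<subseteq> supp \<nu>" and ind: "indep_family (G y q) (supp \<nu>)"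
    and le: "norm (q - p) \<le> norm (y - x)"
  shows "(\<Sum>i\<in>UNIV. \<bar>\<nu> $ i - \<mu> $ i\<bar>) \<le> C1 * norm (y - x)"
proof -
  have act: "supp \<nu> \<subseteq> active_set \<phi> xb pb" using k active_sub[OF x(2) p(2)] by (auto simp: kkt_def)
  have sub: "supp (\<nu> - \<mu>) \<subseteq> supp \<nu>" using s by (auto simp: supp_def)
  have "indep_family (G x p) (supp (\<nu> - \<mu>))"
    using indep_family_persists[OF act x(2) p(2) x(1) p(1) ind] sub by (rule indep_family_subset)
  then have "\<gamma> * norm (\<nu> - \<mu>) \<le> norm (comb (G x p) (\<nu> - \<mu>))"
    using sub act by (intro lower x p) auto
  also have "comb (G x p) (\<nu> - \<mu>) = L x p \<nu> - L y q \<nu>"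
    using eq by (simp add: Lagr_eq_comb comb_diff)
  also have "norm \<dots> \<le> (Lf + B * (\<Sum>i\<in>UNIV. \<nu> $ i)) * (norm (x - y) + norm (p - q))"
    using k by (intro Lagr_lipschitz x p) (auto simp: kkt_def)
  also have "\<dots> \<le> K * (2 * norm (y - x))"
  proof (intro mult_mono)
    show "Lf + B * (\<Sum>i\<in>UNIV. \<nu> $ i) \<le> K"
      using multiplier_bound[OF x(2) p(2) k] eq v B by (simp add: K_def)
    show "norm (x - y) + norm (p - q) \<le> 2 * norm (y - x)" using le by (simp add: norm_minus_commute)
  qed (use const_nonneg in auto)
  finally have "norm (\<nu> - \<mu>) \<le> 2 * K / \<gamma> * norm (y - x)" using gamma by (simp add: field_simps)
  then have "real CARD('m) * norm (\<nu> - \<mu>) \<le> C1 * norm (y - x)"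
    unfolding C1_def mult.assoc by (intro mult_left_mono) auto
  then show ?thesis using sum_abs_le_norm[of "\<nu> - \<mu>"] by simp
qed

text \<open>If solutions moved faster than \<open>calm_const\<close> times the parameter, the blow-up direction \<open>u\<close> would satisfy the critical
cone conditions up to \<open>B / calm_const\<close>, and the quadratic form at \<open>u\<close> would be at most \<open>C2 / calm_const\<close>. Hoffman's bound provides a
truly critical direction nearby, for which the second-order condition fails.\<close>

lemma calm_in_parameter:
  assumes X: "X \<longlonglongrightarrow> x" "P \<longlonglongrightarrow> p" "\<And>k. X k \<in> cball xb \<rho>" "\<And>k. P k \<in> cball pb \<rho>" and x: "x \<in> ball xb \<rho>"
    and v: "v \<in> cball vb \<rho>" and sol: "\<And>k. \<exists>\<mu>. kkt \<phi> (X k) (P k) \<mu> \<and> v = L (X k) (P k) \<mu>"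
    and fast: "\<And>k. calm_const * norm (P k - p) < norm (X k - x)"
  shows False
proof -
  have xc: "x \<in> cball xb \<rho>" and pc: "p \<in> cball pb \<rho>"
    using x closed_sequentially[OF closed_cball X(4,2)] by auto
  have "\<exists>\<mu>. kkt \<phi> (X k) (P k) \<mu> \<and> L (X k) (P k) \<mu> = v \<and> indep_family (G (X k) (P k)) (supp \<mu>)" for k
    using sol[of k] kkt_independent_support[of \<phi> "X k" "P k" _ f] by metis
  then obtain M where M: "\<And>k. kkt \<phi> (X k) (P k) (M k)" "\<And>k. L (X k) (P k) (M k) = v"
      "\<And>k. indep_family (G (X k) (P k)) (supp (M k))" by metis
  have ne: "X k \<noteq> x" for k
  proof -
    have "0 \<le> calm_const * norm (P k - p)" using calm_const_ge(1) by simp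
    then have "norm (X k - x) > 0" using fast[of k] by linarith
    then show ?thesis by simp
  qed
  have "(\<lambda>k. L (X k) (P k) (M k)) \<longlonglongrightarrow> v" by (simp add: M(2))
  then obtain r \<mu> u where r: "strict_mono r" and k: "kkt \<phi> x p \<mu>" "L x p \<mu> = v"
    and u: "(\<lambda>k. (X (r k) - x) /\<^sub>R norm (X (r k) - x)) \<longlonglongrightarrow> u" "norm u = 1"
    and s: "\<And>k. supp \<mu> \<subseteq> supp (M (r k))" "\<And>k. supp (M (r k)) \<subseteq> active_set \<phi> x p"
    by (rule blow_up_subsequence[OF X M(1) _ ne]) (rule that)
  define t where "t k = norm (X (r k) - x)" for k
  have t: "\<And>k. t k > 0" "t \<longlonglongrightarrow> 0"
    using ne tendsto_norm_zero[OF LIM_zero[OF LIMSEQ_subseq_LIMSEQ[OF X(1) r]]] by (auto simp: t_def[abs_def] o_def)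
  let ?c = calm_const
  have c: "?c > 0" using calm_const_ge(1) by simp
  have dp: "norm (P (r k) - p) \<le> t k / ?c" for k
    using fast[of "r k"] c by (simp add: t_def pos_le_divide_eq mult.commute less_imp_le)
  have dp': "norm (P (r k) - p) \<le> t k" for k
  proof -
    have "t k / ?c \<le> t k / 1" using t(1)[of k] calm_const_ge(1) by (intro divide_left_mono) auto
    then show ?thesis using dp[of k] by simp
  qed
  let ?u = "\<lambda>k. (X (r k) - x) /\<^sub>R t k"
  have u': "?u \<longlonglongrightarrow> u" using u(1) by (simp add: t_def)
  have gap: "B * norm (P (r k) - p) + B * (t k)\<^sup>2 \<le> t k * (B / ?c + B * t k)" for k
    using mult_left_mono[OF dp[of k], of B] B by (simp add: power2_eq_square algebra_simps)
  have Blim: "(\<lambda>k. B / ?c + B * t k) \<longlonglongrightarrow> B / ?c"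
    using tendsto_add[OF tendsto_const[of "B / ?c"] tendsto_mult[OF tendsto_const[of B] t(2)]] by simp
  have Gu: "(\<lambda>k. G x p i \<bullet> ?u k) \<longlonglongrightarrow> G x p i \<bullet> u" for i by (intro tendsto_intros u')
  have Guk: "G x p i \<bullet> ?u k = (G x p i \<bullet> (X (r k) - x)) / t k" for i k
    by (simp add: divide_inverse mult.commute)
  have ineq: "G x p i \<bullet> u \<le> B / ?c" if i: "i \<in> active_set \<phi> x p" for i
  proof -
    have "G x p i \<bullet> ?u k \<le> B / ?c + B * t k" for k
    proof -
      have "\<phi> i (X (r k), P (r k)) \<le> 0" using M(1) by (auto simp: kkt_def feasible_set_def)
      from active_gradient_bound(1)[OF xc X(3) pc X(4) i this]
      have "G x p i \<bullet> (X (r k) - x) \<le> t k * (B / ?c + B * t k)" using gap[of k] by (simp add: t_def)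
      then show ?thesis unfolding Guk using t(1)[of k] by (simp add: pos_divide_le_eq mult.commute)
    qed
    then show ?thesis by (intro LIMSEQ_le[OF Gu Blim]) blast
  qed
  have eqn: "\<bar>G x p i \<bullet> u\<bar> \<le> B / ?c" if i: "i \<in> supp \<mu>" for i
  proof -
    have "\<bar>G x p i \<bullet> ?u k\<bar> \<le> B / ?c + B * t k" for k
    proof -
      have "\<phi> i (X (r k), P (r k)) = 0" "i \<in> active_set \<phi> x p"
        using M(1)[of "r k"] s(1)[of k] s(2)[of k] i by (auto simp: kkt_def active_set_def)
      from active_gradient_bound(2)[OF xc X(3) pc X(4) this(2,1)]
      have "\<bar>G x p i \<bullet> (X (r k) - x)\<bar> \<le> t k * (B / ?c + B * t k)" using gap[of k] by (simp add: t_def)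
      then show ?thesis unfolding Guk abs_divide using t(1)[of k] by (simp add: pos_divide_le_eq mult.commute)
    qed
    then show ?thesis by (intro LIMSEQ_le[OF tendsto_rabs[OF Gu] Blim]) blast
  qed
  have quad: "(DL x p \<mu> *v u) \<bullet> u \<le> C2 / ?c"
  proof -
    let ?q = "\<lambda>k. ((L (X (r k)) p \<mu> - L x p \<mu>) /\<^sub>R t k) \<bullet> ?u k"
    have le: "?q k \<le> C2 / ?c + C1 * B * t k" for k
    proof -
      have vv: "L (X (r k)) (P (r k)) (M (r k)) = L x p \<mu>" using M(2) k(2) by simp
      have vin: "L (X (r k)) (P (r k)) (M (r k)) \<in> cball vb \<rho>" using v k(2) vv by simp
      have "Lf + B * (\<Sum>i\<in>UNIV. M (r k) $ i) \<le> K"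
        using multiplier_bound[OF X(3,4) M(1) vin] B by (simp add: K_def)
      then have "(Lf + B * (\<Sum>i\<in>UNIV. M (r k) $ i)) * norm (P (r k) - p) * t k \<le> K * (t k / ?c) * t k"
        using dp[of k] t(1)[of k] const_nonneg(1) c by (intro mult_mono) auto
      moreover have "(\<Sum>i\<in>UNIV. \<bar>M (r k) $ i - \<mu> $ i\<bar>) * (B * norm (P (r k) - p) + B * (t k)\<^sup>2)
          \<le> (C1 * t k) * (t k * (B / ?c + B * t k))"
      proof (intro mult_mono gap)
        show "(\<Sum>i\<in>UNIV. \<bar>M (r k) $ i - \<mu> $ i\<bar>) \<le> C1 * t k"
          unfolding t_def using v k(2) dp'[of k]
          by (intro multiplier_difference_bound[OF xc X(3) pc X(4) M(1) vv _ s(1) M(3)]) (auto simp: t_def)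
      qed (use B t(1)[of k] const_nonneg in auto)
      moreover have "(L (X (r k)) p \<mu> - L x p \<mu>) \<bullet> (X (r k) - x) \<le>
          (Lf + B * (\<Sum>i\<in>UNIV. M (r k) $ i)) * norm (P (r k) - p) * t k
          + (\<Sum>i\<in>UNIV. \<bar>M (r k) $ i - \<mu> $ i\<bar>) * (B * norm (P (r k) - p) + B * (t k)\<^sup>2)"
        using second_order_expansion[OF xc X(3)[of "r k"] pc X(4)[of "r k"] k(1) M(1)[of "r k"] s(1)[of k] s(2)[of k]]
        unfolding vv t_def by simp
      ultimately have "(L (X (r k)) p \<mu> - L x p \<mu>) \<bullet> (X (r k) - x)
          \<le> K * (t k / ?c) * t k + (C1 * t k) * (t k * (B / ?c + B * t k))" by linarith
      also have "\<dots> = (C2 / ?c + C1 * B * t k) * (t k)\<^sup>2"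
        by (simp add: C2_def power2_eq_square add_divide_distrib algebra_simps)
      finally show ?thesis
        unfolding inner_scaleR_quotient using t(1)[of k] by (simp add: pos_divide_le_eq)
    qed
    have q: "?q \<longlonglongrightarrow> (DL x p \<mu> *v u) \<bullet> u"
      by (intro tendsto_inner u' has_derivative_along_sequence[OF Lagr_has_derivative[OF xc pc] t u'])
    have e: "(\<lambda>k. C2 / ?c + C1 * B * t k) \<longlonglongrightarrow> C2 / ?c"
      using tendsto_add[OF tendsto_const[of "C2 / ?c"] tendsto_mult[OF tendsto_const[of "C1 * B"] t(2)]] by simp
    show ?thesis by (rule LIMSEQ_le[OF q e]) (use le in blast)
  qed
  have actx: "active_set \<phi> x p \<subseteq> active_set \<phi> xb pb" by (rule active_sub[OF xc pc])
  obtain u1 where u1: "\<And>i. i \<in> supp \<mu> \<Longrightarrow> G x p i \<bullet> u1 = 0" "\<And>i. i \<in> active_set \<phi> x p \<Longrightarrow> G x p i \<bullet> u1 \<le> 0"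
    and dist: "norm (u - u1) \<le> C3 / ?c"
  proof (rule hoffman_bound[of \<gamma> "active_set \<phi> x p" "G x p" "supp \<mu>" u "B / ?c"])
    show "\<gamma> * norm \<nu> \<le> norm (comb (G x p) \<nu>)"
      if "supp \<nu> \<subseteq> active_set \<phi> x p" "indep_family (G x p) (supp \<nu>)" for \<nu>
      using that actx by (intro lower xc pc) auto
    show "supp \<mu> \<subseteq> active_set \<phi> x p" using k(1) by (simp add: kkt_def)
    show "0 \<le> B / ?c" using B c by simp
    fix u' assume *: "\<And>i. i \<in> supp \<mu> \<Longrightarrow> G x p i \<bullet> u' = 0" "\<And>i. i \<in> active_set \<phi> x p \<Longrightarrow> G x p i \<bullet> u' \<le> 0"
      "norm (u - u') \<le> real CARD('m) * (B / ?c) / \<gamma>"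
    show thesis by (rule that[of u']) (use * in \<open>auto simp: C3_def mult.commute\<close>)
  qed (use gamma eqn ineq in auto)
  let ?A = "DL x p \<mu>"
  have bnd: "norm (?A *v z) \<le> K * norm z" for z
  proof (rule derivative_bound_if_lipschitz[OF Lagr_has_derivative[OF xc pc]])
    show "\<rho> - dist xb x > 0" using x by simp
    fix y assume "norm (y - x) < \<rho> - dist xb x"
    then have yc: "y \<in> cball xb \<rho>"
      using dist_triangle[of xb y x] by (simp add: dist_norm norm_minus_commute)
    have "norm (L y p \<mu> - L x p \<mu>) \<le> (Lf + B * (\<Sum>i\<in>UNIV. \<mu> $ i)) * (norm (y - x) + norm (p - p))"
      using k(1) by (intro Lagr_lipschitz yc xc pc) (simp add: kkt_def)
    also have "\<dots> \<le> K * (norm (y - x) + norm (p - p))"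
      using multiplier_bound[OF xc pc k(1)] k(2) v B by (intro mult_right_mono) (auto simp: K_def)
    finally show "norm (L y p \<mu> - L x p \<mu>) \<le> K * norm (y - x)" by simp
  qed
  have half: "C3 / ?c \<le> 1 / 2" using calm_const_ge(2) c by (simp add: pos_divide_le_eq)
  have n1: "norm u1 \<ge> 1 / 2" "norm u1 \<le> 3 / 2"
  proof -
    have "\<bar>norm u - norm u1\<bar> \<le> 1 / 2" using norm_triangle_ineq3[of u u1] dist half by linarith
    then show "norm u1 \<ge> 1 / 2" "norm u1 \<le> 3 / 2" using u(2) by linarith+
  qed
  have "l * (norm u1)\<^sup>2 \<le> (?A *v u1) \<bullet> u1"
    using v k u1 by (intro soc xc pc) auto
  also have "(?A *v u1) \<bullet> u1 = (?A *v u) \<bullet> u + (?A *v (u1 - u)) \<bullet> u1 + (?A *v u) \<bullet> (u1 - u)"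
    by (simp add: matrix_vector_mult_diff_distrib inner_diff_left inner_diff_right)
  also have "(?A *v (u1 - u)) \<bullet> u1 \<le> (K * (C3 / ?c)) * (3 / 2)"
  proof -
    have "(?A *v (u1 - u)) \<bullet> u1 \<le> norm (?A *v (u1 - u)) * norm u1" by (rule norm_cauchy_schwarz)
    also have "\<dots> \<le> (K * norm (u1 - u)) * (3 / 2)"
      using bnd n1 const_nonneg(1) by (intro mult_mono) auto
    also have "\<dots> \<le> (K * (C3 / ?c)) * (3 / 2)"
      using dist const_nonneg(1) by (intro mult_right_mono mult_left_mono) (auto simp: norm_minus_commute)
    finally show ?thesis .
  qed
  also have "(?A *v u) \<bullet> (u1 - u) \<le> K * (C3 / ?c)"
  proof -
    have "(?A *v u) \<bullet> (u1 - u) \<le> norm (?A *v u) * norm (u1 - u)" by (rule norm_cauchy_schwarz)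
    also have "\<dots> \<le> K * (C3 / ?c)"
      using bnd[of u] u(2) dist const_nonneg by (intro mult_mono) (auto simp: norm_minus_commute)
    finally show ?thesis .
  qed
  finally have "l * (norm u1)\<^sup>2 \<le> C2 / ?c + (K * (C3 / ?c)) * (3 / 2) + K * (C3 / ?c)" using quad by linarith
  moreover have "l * (1 / 4) \<le> l * (norm u1)\<^sup>2"
    using power_mono[OF n1(1), of 2] l by (intro mult_left_mono) (auto simp: power2_eq_square)
  moreover have "C2 / ?c + (K * (C3 / ?c)) * (3 / 2) + K * (C3 / ?c) \<le> (C2 + 3 * K * C3) / ?c"
  proof -
    have "0 \<le> K * (C3 / ?c)" using const_nonneg c by simp
    moreover have "(C2 + 3 * K * C3) / ?c = C2 / ?c + 3 * (K * (C3 / ?c))" by (simp add: add_divide_distrib mult.assoc)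
    moreover have "a + w * (3 / 2) + w \<le> a + 3 * w" if "0 \<le> w" for a w :: real using that by simp
    ultimately show ?thesis by (simp only:)
  qed
  moreover have "(C2 + 3 * K * C3) / ?c < l / 4"
    using calm_const_ge(3) c by (simp add: pos_divide_less_eq)
  ultimately show False by linarith
qed

text \<open>The increment of the localization is split into a change of \<open>v\<close> with \<open>p\<close> fixed and a change of \<open>p\<close> with \<open>v\<close> fixed.
Strong monotonicity makes \<open>\<parallel>\<Delta>v - 2 \<kappa> \<Delta>x\<parallel> \<le> \<parallel>\<Delta>v\<parallel>\<close> for the first part, and the second part is Lipschitz.\<close>

lemma fully_stable: "lipschitzian_fully_stable (sol_map f \<phi>) xb vb pb"
proof -
  define \<kappa> where "\<kappa> = l / 2"
  have \<kappa>: "0 < \<kappa>" "\<kappa> < l" using l by (auto simp: \<kappa>_def)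
  obtain r c \<delta> where rcd: "0 < r" "r < \<rho>" "0 < c" "c \<le> \<rho>" "0 < \<delta>" "\<delta> \<le> \<rho>"
    and ex: "\<And>p v. p \<in> cball pb \<delta> \<Longrightarrow> v \<in> cball vb c \<Longrightarrow> \<exists>x\<in>cball xb r. \<exists>\<mu>. kkt \<phi> x p \<mu> \<and> v = L x p \<mu>"
    and mono: "\<And>p x y \<mu> \<nu>. p \<in> cball pb \<delta> \<Longrightarrow> x \<in> cball xb r \<Longrightarrow> y \<in> cball xb r \<Longrightarrow> kkt \<phi> x p \<mu> \<Longrightarrow> kkt \<phi> y p \<nu> \<Longrightarrow>
       L x p \<mu> \<in> cball vb c \<Longrightarrow> L y p \<nu> \<in> cball vb c \<Longrightarrow>
       \<kappa> * (norm (x - y))\<^sup>2 \<le> (L x p \<mu> - L y p \<nu>) \<bullet> (x - y)"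
    by (rule strongly_monotone_solutions[OF \<kappa>]) (rule that)
  let ?V = "cball vb c" and ?Q = "cball pb \<delta>" and ?U = "cball xb r"
  define sol where "sol v p x \<longleftrightarrow> x \<in> ?U \<and> (\<exists>\<mu>. kkt \<phi> x p \<mu> \<and> v = L x p \<mu>)" for v p x
  have sub: "x \<in> ball xb \<rho>" "x \<in> cball xb \<rho>" if "x \<in> ?U" for x using that rcd by auto
  have subQ: "p \<in> cball pb \<rho>" if "p \<in> ?Q" for p using that rcd by auto
  have smono: "\<kappa> * (norm (x - y))\<^sup>2 \<le> (v - w) \<bullet> (x - y)"
    if "sol v p x" "sol w p y" "p \<in> ?Q" "v \<in> ?V" "w \<in> ?V" for v w p x y
    using that mono unfolding sol_def by blast
  have uniq: "x = y" if "sol v p x" "sol v p y" "p \<in> ?Q" "v \<in> ?V" for v p x y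
    using smono[OF that(1,2,3,4,4)] \<kappa>(1) by (simp add: mult_le_0_iff)
  define \<theta> where "\<theta> z = (SOME x. sol (fst z) (snd z) x)" for z
  have \<theta>: "sol v p (\<theta> (v, p))" if "p \<in> ?Q" "v \<in> ?V" for v p
  proof -
    have "\<exists>x. sol v p x" using ex[OF that] unfolding sol_def by blast
    from someI_ex[OF this] show ?thesis by (simp add: \<theta>_def)
  qed
  have loc: "single_valued_localization (sol_map f \<phi>) ?V ?Q ?U \<theta>"
    unfolding single_valued_localization_def
  proof (intro conjI)
    show "\<theta> \<in> ?V \<times> ?Q \<rightarrow> ?U" using \<theta> by (auto simp: sol_def)
    have "x = \<theta> (v, p) \<longleftrightarrow> x \<in> sol_map f \<phi> (v, p) \<and> x \<in> ?U" if "v \<in> ?V" "p \<in> ?Q" for v p x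
    proof -
      have "x \<in> sol_map f \<phi> (v, p) \<and> x \<in> ?U \<longleftrightarrow> sol v p x"
        using sol_map_iff_kkt[OF sub(1) subQ[OF that(2)], of x f v] unfolding sol_def by blast
      then show ?thesis using \<theta>[OF that(2,1)] uniq that by blast
    qed
    then show "{(z, x). z \<in> ?V \<times> ?Q \<and> x = \<theta> z} = {(z, x). x \<in> sol_map f \<phi> z} \<inter> (?V \<times> ?Q) \<times> ?U"
      by (intro set_eqI) (clarsimp, blast)
  qed
  have plip: "norm (\<theta> (v, p1) - \<theta> (v, p2)) \<le> calm_const * norm (p1 - p2)"
    if v: "v \<in> ?V" and p1: "p1 \<in> ?Q" and p2: "p2 \<in> ?Q" for v p1 p2
  proof -
    define P where "P t = p2 + t *\<^sub>R (p1 - p2)" for t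
    have PQ: "P t \<in> ?Q" if "0 \<le> t" "t \<le> 1" for t
    proof -
      have "P t = (1 - t) *\<^sub>R p2 + t *\<^sub>R p1" by (simp add: P_def algebra_simps)
      then show ?thesis using convexD_alt[OF convex_cball p2 p1] that by simp
    qed
    have Pdiff: "norm (P s - P t) = \<bar>s - t\<bar> * norm (p1 - p2)" for s t
    proof -
      have "P s - P t = (s - t) *\<^sub>R (p1 - p2)" by (simp add: P_def algebra_simps)
      then show ?thesis by simp
    qed
    have "norm (\<theta> (v, P 1) - \<theta> (v, P 0)) \<le> calm_const * norm (p1 - p2)"
    proof (rule lipschitz_along_path[of "\<lambda>t. \<theta> (v, P t)"], rule ccontr)
      fix t :: real assume t: "0 \<le> t" "t \<le> 1"
      assume no: "\<not> (\<exists>e>0. \<forall>s. 0 \<le> s \<and> s \<le> 1 \<and> \<bar>s - t\<bar> < e \<longrightarrow>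
          norm (\<theta> (v, P s) - \<theta> (v, P t)) \<le> calm_const * norm (p1 - p2) * \<bar>s - t\<bar>)"
      have "\<exists>s. 0 \<le> s \<and> s \<le> 1 \<and> \<bar>s - t\<bar> < inverse (real (Suc k)) \<and>
          calm_const * norm (p1 - p2) * \<bar>s - t\<bar> < norm (\<theta> (v, P s) - \<theta> (v, P t))" for k
      proof -
        have "inverse (real (Suc k)) > 0" by simp
        then show ?thesis using no not_less by blast
      qed
      then obtain S where S: "\<And>k. 0 \<le> S k" "\<And>k. S k \<le> 1" "\<And>k. \<bar>S k - t\<bar> < inverse (real (Suc k))"
        "\<And>k. calm_const * norm (p1 - p2) * \<bar>S k - t\<bar> < norm (\<theta> (v, P (S k)) - \<theta> (v, P t))" by metis
      have "S \<longlonglongrightarrow> t"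
        by (rule LIM_zero_cancel, rule Lim_null_comparison[OF _ LIMSEQ_inverse_real_of_nat])
           (intro always_eventually allI, unfold real_norm_def, intro less_imp_le S(3))
      then have Plim: "(\<lambda>k. P (S k)) \<longlonglongrightarrow> P t" unfolding P_def by (intro tendsto_intros)
      have sk: "sol v (P (S k)) (\<theta> (v, P (S k)))" for k by (intro \<theta> PQ v S)
      have "\<forall>k. \<theta> (v, P (S k)) \<in> ?U" using sk by (simp add: sol_def)
      then obtain x q where q: "x \<in> ?U" "strict_mono q" "((\<lambda>k. \<theta> (v, P (S k))) \<circ> q) \<longlonglongrightarrow> x"
        by (rule seq_compactE[OF compact_imp_seq_compact[OF compact_cball[of xb r]]])
      have Xlim: "(\<lambda>k. \<theta> (v, P (S (q k)))) \<longlonglongrightarrow> x" using q(3) by (simp add: o_def)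
      have Plim': "(\<lambda>k. P (S (q k))) \<longlonglongrightarrow> P t" using LIMSEQ_subseq_LIMSEQ[OF Plim q(2)] by (simp add: o_def)
      have inX: "\<theta> (v, P (S (q k))) \<in> cball xb \<rho>" and inP: "P (S (q k)) \<in> cball pb \<rho>" for k
        using sk[of "q k"] sub(2) subQ[OF PQ[OF S(1,2)]] by (auto simp: sol_def)
      have ex': "\<exists>\<mu>. kkt \<phi> (\<theta> (v, P (S (q k)))) (P (S (q k))) \<mu> \<and> v = L (\<theta> (v, P (S (q k)))) (P (S (q k))) \<mu>" for k
        using sk[of "q k"] by (simp add: sol_def)
      then obtain M where M: "\<And>k. kkt \<phi> (\<theta> (v, P (S (q k)))) (P (S (q k))) (M k)"
        "\<And>k. v = L (\<theta> (v, P (S (q k)))) (P (S (q k))) (M k)" by metis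
      have "(\<lambda>k. L (\<theta> (v, P (S (q k)))) (P (S (q k))) (M k)) \<longlonglongrightarrow> v" using M(2) by simp
      then obtain \<mu> where "kkt \<phi> x (P t) \<mu>" "L x (P t) \<mu> = v"
        using Lagr_kkt_limit[OF Xlim Plim' inX inP M(1)] by blast
      then have "sol v (P t) x" using q(1) by (auto simp: sol_def)
      then have xt: "x = \<theta> (v, P t)" using uniq \<theta> PQ[OF t] v by blast
      show False
      proof (rule calm_in_parameter[OF Xlim Plim' inX inP])
        show "x \<in> ball xb \<rho>" using q(1) sub(1) by blast
        show "v \<in> cball vb \<rho>" using v rcd(4) by auto
        show "calm_const * norm (P (S (q k)) - P t) < norm (\<theta> (v, P (S (q k))) - x)" for k
          using S(4)[of "q k"] unfolding Pdiff xt by (simp add: mult_ac)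
      qed (rule ex')
    qed
    then show ?thesis by (simp add: P_def)
  qed
  have main: "norm ((v1 - v2) - (2 * \<kappa>) *\<^sub>R (\<theta> (v1, p1) - \<theta> (v2, p2))) \<le> norm (v1 - v2) + (2 * \<kappa> * calm_const) * norm (p1 - p2)"
    if v: "v1 \<in> ?V" "v2 \<in> ?V" and p: "p1 \<in> ?Q" "p2 \<in> ?Q" for v1 v2 p1 p2
  proof -
    let ?a = "v1 - v2" and ?b = "\<theta> (v1, p1) - \<theta> (v2, p1)" and ?e = "\<theta> (v2, p1) - \<theta> (v2, p2)"
    have "\<kappa> * (norm ?b)\<^sup>2 \<le> ?a \<bullet> ?b" using \<theta> v p by (intro smono) auto
    then have "4 * \<kappa> * (\<kappa> * (norm ?b)\<^sup>2) \<le> 4 * \<kappa> * (?a \<bullet> ?b)" using \<kappa> by (intro mult_left_mono) auto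
    moreover have "(norm (?a - (2 * \<kappa>) *\<^sub>R ?b))\<^sup>2 = (norm ?a)\<^sup>2 - 4 * \<kappa> * (?a \<bullet> ?b) + 4 * \<kappa> * (\<kappa> * (norm ?b)\<^sup>2)"
    proof -
      have "(norm (a - (2 * k) *\<^sub>R b))\<^sup>2 = (norm a)\<^sup>2 - 4 * k * (a \<bullet> b) + 4 * k * (k * (norm b)\<^sup>2)" for a b :: "real^'n" and k
        by (simp add: power2_norm_eq_inner inner_diff_left inner_diff_right inner_commute algebra_simps)
      then show ?thesis .
    qed
    ultimately have "(norm (?a - (2 * \<kappa>) *\<^sub>R ?b))\<^sup>2 \<le> (norm ?a)\<^sup>2" by linarith
    then have 1: "norm (?a - (2 * \<kappa>) *\<^sub>R ?b) \<le> norm ?a" by (rule power2_le_imp_le) simp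
    have 2: "norm ((2 * \<kappa>) *\<^sub>R ?e) \<le> (2 * \<kappa> * calm_const) * norm (p1 - p2)"
      using mult_left_mono[OF plip[OF v(2) p], of "2 * \<kappa>"] \<kappa> by simp
    have "?a - (2 * \<kappa>) *\<^sub>R (\<theta> (v1, p1) - \<theta> (v2, p2)) = (?a - (2 * \<kappa>) *\<^sub>R ?b) - (2 * \<kappa>) *\<^sub>R ?e"
      by (simp add: algebra_simps)
    then have "norm (?a - (2 * \<kappa>) *\<^sub>R (\<theta> (v1, p1) - \<theta> (v2, p2))) \<le> norm (?a - (2 * \<kappa>) *\<^sub>R ?b) + norm ((2 * \<kappa>) *\<^sub>R ?e)"
      by (simp only: norm_triangle_ineq4)
    then show ?thesis using 1 2 by linarith
  qed
  have "2 * \<kappa> * calm_const > 0" using \<kappa> calm_const_ge(1) by simp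
  then show ?thesis
    unfolding lipschitzian_fully_stable_def using loc rcd(1,3,5) \<kappa>(1) main
    by (intro exI[of _ ?V] exI[of _ ?Q] exI[of _ ?U] exI[of _ \<theta>] conjI exI[of _ \<kappa>] exI[of _ "2 * \<kappa> * calm_const"])
       (auto simp: interior_cball)
qed

end

section \<open>Existence of good neighborhoods\<close>

lemma eventually_nhds_Pair_cball:
  fixes a :: "'a::metric_space" and b :: "'b::metric_space"
  assumes "eventually Q (nhds (a, b))"
  obtains \<rho> where "\<rho> > 0" "\<And>x p. x \<in> cball a \<rho> \<Longrightarrow> p \<in> cball b \<rho> \<Longrightarrow> Q (x, p)"
proof -
  obtain e where e: "e > 0" "\<And>z. dist z (a, b) < e \<Longrightarrow> Q z"
    using assms by (auto simp: eventually_nhds_metric)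
  show thesis
  proof (rule that[of "e / 3"])
    fix x p assume xp: "x \<in> cball a (e / 3)" "p \<in> cball b (e / 3)"
    have "dist (x, p) (a, b) \<le> dist x a + dist p b"
      unfolding dist_Pair_Pair by (rule sqrt_sum_squares_le_sum) auto
    also have "\<dots> < e" using xp e(1) by (simp add: dist_commute)
    finally show "Q (x, p)" by (rule e(2))
  qed (use e in simp)
qed

text \<open>The estimates required of a single constraint in \<open>constraint_nbhd\<close>, on balls of radius \<open>\<rho>\<close> with constant \<open>B\<close>. They
persist for smaller radii and larger constants, so finitely many constraints can share them.\<close>

definition gradient_bounds :: "((real^'n) \<times> (real^'d) \<Rightarrow> real) \<Rightarrow> real^'n \<Rightarrow> real^'d \<Rightarrow> real \<Rightarrow> real \<Rightarrow> bool" where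
  "gradient_bounds g xb pb \<rho> B \<longleftrightarrow> (\<forall>x\<in>cball xb \<rho>. \<forall>p\<in>cball pb \<rho>.
     ((\<lambda>y. g (y, p)) has_derivative (\<lambda>u. grad_x g x p \<bullet> u)) (at x) \<and>
     norm (grad_x g x p) \<le> B \<and>
     (\<lambda>y. grad_x g y p) differentiable (at x) \<and>
     (\<forall>y\<in>cball xb \<rho>. \<bar>g (y, p) - g (x, p) - grad_x g x p \<bullet> (y - x)\<bar> \<le> B * (norm (y - x))\<^sup>2) \<and>
     (\<forall>q\<in>cball pb \<rho>. \<bar>g (x, p) - g (x, q)\<bar> \<le> B * norm (p - q)) \<and>
     (\<forall>y\<in>cball xb \<rho>. \<forall>q\<in>cball pb \<rho>. norm (grad_x g x p - grad_x g y q) \<le> B * (norm (x - y) + norm (p - q))))"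

lemma gradient_bounds_mono:
  assumes "gradient_bounds g xb pb \<rho> B" "\<rho>' \<le> \<rho>" "B \<le> B'"
  shows "gradient_bounds g xb pb \<rho>' B'"
proof -
  have sub: "cball xb \<rho>' \<subseteq> cball xb \<rho>" "cball pb \<rho>' \<subseteq> cball pb \<rho>" using assms(2) by auto
  have grow: "B * c \<le> B' * c" if "0 \<le> c" for c using assms(3) that by (rule mult_right_mono)
  show ?thesis
    unfolding gradient_bounds_def
  proof (intro ballI conjI)
    fix x p assume xp: "x \<in> cball xb \<rho>'" "p \<in> cball pb \<rho>'"
    then have in': "x \<in> cball xb \<rho>" "p \<in> cball pb \<rho>" using sub by blast+
    note * = assms(1)[unfolded gradient_bounds_def, rule_format, OF in']
    show "((\<lambda>y. g (y, p)) has_derivative (\<lambda>u. grad_x g x p \<bullet> u)) (at x)"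
      "(\<lambda>y. grad_x g y p) differentiable (at x)" using * by blast+
    show "norm (grad_x g x p) \<le> B'" using * assms(3) by linarith
    fix y assume "y \<in> cball xb \<rho>'"
    then have y: "y \<in> cball xb \<rho>" using sub by blast
    show "\<bar>g (y, p) - g (x, p) - grad_x g x p \<bullet> (y - x)\<bar> \<le> B' * (norm (y - x))\<^sup>2"
    proof -
      have "\<bar>g (y, p) - g (x, p) - grad_x g x p \<bullet> (y - x)\<bar> \<le> B * (norm (y - x))\<^sup>2" using * y by blast
      also have "\<dots> \<le> B' * (norm (y - x))\<^sup>2" by (rule grow) simp
      finally show ?thesis .
    qed
    fix q assume "q \<in> cball pb \<rho>'"
    then have q: "q \<in> cball pb \<rho>" using sub by blast
    show "norm (grad_x g x p - grad_x g y q) \<le> B' * (norm (x - y) + norm (p - q))"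
    proof -
      have "norm (grad_x g x p - grad_x g y q) \<le> B * (norm (x - y) + norm (p - q))" using * y q by blast
      also have "\<dots> \<le> B' * (norm (x - y) + norm (p - q))" by (rule grow) simp
      finally show ?thesis .
    qed
  next
    fix x p q assume "x \<in> cball xb \<rho>'" "p \<in> cball pb \<rho>'" "q \<in> cball pb \<rho>'"
    then have in': "x \<in> cball xb \<rho>" "p \<in> cball pb \<rho>" "q \<in> cball pb \<rho>" using sub by blast+
    then have "\<bar>g (x, p) - g (x, q)\<bar> \<le> B * norm (p - q)"
      using assms(1) unfolding gradient_bounds_def by blast
    then show "\<bar>g (x, p) - g (x, q)\<bar> \<le> B' * norm (p - q)" using grow[of "norm (p - q)"] by simp
  qed
qed

text \<open>The vector that represents the partial derivative with respect to the first argument. It depends linearly on the full derivative,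
so it inherits the Lipschitz continuity and the differentiability of the latter.\<close>

definition riesz_fst :: "(('a::euclidean_space \<times> 'b::euclidean_space) \<Rightarrow>\<^sub>L real) \<Rightarrow> 'a" where
  "riesz_fst T = (\<Sum>b\<in>Basis. blinfun_apply T (b, 0) *\<^sub>R b)"

lemma riesz_fst_inner: "riesz_fst T \<bullet> u = blinfun_apply T (u, 0)"
proof -
  have "blinfun_apply T (u, 0) = blinfun_apply T (\<Sum>b\<in>Basis. (u \<bullet> b) *\<^sub>R (b, 0))"
    by (simp add: sum_prod euclidean_representation)
  also have "\<dots> = (\<Sum>b\<in>Basis. (u \<bullet> b) * blinfun_apply T (b, 0))"
    by (simp only: blinfun.sum_right blinfun.scaleR_right real_scaleR_def)
  finally show ?thesis by (simp add: riesz_fst_def inner_sum_left) (simp add: inner_commute mult.commute)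
qed

lemma norm_riesz_fst_le: "norm (riesz_fst T) \<le> norm T"
proof (cases "riesz_fst T = 0")
  case False
  have "norm (riesz_fst T) * norm (riesz_fst T) = blinfun_apply T (riesz_fst T, 0)"
    by (simp add: riesz_fst_inner[symmetric] power2_norm_eq_inner[symmetric] power2_eq_square)
  also have "\<dots> \<le> norm T * norm (riesz_fst T)"
    using norm_blinfun[of T "(riesz_fst T, 0)"] by (simp add: norm_Pair)
  finally show ?thesis using False by simp
qed simp

lemma bounded_linear_riesz_fst: "bounded_linear riesz_fst"
proof (rule bounded_linear_intro[of _ 1])
  show "riesz_fst (S + T) = riesz_fst S + riesz_fst T" for S T
    by (simp add: riesz_fst_def blinfun.add_left scaleR_add_left sum.distrib)
  show "riesz_fst (c *\<^sub>R T) = c *\<^sub>R riesz_fst T" for c T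
    by (simp add: riesz_fst_def blinfun.scaleR_left scaleR_sum_right)
qed (use norm_riesz_fst_le in simp)

text \<open>The first and second derivatives are bounded on a compact convex product of balls; the mean value theorem yields the
Lipschitz estimates and its linearized version the Taylor estimate.\<close>

lemma gradient_bounds_if_C2:
  assumes "C2_around g (xb, pb)"
  obtains \<rho> B where "\<rho> > 0" "B > 0" "gradient_bounds g xb pb \<rho> B"
proof -
  obtain W g' g'' where W: "open W" "(xb, pb) \<in> W"
    and g': "\<And>z. z \<in> W \<Longrightarrow> (g has_derivative blinfun_apply (g' z)) (at z)"
    and g'': "\<And>z. z \<in> W \<Longrightarrow> (g' has_derivative blinfun_apply (g'' z)) (at z)"
    and cont: "continuous_on W g''"
    using assms unfolding C2_around_def by blast
  have "eventually (\<lambda>z. z \<in> W) (nhds (xb, pb))" using W by (rule eventually_nhds_in_open)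
  then obtain \<rho> where \<rho>: "\<rho> > 0" "\<And>x p. x \<in> cball xb \<rho> \<Longrightarrow> p \<in> cball pb \<rho> \<Longrightarrow> (x, p) \<in> W"
    using eventually_nhds_Pair_cball by blast
  let ?K = "cball xb \<rho> \<times> cball pb \<rho>"
  have KW: "?K \<subseteq> W" using \<rho>(2) by auto
  have K: "compact ?K" "convex ?K" by (auto intro: compact_Times convex_Times)
  have "continuous_on ?K g'"
    using g'' KW by (meson continuous_at_imp_continuous_on has_derivative_continuous subsetD)
  then have "bounded (g' ` ?K)" using K(1) by (intro compact_imp_bounded compact_continuous_image)
  then obtain M1 where M1: "\<And>z. z \<in> ?K \<Longrightarrow> norm (g' z) \<le> M1" unfolding bounded_iff by blast
  have "bounded (g'' ` ?K)"
    using K(1) by (intro compact_imp_bounded compact_continuous_image continuous_on_subset[OF cont KW])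
  then obtain M2 where M2: "\<And>z. z \<in> ?K \<Longrightarrow> norm (g'' z) \<le> M2" unfolding bounded_iff by blast
  have slice: "((\<lambda>y. (y, p)) has_derivative (\<lambda>u. (u, 0))) (at x)" for x :: "real^'n" and p :: "real^'d"
    by (auto intro!: derivative_eq_intros)
  have dW: "((\<lambda>y. g (y, p)) has_derivative (\<lambda>u. riesz_fst (g' (x, p)) \<bullet> u)) (at x)" if "(x, p) \<in> W" for x p
    using diff_chain_at[OF slice g'[OF that]] by (simp add: o_def riesz_fst_inner)
  have grad: "grad_x g x p = riesz_fst (g' (x, p))" if "(x, p) \<in> W" for x p
    unfolding grad_x_def
  proof (rule the_equality)
    show "GDERIV (\<lambda>y. g (y, p)) x :> riesz_fst (g' (x, p))"
      unfolding gderiv_def using dW[OF that] by (simp add: inner_commute)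
    fix D assume "GDERIV (\<lambda>y. g (y, p)) x :> D"
    then have "((\<lambda>y. g (y, p)) has_derivative (\<lambda>u. D \<bullet> u)) (at x)"
      unfolding gderiv_def by (simp add: inner_commute)
    from has_derivative_unique[OF this dW[OF that]]
    have "\<forall>u. D \<bullet> u = riesz_fst (g' (x, p)) \<bullet> u" by meson
    then show "D = riesz_fst (g' (x, p))" by (simp add: vector_eq_rdot)
  qed
  have lip': "norm (g' z - g' w) \<le> M2 * norm (z - w)" if "z \<in> ?K" "w \<in> ?K" for z w
  proof (rule differentiable_bound[of ?K g' "\<lambda>z. blinfun_apply (g'' z)"])
    fix z assume z: "z \<in> ?K"
    then have "z \<in> W" using KW by blast
    then show "(g' has_derivative blinfun_apply (g'' z)) (at z within ?K)" by (rule has_derivative_at_withinI[OF g''])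
    show "onorm (blinfun_apply (g'' z)) \<le> M2" using M2[OF z] by (simp add: norm_blinfun.rep_eq)
  qed (use K(2) that in blast)+
  have lip: "norm (g z - g w) \<le> M1 * norm (z - w)" if "z \<in> ?K" "w \<in> ?K" for z w
  proof (rule differentiable_bound[of ?K g "\<lambda>z. blinfun_apply (g' z)"])
    fix z assume z: "z \<in> ?K"
    then have "z \<in> W" using KW by blast
    then show "(g has_derivative blinfun_apply (g' z)) (at z within ?K)" by (rule has_derivative_at_withinI[OF g'])
    show "onorm (blinfun_apply (g' z)) \<le> M1" using M1[OF z] by (simp add: norm_blinfun.rep_eq)
  qed (use K(2) that in blast)+
  have inK: "(xb, pb) \<in> ?K" using \<rho>(1) by auto
  have M0: "0 \<le> M1" "0 \<le> M2" using M1[OF inK] M2[OF inK] norm_ge_zero order_trans by blast+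
  define B where "B = M1 + M2 + 1"
  have grad_lip: "norm (grad_x g x p - grad_x g y q) \<le> M2 * (norm (x - y) + norm (p - q))"
    if "x \<in> cball xb \<rho>" "y \<in> cball xb \<rho>" "p \<in> cball pb \<rho>" "q \<in> cball pb \<rho>" for x y p q
  proof -
    have "norm (grad_x g x p - grad_x g y q) = norm (riesz_fst (g' (x, p) - g' (y, q)))"
      using that \<rho>(2) by (simp add: grad linear_diff[OF bounded_linear.linear[OF bounded_linear_riesz_fst]])
    also have "\<dots> \<le> norm (g' (x, p) - g' (y, q))" by (rule norm_riesz_fst_le)
    also have "\<dots> \<le> M2 * norm ((x, p) - (y, q))" using that by (intro lip') auto
    also have "\<dots> \<le> M2 * (norm (x - y) + norm (p - q))"
      using M0 norm_Pair_le[of "x - y" "p - q"] by (intro mult_left_mono) auto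
    finally show ?thesis .
  qed
  have der: "((\<lambda>y. g (y, p)) has_derivative (\<lambda>u. grad_x g x p \<bullet> u)) (at x)"
    if "x \<in> cball xb \<rho>" "p \<in> cball pb \<rho>" for x p
    using dW[OF \<rho>(2)[OF that]] grad[OF \<rho>(2)[OF that]] by simp
  have "gradient_bounds g xb pb \<rho> B"
    unfolding gradient_bounds_def
  proof (intro ballI conjI)
    fix x p assume x: "x \<in> cball xb \<rho>" and p: "p \<in> cball pb \<rho>"
    note xp = \<rho>(2)[OF x p]
    show "((\<lambda>y. g (y, p)) has_derivative (\<lambda>u. grad_x g x p \<bullet> u)) (at x)" by (rule der[OF x p])
    show "norm (grad_x g x p) \<le> B"
      using norm_riesz_fst_le[of "g' (x, p)"] M1[of "(x, p)"] x p M0 by (simp add: grad[OF xp] B_def)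
    have "((\<lambda>y. riesz_fst (g' (y, p))) has_derivative (\<lambda>u. riesz_fst (blinfun_apply (g'' (x, p)) (u, 0)))) (at x)"
      using bounded_linear.has_derivative[OF bounded_linear_riesz_fst diff_chain_at[OF slice g''[OF xp]]]
      by (simp add: o_def)
    moreover have "open {y. (y, p) \<in> W}"
      using open_vimage[OF W(1), of "\<lambda>y. (y, p)"] by (simp add: vimage_def continuous_on_Pair)
    ultimately have "((\<lambda>y. grad_x g y p) has_derivative (\<lambda>u. riesz_fst (blinfun_apply (g'' (x, p)) (u, 0)))) (at x)"
      by (rule has_derivative_transform_within_open[where s = "{y. (y, p) \<in> W}"]) (auto simp: xp grad)
    then show "(\<lambda>y. grad_x g y p) differentiable (at x)" by (rule differentiableI)
    fix y assume y: "y \<in> cball xb \<rho>"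
    have seg: "closed_segment x y \<subseteq> cball xb \<rho>" using x y by (simp add: closed_segment_subset)
    have "norm (g (y, p) - g (x, p) - (\<lambda>u. grad_x g x p \<bullet> u) (y - x)) \<le> norm (y - x) * (M2 * norm (y - x))"
    proof (rule differentiable_bound_linearization[where S = "closed_segment x y" and f' = "\<lambda>z u. grad_x g z p \<bullet> u" and f = "\<lambda>y. g (y, p)"])
      show "x + t *\<^sub>R (y - x) \<in> closed_segment x y" if "t \<in> {0..1}" for t
        using that by (auto simp: closed_segment_def algebra_simps intro!: exI[of _ t])
      fix z assume z: "z \<in> closed_segment x y"
      then show "((\<lambda>y. g (y, p)) has_derivative (\<lambda>u. grad_x g z p \<bullet> u)) (at z within closed_segment x y)"
        by (intro has_derivative_at_withinI[OF der] p) (use z seg in blast)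
      have "norm (z - x) \<le> norm (y - x)" using segment_bound(1)[OF z] by simp
      have "norm (grad_x g z p - grad_x g x p) \<le> M2 * norm (y - x)"
      proof -
        have "norm (grad_x g z p - grad_x g x p) \<le> M2 * (norm (z - x) + norm (p - p))"
          using z seg x p by (intro grad_lip) auto
        also have "\<dots> \<le> M2 * norm (y - x)" using M0 \<open>norm (z - x) \<le> norm (y - x)\<close> by (simp add: mult_left_mono)
        finally show ?thesis .
      qed
      moreover have "onorm (\<lambda>u. (grad_x g z p - grad_x g x p) \<bullet> u) \<le> norm (grad_x g z p - grad_x g x p)"
        by (rule onorm_le) (simp add: Cauchy_Schwarz_ineq2)
      ultimately show "onorm ((\<lambda>u. grad_x g z p \<bullet> u) - (\<lambda>u. grad_x g x p \<bullet> u)) \<le> M2 * norm (y - x)"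
        by (simp add: fun_diff_def inner_diff_left)
    qed simp
    also have "\<dots> \<le> B * (norm (y - x))\<^sup>2"
    proof -
      have "M2 * (norm (y - x))\<^sup>2 \<le> B * (norm (y - x))\<^sup>2" using M0 by (intro mult_right_mono) (auto simp: B_def)
      then show ?thesis by (simp add: power2_eq_square mult_ac)
    qed
    finally show "\<bar>g (y, p) - g (x, p) - grad_x g x p \<bullet> (y - x)\<bar> \<le> B * (norm (y - x))\<^sup>2" by simp
    fix q assume q: "q \<in> cball pb \<rho>"
    have "M2 * (norm (x - y) + norm (p - q)) \<le> B * (norm (x - y) + norm (p - q))"
      using M0 by (intro mult_right_mono) (auto simp: B_def)
    then show "norm (grad_x g x p - grad_x g y q) \<le> B * (norm (x - y) + norm (p - q))"
      using grad_lip[OF x y p q] by linarith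
  next
    fix x p q assume xpq: "x \<in> cball xb \<rho>" "p \<in> cball pb \<rho>" "q \<in> cball pb \<rho>"
    then have "norm (g (x, p) - g (x, q)) \<le> M1 * norm ((x, p) - (x, q))" by (intro lip) auto
    also have "\<dots> = M1 * norm (p - q)" by (simp add: norm_Pair)
    also have "\<dots> \<le> B * norm (p - q)" using M0 by (intro mult_right_mono) (auto simp: B_def)
    finally show "\<bar>g (x, p) - g (x, q)\<bar> \<le> B * norm (p - q)" by simp
  qed
  then show thesis using that[OF \<rho>(1), of B] M0 by (simp add: B_def)
qed

text \<open>The radius keeps the gradients so close to the reference ones that half of the descent rate remains, and the values of the
inactive constraints so close to the reference values that they remain nonzero.\<close>

lemma constraint_nbhd_exists:
  fixes \<phi> :: "'m::finite \<Rightarrow> (real^'n) \<times> (real^'d) \<Rightarrow> real"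
  assumes C2: "\<And>i. C2_around (\<phi> i) (xb, pb)" and mfcq: "partial_MFCQ \<phi> xb pb"
  obtains \<rho>0 B \<tau> d where "\<rho>0 > 0" "\<And>\<rho>. 0 < \<rho> \<Longrightarrow> \<rho> \<le> \<rho>0 \<Longrightarrow> constraint_nbhd \<phi> xb pb \<rho> B \<tau> d"
proof -
  have "\<forall>i. \<exists>\<rho> B. \<rho> > 0 \<and> B > 0 \<and> gradient_bounds (\<phi> i) xb pb \<rho> B"
    using gradient_bounds_if_C2[OF C2] by metis
  then obtain R BB where RB: "\<And>i. R i > 0" "\<And>i. BB i > 0" "\<And>i. gradient_bounds (\<phi> i) xb pb (R i) (BB i)"
    by metis
  define \<rho>1 where "\<rho>1 = Min (range R)"
  define B where "B = Max (range BB)"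
  have \<rho>1: "\<rho>1 > 0" using RB(1) by (simp add: \<rho>1_def)
  have B: "B > 0" using RB(2) by (simp add: B_def Max_gr_iff)
  have gb1: "gradient_bounds (\<phi> i) xb pb \<rho>1 B" for i
    using RB(3) by (rule gradient_bounds_mono) (auto simp: \<rho>1_def B_def)
  obtain d where d: "\<And>i. i \<in> active_set \<phi> xb pb \<Longrightarrow> grad_x (\<phi> i) xb pb \<bullet> d < 0"
    using mfcq unfolding partial_MFCQ_def by blast
  define \<tau> where "\<tau> = Min (range (\<lambda>i. if i \<in> active_set \<phi> xb pb then - (grad_x (\<phi> i) xb pb \<bullet> d) / 2 else 1))"
  have \<tau>: "\<tau> > 0" using d by (auto simp: \<tau>_def)
  have \<tau>i: "grad_x (\<phi> i) xb pb \<bullet> d \<le> - 2 * \<tau>" if "i \<in> active_set \<phi> xb pb" for i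
  proof -
    have "\<tau> \<le> (if i \<in> active_set \<phi> xb pb then - (grad_x (\<phi> i) xb pb \<bullet> d) / 2 else 1)"
      unfolding \<tau>_def by (rule Min_le) auto
    then show ?thesis using that by simp
  qed
  define s where "s = Min (range (\<lambda>i. if i \<in> active_set \<phi> xb pb then 1 else \<bar>\<phi> i (xb, pb)\<bar>))"
  have s: "s > 0" unfolding s_def by (subst Min_gr_iff) (auto simp: active_set_def)
  have si: "s \<le> \<bar>\<phi> i (xb, pb)\<bar>" if "i \<notin> active_set \<phi> xb pb" for i
  proof -
    have "s \<le> (if i \<in> active_set \<phi> xb pb then 1 else \<bar>\<phi> i (xb, pb)\<bar>)" unfolding s_def by (rule Min_le) auto
    then show ?thesis using that by simp
  qed
  define \<rho>0 where "\<rho>0 = min (min \<rho>1 1) (min (\<tau> / (2 * B * (norm d + 1))) (s / (4 * B)))"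
  have dpos: "2 * B * (norm d + 1) > 0" using B by (simp add: add_nonneg_pos)
  have \<rho>0: "\<rho>0 > 0" using \<rho>1 \<tau> s B dpos by (simp add: \<rho>0_def)
  have nbhd: "constraint_nbhd \<phi> xb pb \<rho> B \<tau> d" if \<rho>: "0 < \<rho>" "\<rho> \<le> \<rho>0" for \<rho>
  proof -
    have small: "\<rho> \<le> \<rho>1" "\<rho> \<le> 1" "\<rho> * (2 * B * (norm d + 1)) \<le> \<tau>" "\<rho> * (4 * B) \<le> s"
    proof -
      have "\<rho> \<le> \<tau> / (2 * B * (norm d + 1))" "\<rho> \<le> s / (4 * B)" using \<rho>(2) by (auto simp: \<rho>0_def)
      then show "\<rho> * (2 * B * (norm d + 1)) \<le> \<tau>" "\<rho> * (4 * B) \<le> s"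
        using dpos B by (simp_all only: pos_le_divide_eq mult_pos_pos zero_less_numeral)
    qed (use \<rho>(2) in \<open>auto simp: \<rho>0_def\<close>)
    have gb: "gradient_bounds (\<phi> i) xb pb \<rho> B" for i using gb1 small(1) by (rule gradient_bounds_mono) simp
    note gbD = gb[unfolded gradient_bounds_def, rule_format]
    have base: "xb \<in> cball xb \<rho>" "pb \<in> cball pb \<rho>" using \<rho>(1) by auto
    show ?thesis
    proof
      fix i x p assume i: "i \<in> active_set \<phi> xb pb" and x: "x \<in> cball xb \<rho>" and p: "p \<in> cball pb \<rho>"
      have "(grad_x (\<phi> i) x p - grad_x (\<phi> i) xb pb) \<bullet> d \<le> norm (grad_x (\<phi> i) x p - grad_x (\<phi> i) xb pb) * norm d"
        by (rule norm_cauchy_schwarz)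
      also have "\<dots> \<le> (B * (\<rho> + \<rho>)) * (norm d + 1)"
      proof (intro mult_mono)
        have "norm (grad_x (\<phi> i) x p - grad_x (\<phi> i) xb pb) \<le> B * (norm (x - xb) + norm (p - pb))"
          using gbD[OF x p] base by blast
        also have "\<dots> \<le> B * (\<rho> + \<rho>)"
          using x p B by (intro mult_left_mono add_mono) (auto simp: dist_norm norm_minus_commute)
        finally show "norm (grad_x (\<phi> i) x p - grad_x (\<phi> i) xb pb) \<le> B * (\<rho> + \<rho>)" .
      qed (use B \<rho> in auto)
      also have "\<dots> \<le> \<tau>" using small(3) by (simp add: algebra_simps)
      finally show "grad_x (\<phi> i) x p \<bullet> d \<le> - \<tau>" using \<tau>i[OF i] by (simp add: inner_diff_left)
    next
      fix x p assume x: "x \<in> cball xb \<rho>" and p: "p \<in> cball pb \<rho>"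
      have "\<phi> i (x, p) \<noteq> 0" if i: "i \<notin> active_set \<phi> xb pb" for i
      proof
        assume z: "\<phi> i (x, p) = 0"
        have n: "norm (x - xb) \<le> \<rho>" "norm (p - pb) \<le> \<rho>"
          using x p by (auto simp: dist_norm norm_minus_commute)
        have "\<bar>\<phi> i (x, p) - \<phi> i (x, pb)\<bar> \<le> B * norm (p - pb)" using gbD[OF x p] base by blast
        moreover have "B * norm (p - pb) \<le> B * \<rho>" using n B by simp
        moreover have "\<bar>\<phi> i (x, pb) - \<phi> i (xb, pb) - grad_x (\<phi> i) xb pb \<bullet> (x - xb)\<bar> \<le> B * (norm (x - xb))\<^sup>2"
          using gbD[OF base] x by blast
        moreover have "B * (norm (x - xb))\<^sup>2 \<le> B * \<rho>"
        proof -
          have "norm (x - xb) * norm (x - xb) \<le> \<rho> * 1" using n \<rho> small(2) by (intro mult_mono) auto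
          then show ?thesis using B by (simp add: power2_eq_square)
        qed
        moreover have "\<bar>grad_x (\<phi> i) xb pb \<bullet> (x - xb)\<bar> \<le> B * \<rho>"
        proof -
          have "\<bar>grad_x (\<phi> i) xb pb \<bullet> (x - xb)\<bar> \<le> norm (grad_x (\<phi> i) xb pb) * norm (x - xb)"
            by (rule Cauchy_Schwarz_ineq2)
          also have "\<dots> \<le> B * \<rho>" using gbD[OF base] n B by (intro mult_mono) auto
          finally show ?thesis .
        qed
        ultimately have "\<bar>\<phi> i (xb, pb)\<bar> \<le> 3 * (B * \<rho>)" using z by linarith
        moreover have "4 * (B * \<rho>) \<le> \<bar>\<phi> i (xb, pb)\<bar>" using small(4) si[OF i] by (simp add: mult_ac)
        moreover have "0 < B * \<rho>" using B \<rho> by simp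
        ultimately show False by linarith
      qed
      then show "active_set \<phi> x p \<subseteq> active_set \<phi> xb pb" by (auto simp: active_set_def)
    qed (use \<rho>(1) B \<tau> gbD in blast)+
  qed
  show thesis using that[OF \<rho>0 nbhd] by blast
qed

text \<open>The Jacobian is bounded near the reference point because it is continuous there, which makes \<open>f\<close> Lipschitz in \<open>x\<close> by the mean value theorem.\<close>

lemma lipschitz_data_nbhd_exists:
  fixes f :: "(real^'n) \<times> (real^'d) \<Rightarrow> real^'n"
  assumes diff: "\<forall>\<^sub>F (x, p) in nhds (xb, pb). (\<lambda>y. f (y, p)) differentiable (at x)"
    and jac: "isCont (\<lambda>(x, p). jacobian (\<lambda>y. f (y, p)) (at x)) (xb, pb)"
    and lip: "\<exists>U\<^sub>0 P\<^sub>0 L\<^sub>0. xb \<in> interior U\<^sub>0 \<and> pb \<in> interior P\<^sub>0 \<and> L\<^sub>0 > 0 \<and>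
      (\<forall>x\<in>U\<^sub>0. \<forall>p1\<in>P\<^sub>0. \<forall>p2\<in>P\<^sub>0. norm (f (x, p1) - f (x, p2)) \<le> L\<^sub>0 * norm (p1 - p2))"
  obtains \<rho> Lf where "\<rho> > 0" "Lf > 0"
    "\<And>x y p q. x \<in> cball xb \<rho> \<Longrightarrow> y \<in> cball xb \<rho> \<Longrightarrow> p \<in> cball pb \<rho> \<Longrightarrow> q \<in> cball pb \<rho> \<Longrightarrow>
      norm (f (x, p) - f (y, q)) \<le> Lf * (norm (x - y) + norm (p - q))"
    "\<And>x p. x \<in> cball xb \<rho> \<Longrightarrow> p \<in> cball pb \<rho> \<Longrightarrow> (\<lambda>y. f (y, p)) differentiable (at x)"
proof -
  let ?J = "\<lambda>z. jacobian (\<lambda>y. f (y, snd z)) (at (fst z))"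
  obtain U0 P0 L0 where L0: "xb \<in> interior U0" "pb \<in> interior P0" "L0 > 0"
    "\<And>x p1 p2. x \<in> U0 \<Longrightarrow> p1 \<in> P0 \<Longrightarrow> p2 \<in> P0 \<Longrightarrow> norm (f (x, p1) - f (x, p2)) \<le> L0 * norm (p1 - p2)"
    using lip by blast
  have J: "isCont ?J (xb, pb)" using jac by (simp add: case_prod_beta')
  then have "(?J \<longlongrightarrow> ?J (xb, pb)) (nhds (xb, pb))" by (rule isContD[unfolded tendsto_at_iff_tendsto_nhds])
  then have "eventually (\<lambda>z. dist (?J z) (?J (xb, pb)) < 1) (nhds (xb, pb))" by (rule tendstoD) simp
  moreover have "eventually (\<lambda>z. z \<in> interior U0 \<times> interior P0) (nhds (xb, pb))"
    using L0 by (intro eventually_nhds_in_open) (auto intro: open_Times)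
  moreover have "eventually (\<lambda>z. (\<lambda>y. f (y, snd z)) differentiable (at (fst z))) (nhds (xb, pb))"
    using diff by (simp add: case_prod_beta')
  ultimately have "eventually (\<lambda>z. dist (?J z) (?J (xb, pb)) < 1 \<and> z \<in> interior U0 \<times> interior P0 \<and>
      (\<lambda>y. f (y, snd z)) differentiable (at (fst z))) (nhds (xb, pb))"
    by eventually_elim blast
  then obtain \<rho> where \<rho>: "\<rho> > 0" and ev: "\<And>x p. x \<in> cball xb \<rho> \<Longrightarrow> p \<in> cball pb \<rho> \<Longrightarrow>
      dist (?J (x, p)) (?J (xb, pb)) < 1 \<and> (x, p) \<in> interior U0 \<times> interior P0 \<and>
      (\<lambda>y. f (y, snd (x, p))) differentiable (at (fst (x, p)))"
    using eventually_nhds_Pair_cball by blast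
  have df: "(\<lambda>y. f (y, p)) differentiable (at x)" if "x \<in> cball xb \<rho>" "p \<in> cball pb \<rho>" for x p
    using ev[OF that] by simp
  define C where "C = real CARD('n) * real CARD('n) * (norm (?J (xb, pb)) + 1)"
  have C0: "C \<ge> 0" by (simp add: C_def)
  have onorm: "onorm ((*v) (?J (x, p))) \<le> C" if "x \<in> cball xb \<rho>" "p \<in> cball pb \<rho>" for x p
    unfolding C_def
  proof (rule onorm_le_matrix_component)
    fix i j
    have "\<bar>?J (x, p) $ i $ j\<bar> \<le> norm (?J (x, p))"
      using component_le_norm_cart[of "?J (x, p) $ i" j] Finite_Cartesian_Product.norm_nth_le[of "?J (x, p)" i] by simp
    also have "\<dots> \<le> norm (?J (xb, pb)) + 1"
      using ev[OF that] norm_triangle_ineq2[of "?J (x, p)" "?J (xb, pb)"] by (simp add: dist_norm)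
    finally show "\<bar>?J (x, p) $ i $ j\<bar> \<le> norm (?J (xb, pb)) + 1" .
  qed
  have fx: "norm (f (x, p) - f (y, p)) \<le> C * norm (x - y)"
    if "x \<in> cball xb \<rho>" "y \<in> cball xb \<rho>" "p \<in> cball pb \<rho>" for x y p
  proof (rule differentiable_bound[of "cball xb \<rho>" "\<lambda>y. f (y, p)" "\<lambda>z u. ?J (z, p) *v u"])
    fix z assume z: "z \<in> cball xb \<rho>"
    show "((\<lambda>y. f (y, p)) has_derivative (\<lambda>u. ?J (z, p) *v u)) (at z within cball xb \<rho>)"
      using df[OF z that(3)] by (subst has_derivative_at_withinI) (simp_all add: jacobian_works)
    show "onorm (\<lambda>u. ?J (z, p) *v u) \<le> C" using onorm[OF z that(3)] .
  qed (use that in auto)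
  show thesis
  proof (rule that[of \<rho> "C + L0"])
    show "\<rho> > 0" "C + L0 > 0" using \<rho> C0 L0(3) by auto
    show "norm (f (x, p) - f (y, q)) \<le> (C + L0) * (norm (x - y) + norm (p - q))"
      if "x \<in> cball xb \<rho>" "y \<in> cball xb \<rho>" "p \<in> cball pb \<rho>" "q \<in> cball pb \<rho>" for x y p q
    proof -
      have "y \<in> U0" "p \<in> P0" "q \<in> P0"
        using ev[OF that(2,3)] ev[OF that(2,4)] interior_subset by auto
      then have "norm (f (y, p) - f (y, q)) \<le> L0 * norm (p - q)" by (rule L0(4))
      moreover have "norm (f (x, p) - f (y, p)) \<le> C * norm (x - y)" by (rule fx[OF that(1,2,3)])
      moreover have "norm (f (x, p) - f (y, q)) \<le> norm (f (x, p) - f (y, p)) + norm (f (y, p) - f (y, q))"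
        using norm_triangle_ineq[of "f (x, p) - f (y, p)" "f (y, p) - f (y, q)"] by simp
      moreover have "0 \<le> C * norm (p - q)" "0 \<le> L0 * norm (x - y)" using C0 L0(3) by auto
      ultimately show ?thesis by (simp add: algebra_simps)
    qed
  qed (rule df)
qed

lemma crcq_nbhd_exists:
  fixes \<phi> :: "'m::finite \<Rightarrow> (real^'n) \<times> (real^'d) \<Rightarrow> real"
  assumes "partial_CRCQ \<phi> xb pb"
  obtains \<rho> where "\<rho> > 0" "\<And>J x p. J \<subseteq> active_set \<phi> xb pb \<Longrightarrow> x \<in> cball xb \<rho> \<Longrightarrow> p \<in> cball pb \<rho> \<Longrightarrow>
    dim (gradients \<phi> x p ` J) = dim (gradients \<phi> xb pb ` J)"
proof -
  obtain W where W: "(xb, pb) \<in> interior W"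
    and rank: "\<And>J. J \<subseteq> active_set \<phi> xb pb \<Longrightarrow> \<exists>r. \<forall>(x, p)\<in>W. dim (gradients \<phi> x p ` J) = r"
    using assms unfolding partial_CRCQ_def by blast
  have "eventually (\<lambda>z. z \<in> interior W) (nhds (xb, pb))" using W by (intro eventually_nhds_in_open) auto
  then obtain \<rho> where \<rho>: "\<rho> > 0" "\<And>x p. x \<in> cball xb \<rho> \<Longrightarrow> p \<in> cball pb \<rho> \<Longrightarrow> (x, p) \<in> interior W"
    using eventually_nhds_Pair_cball by blast
  show thesis
  proof (rule that[OF \<rho>(1)])
    fix J x p assume J: "J \<subseteq> active_set \<phi> xb pb" and "x \<in> cball xb \<rho>" "p \<in> cball pb \<rho>"
    then have in_W: "(x, p) \<in> W" "(xb, pb) \<in> W" using \<rho>(2) W interior_subset by blast+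
    obtain r where "\<forall>(x, p)\<in>W. dim (gradients \<phi> x p ` J) = r" using rank[OF J] by blast
    from bspec[OF this in_W(1)] bspec[OF this in_W(2)]
    show "dim (gradients \<phi> x p ` J) = dim (gradients \<phi> xb pb ` J)" by simp
  qed
qed

text \<open>There are finitely many independent subfamilies at the reference point, each with a positive lower bound. Half of the smallest
bound survives on a smaller neighborhood, and by constant rank no other subfamily is independent there.\<close>

lemma (in crcq_nbhd) uniform_lower_bound:
  obtains \<gamma> \<rho>' where "\<gamma> > 0" "\<rho>' > 0" "\<rho>' \<le> \<rho>"
    "\<And>x p \<mu>. x \<in> cball xb \<rho>' \<Longrightarrow> p \<in> cball pb \<rho>' \<Longrightarrow> supp \<mu> \<subseteq> active_set \<phi> xb pb \<Longrightarrow>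
      indep_family (G x p) (supp \<mu>) \<Longrightarrow> \<gamma> * norm \<mu> \<le> norm (comb (G x p) \<mu>)"
proof -
  have "\<exists>\<gamma>>0. indep_family (G xb pb) J \<longrightarrow> (\<forall>\<mu>. supp \<mu> \<subseteq> J \<longrightarrow> \<gamma> * norm \<mu> \<le> norm (comb (G xb pb) \<mu>))" for J
    using indep_family_lower_bound[of "G xb pb" J] zero_less_one by blast
  then obtain \<gamma>J where \<gamma>J: "\<And>J. \<gamma>J J > 0" "\<And>J \<mu>. indep_family (G xb pb) J \<Longrightarrow> supp \<mu> \<subseteq> J \<Longrightarrow>
      \<gamma>J J * norm \<mu> \<le> norm (comb (G xb pb) \<mu>)" by metis
  define \<gamma> where "\<gamma> = Min (range \<gamma>J)"
  have \<gamma>: "\<gamma> > 0" "\<And>J. \<gamma> \<le> \<gamma>J J" using \<gamma>J(1) by (auto simp: \<gamma>_def)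
  let ?N = "real CARD('m)"
  \<comment> \<open>on this ball the gradients move by at most the fraction of the bound that may be lost\<close>
  define \<rho>' where "\<rho>' = min \<rho> (\<gamma> / (4 * B * ?N))"
  have den: "4 * B * ?N > 0" using B by simp
  have \<rho>': "\<rho>' > 0" "\<rho>' \<le> \<rho>" "\<rho>' * (4 * B * ?N) \<le> \<gamma>"
  proof -
    show "\<rho>' > 0" "\<rho>' \<le> \<rho>" using rho \<gamma>(1) den by (auto simp: \<rho>'_def)
    have "\<rho>' \<le> \<gamma> / (4 * B * ?N)" by (simp add: \<rho>'_def)
    then show "\<rho>' * (4 * B * ?N) \<le> \<gamma>" using den by (simp only: pos_le_divide_eq)
  qed
  show thesis
  proof (rule that[of "\<gamma> / 2" \<rho>'])
    fix x p \<mu> assume x: "x \<in> cball xb \<rho>'" and p: "p \<in> cball pb \<rho>'" and s: "supp \<mu> \<subseteq> active_set \<phi> xb pb"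
      and ind: "indep_family (G x p) (supp \<mu>)"
    have big: "x \<in> cball xb \<rho>" "p \<in> cball pb \<rho>" "xb \<in> cball xb \<rho>" "pb \<in> cball pb \<rho>"
      using x p \<rho>'(2) rho by auto
    have "indep_family (G xb pb) (supp \<mu>)" by (rule indep_family_persists[OF s big ind])
    then have "\<gamma>J (supp \<mu>) * norm \<mu> \<le> norm (comb (G xb pb) \<mu>)" by (rule \<gamma>J(2)) simp
    moreover have "\<gamma> * norm \<mu> \<le> \<gamma>J (supp \<mu>) * norm \<mu>" using \<gamma>(2) by (rule mult_right_mono) simp
    ultimately have 1: "\<gamma> * norm \<mu> \<le> norm (comb (G xb pb) \<mu>)" by linarith
    have "norm (comb (G xb pb) \<mu> - comb (G x p) \<mu>) \<le> (\<Sum>i\<in>UNIV. norm ((\<mu> $ i) *\<^sub>R (G xb pb i - G x p i)))"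
      unfolding comb_diff_family by (rule norm_sum)
    also have "\<dots> \<le> (\<Sum>i\<in>(UNIV::'m set). norm \<mu> * (B * (2 * \<rho>')))"
    proof (rule sum_mono)
      fix i
      have "norm (G xb pb i - G x p i) \<le> B * (norm (xb - x) + norm (pb - p))" using big by (intro grad_lip)
      also have "\<dots> \<le> B * (2 * \<rho>')" using x p B by (intro mult_left_mono) (auto simp: dist_norm)
      finally show "norm ((\<mu> $ i) *\<^sub>R (G xb pb i - G x p i)) \<le> norm \<mu> * (B * (2 * \<rho>'))"
        unfolding norm_scaleR using component_le_norm_cart[of \<mu> i] by (intro mult_mono) auto
    qed
    also have "\<dots> = \<rho>' * (4 * B * ?N) / 2 * norm \<mu>" by simp
    also have "\<dots> \<le> \<gamma> / 2 * norm \<mu>" by (intro mult_right_mono divide_right_mono \<rho>'(3)) auto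
    finally have "norm (comb (G xb pb) \<mu> - comb (G x p) \<mu>) \<le> \<gamma> / 2 * norm \<mu>" .
    then show "\<gamma> / 2 * norm \<mu> \<le> norm (comb (G x p) \<mu>)"
      using 1 norm_triangle_ineq2[of "comb (G xb pb) \<mu>" "comb (G x p) \<mu>"] by simp
  qed (use \<gamma> \<rho>' in auto)
qed

section \<open>The equivalence\<close>

text \<open>The stability inequality and the triangle inequality give \<open>2 \<kappa> \<parallel>\<Delta>\<theta>\<parallel> \<le> 2 \<parallel>\<Delta>v\<parallel> + l \<parallel>\<Delta>p\<parallel>\<close>.\<close>

lemma lipschitz_localization_if_fully_stable:
  assumes "lipschitzian_fully_stable S xb vb pb"
  shows "lipschitz_localization S xb vb pb"
proof -
  obtain V Q U \<theta> \<kappa> l where int: "vb \<in> interior V" "pb \<in> interior Q" "xb \<in> interior U"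
    and loc: "single_valued_localization S V Q U \<theta>" and "\<kappa> > 0" "l > 0"
    and main: "\<And>v1 v2 p1 p2. v1 \<in> V \<Longrightarrow> v2 \<in> V \<Longrightarrow> p1 \<in> Q \<Longrightarrow> p2 \<in> Q \<Longrightarrow>
       norm ((v1 - v2) - (2 * \<kappa>) *\<^sub>R (\<theta> (v1, p1) - \<theta> (v2, p2))) \<le> norm (v1 - v2) + l * norm (p1 - p2)"
    using assms unfolding lipschitzian_fully_stable_def by blast
  have "((2 + l) / (2 * \<kappa>))-lipschitz_on (V \<times> Q) \<theta>"
  proof (rule lipschitz_onI)
    fix z1 z2 assume "z1 \<in> V \<times> Q" "z2 \<in> V \<times> Q"
    then obtain v1 p1 v2 p2 where z: "z1 = (v1, p1)" "z2 = (v2, p2)" and vp: "v1 \<in> V" "v2 \<in> V" "p1 \<in> Q" "p2 \<in> Q"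
      by auto
    let ?b = "\<theta> (v1, p1) - \<theta> (v2, p2)"
    have "norm ((2 * \<kappa>) *\<^sub>R ?b) \<le> norm ((v1 - v2) - (2 * \<kappa>) *\<^sub>R ?b) + norm (v1 - v2)"
      using norm_triangle_ineq4[of "v1 - v2" "(v1 - v2) - (2 * \<kappa>) *\<^sub>R ?b"] by simp
    also have "\<dots> \<le> 2 * norm (v1 - v2) + l * norm (p1 - p2)" using main[OF vp] by simp
    also have "\<dots> \<le> 2 * dist z1 z2 + l * dist z1 z2"
      using dist_fst_le[of z1 z2] dist_snd_le[of z1 z2] \<open>l > 0\<close>
      by (intro add_mono mult_left_mono) (auto simp: z dist_norm)
    finally have "2 * \<kappa> * dist (\<theta> z1) (\<theta> z2) \<le> (2 + l) * dist z1 z2"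
      using \<open>\<kappa> > 0\<close> by (simp add: z dist_norm distrib_right)
    then show "dist (\<theta> z1) (\<theta> z2) \<le> (2 + l) / (2 * \<kappa>) * dist z1 z2"
      using \<open>\<kappa> > 0\<close> by (simp add: pos_le_divide_eq mult.commute)
  qed (use \<open>\<kappa> > 0\<close> \<open>l > 0\<close> in simp)
  then show ?thesis unfolding lipschitz_localization_def using int loc by blast
qed

theorem theorem6p3:
  fixes f :: "(real^'n) \<times> (real^'d) \<Rightarrow> real^'n"
    and \<phi> :: "'m::finite \<Rightarrow> (real^'n) \<times> (real^'d) \<Rightarrow> real"
    and xb vb :: "real^'n" and pb :: "real^'d"
  assumes sol: "xb \<in> sol_map f \<phi> (vb, pb)"
    and phi_C2: "\<And>i. C2_around (\<phi> i) (xb, pb)"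
    and f_diff: "\<forall>\<^sub>F (x, p) in nhds (xb, pb). (\<lambda>y. f (y, p)) differentiable (at x)"
    and f_jac_cont: "isCont (\<lambda>(x, p). jacobian (\<lambda>y. f (y, p)) (at x)) (xb, pb)"
    and f_lip: "\<exists>U\<^sub>0 P\<^sub>0 L\<^sub>0. xb \<in> interior U\<^sub>0 \<and> pb \<in> interior P\<^sub>0 \<and> L\<^sub>0 > 0 \<and>
      (\<forall>x\<in>U\<^sub>0. \<forall>p1\<in>P\<^sub>0. \<forall>p2\<in>P\<^sub>0. norm (f (x, p1) - f (x, p2)) \<le> L\<^sub>0 * norm (p1 - p2))"
    and mfcq: "partial_MFCQ \<phi> xb pb"
    and crcq: "partial_CRCQ \<phi> xb pb"
  shows "(lipschitzian_fully_stable (sol_map f \<phi>) xb vb pb \<longleftrightarrow> GUSOSC f \<phi> xb pb vb) \<and>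
         (GUSOSC f \<phi> xb pb vb \<longrightarrow> lipschitz_localization (sol_map f \<phi>) xb vb pb)"
proof -
  obtain \<rho>0 B \<tau> d where \<rho>0: "\<rho>0 > 0" "\<And>\<rho>. 0 < \<rho> \<Longrightarrow> \<rho> \<le> \<rho>0 \<Longrightarrow> constraint_nbhd \<phi> xb pb \<rho> B \<tau> d"
    using constraint_nbhd_exists[OF phi_C2 mfcq] by blast
  obtain \<rho>1 Lf where \<rho>1: "\<rho>1 > 0" "Lf > 0"
    "\<And>x y p q. x \<in> cball xb \<rho>1 \<Longrightarrow> y \<in> cball xb \<rho>1 \<Longrightarrow> p \<in> cball pb \<rho>1 \<Longrightarrow> q \<in> cball pb \<rho>1 \<Longrightarrow>
      norm (f (x, p) - f (y, q)) \<le> Lf * (norm (x - y) + norm (p - q))"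
    "\<And>x p. x \<in> cball xb \<rho>1 \<Longrightarrow> p \<in> cball pb \<rho>1 \<Longrightarrow> (\<lambda>y. f (y, p)) differentiable (at x)"
    using lipschitz_data_nbhd_exists[OF f_diff f_jac_cont f_lip] by blast
  obtain \<rho>2 where \<rho>2: "\<rho>2 > 0" "\<And>J x p. J \<subseteq> active_set \<phi> xb pb \<Longrightarrow> x \<in> cball xb \<rho>2 \<Longrightarrow> p \<in> cball pb \<rho>2 \<Longrightarrow>
    dim (gradients \<phi> x p ` J) = dim (gradients \<phi> xb pb ` J)"
    using crcq_nbhd_exists[OF crcq] by blast
  define \<rho>3 where "\<rho>3 = min \<rho>0 (min \<rho>1 \<rho>2)"
  have \<rho>3: "\<rho>3 > 0" using \<rho>0 \<rho>1 \<rho>2 by (simp add: \<rho>3_def)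
  have nbhd: "crcq_variational_nbhd \<phi> xb pb \<rho> B \<tau> d f Lf" if \<rho>: "0 < \<rho>" "\<rho> \<le> \<rho>3" for \<rho>
  proof -
    interpret constraint_nbhd \<phi> xb pb \<rho> B \<tau> d using \<rho> by (intro \<rho>0(2)) (auto simp: \<rho>3_def)
    have sub: "cball xb \<rho> \<subseteq> cball xb \<rho>1" "cball pb \<rho> \<subseteq> cball pb \<rho>1"
      "cball xb \<rho> \<subseteq> cball xb \<rho>2" "cball pb \<rho> \<subseteq> cball pb \<rho>2" using \<rho>(2) by (auto simp: \<rho>3_def)
    show ?thesis
    proof
      show "dim (gradients \<phi> x p ` J) = dim (gradients \<phi> xb pb ` J)"
        if "J \<subseteq> active_set \<phi> xb pb" "x \<in> cball xb \<rho>" "p \<in> cball pb \<rho>" for J x p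
        using that sub by (intro \<rho>2(2)) auto
      show "norm (f (x, p) - f (y, q)) \<le> Lf * (norm (x - y) + norm (p - q))"
        if "x \<in> cball xb \<rho>" "y \<in> cball xb \<rho>" "p \<in> cball pb \<rho>" "q \<in> cball pb \<rho>" for x y p q
        using that sub by (intro \<rho>1(3)) auto
      show "(\<lambda>y. f (y, p)) differentiable (at x)" if "x \<in> cball xb \<rho>" "p \<in> cball pb \<rho>" for x p
        using that sub by (intro \<rho>1(4)) auto
    qed (rule \<rho>1(2))
  qed
  interpret N: crcq_variational_nbhd \<phi> xb pb \<rho>3 B \<tau> d f Lf using \<rho>3 by (intro nbhd) auto
  have base: "xb \<in> ball xb \<rho>3" "pb \<in> cball pb \<rho>3" using \<rho>3 by auto
  obtain \<mu>b where \<mu>b: "kkt \<phi> xb pb \<mu>b" "vb = Lagr f \<phi> xb pb \<mu>b"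
    using sol N.sol_map_iff_kkt[OF base] by blast
  have stable: "lipschitzian_fully_stable (sol_map f \<phi>) xb vb pb" if G: "GUSOSC f \<phi> xb pb vb"
  proof -
    obtain \<eta> l where \<eta>: "\<eta> > 0" "l > 0" and soc: "\<And>x p \<mu> u. x \<in> cball xb \<eta> \<Longrightarrow> p \<in> cball pb \<eta> \<Longrightarrow> kkt \<phi> x p \<mu> \<Longrightarrow>
        Lagr f \<phi> x p \<mu> \<in> cball vb \<eta> \<Longrightarrow> (\<forall>i\<in>supp \<mu>. grad_x (\<phi> i) x p \<bullet> u = 0) \<Longrightarrow>
        (\<forall>i\<in>active_set \<phi> x p. grad_x (\<phi> i) x p \<bullet> u \<le> 0) \<Longrightarrow>
        l * (norm u)\<^sup>2 \<le> (jacobian (\<lambda>y. Lagr f \<phi> y p \<mu>) (at x) *v u) \<bullet> u"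
      using G unfolding GUSOSC_iff_kkt by blast
    obtain \<gamma> \<rho>4 where \<gamma>: "\<gamma> > 0" "\<rho>4 > 0" "\<rho>4 \<le> \<rho>3"
      "\<And>x p \<mu>. x \<in> cball xb \<rho>4 \<Longrightarrow> p \<in> cball pb \<rho>4 \<Longrightarrow> supp \<mu> \<subseteq> active_set \<phi> xb pb \<Longrightarrow>
        indep_family (gradients \<phi> x p) (supp \<mu>) \<Longrightarrow> \<gamma> * norm \<mu> \<le> norm (comb (gradients \<phi> x p) \<mu>)"
      by (rule N.uniform_lower_bound) (rule that)
    define \<rho> where "\<rho> = min \<rho>4 \<eta>"
    have \<rho>: "0 < \<rho>" "\<rho> \<le> \<rho>3" using \<gamma> \<eta> by (auto simp: \<rho>_def)
    have sub: "cball xb \<rho> \<subseteq> cball xb \<rho>4" "cball pb \<rho> \<subseteq> cball pb \<rho>4"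
      "cball xb \<rho> \<subseteq> cball xb \<eta>" "cball pb \<rho> \<subseteq> cball pb \<eta>" "cball vb \<rho> \<subseteq> cball vb \<eta>" by (auto simp: \<rho>_def)
    interpret M: crcq_variational_nbhd \<phi> xb pb \<rho> B \<tau> d f Lf by (rule nbhd[OF \<rho>])
    interpret F: full_stability_nbhd \<phi> xb pb \<rho> B \<tau> d f Lf vb \<mu>b l \<gamma>
    proof
      show "l * (norm u)\<^sup>2 \<le> (jacobian (\<lambda>y. Lagr f \<phi> y p \<mu>) (at x) *v u) \<bullet> u"
        if "x \<in> cball xb \<rho>" "p \<in> cball pb \<rho>" "kkt \<phi> x p \<mu>" "Lagr f \<phi> x p \<mu> \<in> cball vb \<rho>"
          "\<And>i. i \<in> supp \<mu> \<Longrightarrow> grad_x (\<phi> i) x p \<bullet> u = 0"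
          "\<And>i. i \<in> active_set \<phi> x p \<Longrightarrow> grad_x (\<phi> i) x p \<bullet> u \<le> 0" for x p \<mu> u
        using that sub by (intro soc) auto
      show "\<gamma> * norm \<mu> \<le> norm (comb (gradients \<phi> x p) \<mu>)"
        if "x \<in> cball xb \<rho>" "p \<in> cball pb \<rho>" "supp \<mu> \<subseteq> active_set \<phi> xb pb"
          "indep_family (gradients \<phi> x p) (supp \<mu>)" for x p \<mu>
        using that sub by (intro \<gamma>(4)) auto
    qed (use \<mu>b \<eta> \<gamma> in auto)
    show ?thesis by (rule F.fully_stable)
  qed
  moreover have "GUSOSC f \<phi> xb pb vb" if S: "lipschitzian_fully_stable (sol_map f \<phi>) xb vb pb"
  proof -
    obtain V Q U \<theta> \<kappa> l where int: "vb \<in> interior V" "pb \<in> interior Q" "xb \<in> interior U"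
      and loc: "single_valued_localization (sol_map f \<phi>) V Q U \<theta>" and "\<kappa> > 0" "l > 0"
      and main: "\<And>v1 v2 p1 p2. v1 \<in> V \<Longrightarrow> v2 \<in> V \<Longrightarrow> p1 \<in> Q \<Longrightarrow> p2 \<in> Q \<Longrightarrow>
         norm ((v1 - v2) - (2 * \<kappa>) *\<^sub>R (\<theta> (v1, p1) - \<theta> (v2, p2))) \<le> norm (v1 - v2) + l * norm (p1 - p2)"
      using S unfolding lipschitzian_fully_stable_def by blast
    obtain e1 where e1: "e1 > 0" "cball vb e1 \<subseteq> interior V" using int(1) open_contains_cball open_interior by blast
    obtain e2 where e2: "e2 > 0" "cball pb e2 \<subseteq> interior Q" using int(2) open_contains_cball open_interior by blast
    obtain e3 where e3: "e3 > 0" "cball xb e3 \<subseteq> interior U" using int(3) open_contains_cball open_interior by blast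
    define \<eta> where "\<eta> = min (min e1 e2) (min e3 (\<rho>3 / 2))"
    have \<eta>: "\<eta> > 0" "\<eta> < \<rho>3" using e1 e2 e3 \<rho>3 by (auto simp: \<eta>_def)
    have sub: "cball vb \<eta> \<subseteq> interior V" "cball pb \<eta> \<subseteq> Q" "cball xb \<eta> \<subseteq> interior U"
      "cball xb \<eta> \<subseteq> ball xb \<rho>3" "cball pb \<eta> \<subseteq> cball pb \<rho>3"
    proof -
      have le: "\<eta> \<le> e1" "\<eta> \<le> e2" "\<eta> \<le> e3" by (auto simp: \<eta>_def)
      show "cball vb \<eta> \<subseteq> interior V" using e1(2) subset_cball[OF le(1), of vb] by blast
      show "cball pb \<eta> \<subseteq> Q" using e2(2) subset_cball[OF le(2), of pb] interior_subset by blast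
      show "cball xb \<eta> \<subseteq> interior U" using e3(2) subset_cball[OF le(3), of xb] by blast
      show "cball xb \<eta> \<subseteq> ball xb \<rho>3" "cball pb \<eta> \<subseteq> cball pb \<rho>3" using \<eta>(2) by auto
    qed
    have stab: "norm ((v1 - v2) - (2 * \<kappa>) *\<^sub>R (\<theta> (v1, p) - \<theta> (v2, p))) \<le> norm (v1 - v2)"
      if "v1 \<in> V" "v2 \<in> V" "p \<in> Q" for v1 v2 p
      using main[OF that(1,2,3,3)] by simp
    have "\<kappa> * (norm u)\<^sup>2 \<le> (jacobian (\<lambda>y. Lagr f \<phi> y p \<mu>) (at x) *v u) \<bullet> u"
      if "x \<in> cball xb \<eta>" "p \<in> cball pb \<eta>" "kkt \<phi> x p \<mu>" "Lagr f \<phi> x p \<mu> \<in> cball vb \<eta>"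
        "\<forall>i\<in>supp \<mu>. grad_x (\<phi> i) x p \<bullet> u = 0" "\<forall>i\<in>active_set \<phi> x p. grad_x (\<phi> i) x p \<bullet> u \<le> 0" for x p \<mu> u
    proof (rule N.second_order_if_stable[OF loc \<open>\<kappa> > 0\<close> stab])
      show "x \<in> ball xb \<rho>3" "x \<in> interior U" "p \<in> cball pb \<rho>3" "p \<in> Q" "Lagr f \<phi> x p \<mu> \<in> interior V"
        using that sub by blast+
    qed (use that in auto)
    then show ?thesis
      unfolding GUSOSC_iff_kkt using \<mu>b \<eta>(1) \<open>\<kappa> > 0\<close> by blast
  qed
  ultimately show ?thesis using lipschitz_localization_if_fully_stable by blast
qed

end
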